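(* Let $k$ be a field, $0\neq q\in k$, and let $m\le n$ be positive integers. Then the quantum grassmannian $\mathcal{G}_q(m,n)$ is a noetherian domain.
   Context: $\mathcal{O}_q(M_{mn})$ is the (unital associative) $k$-algebra generated by $X_{ij}$, $1\le i\le m$, $1\le j\le n$, subject to the relations, for $1\le i<k\le m$ and $1\le j<l\le n$: $X_{ij}X_{il}=qX_{il}X_{ij}$, $X_{ij}X_{kj}=qX_{kj}X_{ij}$, $X_{il}X_{kj}=X_{kj}X_{il}$, $X_{ij}X_{kl}-X_{kl}X_{ij}=(q-q^{-1})X_{il}X_{kj}$. For $I=\{i_1<\dots<i_s\}\subseteq\{1,\dots,m\}$ and $J=\{j_1<\dots<j_s\}\subseteq\{1,\dots,n\}$, the quantum minor is $[I|J]=\sum_{\sigma\in S_s}(-q)^{\ell(\sigma)}X_{i_1 j_{\sigma(1)}}\cdots X_{i_s j_{\sigma(s)}}$, where $\ell(\sigma)$ is the length of $\sigma$. For an $m$-element subset $J\subseteq\{1,\dots,n\}$ write $[J]=[\{1,\dots,m\}|J]$. The quantum grassmannian $\mathcal{G}_q(m,n)$ is the $k$-subalgebra of $\mathcal{O}_q(M_{mn})$ generated by all the $m\times m$ quantum minors $[J]$. Noetherian means left and right noetherian. *)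

theory Defs
  imports
    "HOL-Algebra.Algebra"
    "HOL-Combinatorics.Permutations"
    "HOL-Library.Poly_Mapping"
begin

section \<open>Noncommutative noetherian rings and domains\<close>

text \<open>The locales \<open>noetherian_ring\<close> and \<open>domain\<close> of HOL-Algebra refer to two-sided ideals and to
  commutative rings, respectively; here the one-sided and the noncommutative notions are needed.\<close>

locale left_ideal = additive_subgroup I R + ring R for I and R (structure) +
  assumes I_l_closed: "\<lbrakk> a \<in> I; x \<in> carrier R \<rbrakk> \<Longrightarrow> x \<otimes> a \<in> I"

locale right_ideal = additive_subgroup I R + ring R for I and R (structure) +
  assumes I_r_closed: "\<lbrakk> a \<in> I; x \<in> carrier R \<rbrakk> \<Longrightarrow> a \<otimes> x \<in> I"

definition gen_left_ideal :: "('a, 'b) ring_scheme \<Rightarrow> 'a set \<Rightarrow> 'a set" where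
  "gen_left_ideal R A = \<Inter>{I. left_ideal I R \<and> A \<subseteq> I}"

definition gen_right_ideal :: "('a, 'b) ring_scheme \<Rightarrow> 'a set \<Rightarrow> 'a set" where
  "gen_right_ideal R A = \<Inter>{I. right_ideal I R \<and> A \<subseteq> I}"

locale left_noetherian_ring = ring +
  assumes left_fin_gen:
    "left_ideal I R \<Longrightarrow> \<exists>A \<subseteq> carrier R. finite A \<and> I = gen_left_ideal R A"

locale right_noetherian_ring = ring +
  assumes right_fin_gen:
    "right_ideal I R \<Longrightarrow> \<exists>A \<subseteq> carrier R. finite A \<and> I = gen_right_ideal R A"

locale lr_noetherian_ring = left_noetherian_ring + right_noetherian_ring

locale nc_domain = ring +
  assumes one_not_zero: "\<one> \<noteq> \<zero>"
    and integral: "\<lbrakk> a \<otimes> b = \<zero>; a \<in> carrier R; b \<in> carrier R \<rbrakk> \<Longrightarrow> a = \<zero> \<or> b = \<zero>"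


section \<open>Free associative algebras\<close>

text \<open>The free monoid, written additively so that the convolution product of
  \<^typ>\<open>'a \<Rightarrow>\<^sub>0 'b\<close> makes \<open>'v word \<Rightarrow>\<^sub>0 'k\<close> the free associative \<open>'k\<close>-algebra on \<open>'v\<close>.\<close>

datatype 'v word = Word (letters: "'v list")

instantiation word :: (type) monoid_add
begin

definition zero_word :: "'v word" where "zero_word = Word []"

definition plus_word :: "'v word \<Rightarrow> 'v word \<Rightarrow> 'v word" where
  "plus_word u v = Word (letters u @ letters v)"

instance by standard (simp_all add: zero_word_def plus_word_def)

end

type_synonym ('v, 'k) ncpoly = "'v word \<Rightarrow>\<^sub>0 'k"

definition ncconst :: "'k \<Rightarrow> ('v, 'k::field) ncpoly" where
  "ncconst c = Poly_Mapping.single 0 c"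

definition ncvar :: "'v \<Rightarrow> ('v, 'k::field) ncpoly" where
  "ncvar v = Poly_Mapping.single (Word [v]) 1"

definition free_algebra :: "'v set \<Rightarrow> ('v, 'k::field) ncpoly ring" where
  "free_algebra V =
    \<lparr> carrier = {p. \<forall>w \<in> Poly_Mapping.keys p. set (letters w) \<subseteq> V},
      monoid.mult = (*), one = 1, ring.zero = 0, ring.add = (+) \<rparr>"

lemma word_simps [simp]: "letters 0 = []" "letters (u + v) = letters u @ letters v"
  by (simp_all add: zero_word_def plus_word_def)

lemma free_algebra_closed:
  assumes "p \<in> carrier (free_algebra V)" "r \<in> carrier (free_algebra V)"
  shows "p + r \<in> carrier (free_algebra V)" "p * r \<in> carrier (free_algebra V)"
    "p - r \<in> carrier (free_algebra V)"
proof -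
  have key: "w \<in> Poly_Mapping.keys p \<Longrightarrow> x \<in> set (letters w) \<Longrightarrow> x \<in> V"
    "w \<in> Poly_Mapping.keys r \<Longrightarrow> x \<in> set (letters w) \<Longrightarrow> x \<in> V" for w x
    using assms by (auto simp: free_algebra_def)
  show "p + r \<in> carrier (free_algebra V)"
    using key Poly_Mapping.keys_add[of p r] by (fastforce simp: free_algebra_def)
  show "p * r \<in> carrier (free_algebra V)"
    using key keys_mult[of p r] by (fastforce simp: free_algebra_def)
  have "Poly_Mapping.keys (p - r) \<subseteq> Poly_Mapping.keys p \<union> Poly_Mapping.keys r"
    by (auto simp: in_keys_iff lookup_minus)
  then show "p - r \<in> carrier (free_algebra V)"
    using key by (fastforce simp: free_algebra_def)
qed

lemma free_algebra_uminus_closed: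
  "p \<in> carrier (free_algebra V) \<Longrightarrow> - p \<in> carrier (free_algebra V)"
  by (simp add: free_algebra_def in_keys_iff)

lemma ncconst_closed [simp]: "ncconst c \<in> carrier (free_algebra V)"
  by (simp add: ncconst_def free_algebra_def)

lemma ncvar_closed: "v \<in> V \<Longrightarrow> ncvar v \<in> carrier (free_algebra V)"
  by (simp add: ncvar_def free_algebra_def)

lemma free_algebra_ring:
  "ring (free_algebra (V :: 'v set) :: ('v, 'k::field) ncpoly ring)"
proof (rule ringI)
  show "abelian_group (free_algebra V :: ('v, 'k) ncpoly ring)"
  proof (rule abelian_groupI)
    fix p :: "('v, 'k) ncpoly"
    assume "p \<in> carrier (free_algebra V)"
    from free_algebra_uminus_closed[OF this]
    show "\<exists>r \<in> carrier (free_algebra V). r \<oplus>\<^bsub>free_algebra V\<^esub> p = \<zero>\<^bsub>free_algebra V\<^esub>"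
      by (rule bexI[rotated]) (simp add: free_algebra_def)
  next
    show "\<zero>\<^bsub>free_algebra V\<^esub> \<in> carrier (free_algebra V :: ('v, 'k) ncpoly ring)"
      by (simp add: free_algebra_def)
  next
    fix p r :: "('v, 'k) ncpoly"
    assume "p \<in> carrier (free_algebra V)" "r \<in> carrier (free_algebra V)"
    from free_algebra_closed(1)[OF this]
    show "p \<oplus>\<^bsub>free_algebra V\<^esub> r \<in> carrier (free_algebra V)"
      by (simp add: free_algebra_def)
  qed (simp_all add: free_algebra_def ac_simps)
  show "Group.monoid (free_algebra V :: ('v, 'k) ncpoly ring)"
  proof (rule Group.monoidI)
    fix p r :: "('v, 'k) ncpoly"
    assume "p \<in> carrier (free_algebra V)" "r \<in> carrier (free_algebra V)"
    from free_algebra_closed(2)[OF this]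
    show "p \<otimes>\<^bsub>free_algebra V\<^esub> r \<in> carrier (free_algebra V)"
      by (simp add: free_algebra_def)
  qed (simp_all add: free_algebra_def mult.assoc)
qed (simp_all add: free_algebra_def algebra_simps)


section \<open>Quantum matrices\<close>

text \<open>Each relation is imposed for all values of the indices that occur in it; in particular the
  first family holds in every row and the second one in every column (also when \<open>m = 1\<close> or
  \<open>n = 1\<close>).\<close>

definition qmatrix_relations :: "'k::field \<Rightarrow> nat \<Rightarrow> nat \<Rightarrow> (nat \<times> nat, 'k) ncpoly set" where
  "qmatrix_relations q m n =
     {ncvar (i, j) * ncvar (i, l) - ncconst q * ncvar (i, l) * ncvar (i, j) | i j l.
        1 \<le> i \<and> i \<le> m \<and> 1 \<le> j \<and> j < l \<and> l \<le> n}
   \<union> {ncvar (i, j) * ncvar (k, j) - ncconst q * ncvar (k, j) * ncvar (i, j) | i k j.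
        1 \<le> i \<and> i < k \<and> k \<le> m \<and> 1 \<le> j \<and> j \<le> n}
   \<union> {ncvar (i, l) * ncvar (k, j) - ncvar (k, j) * ncvar (i, l) | i k j l.
        1 \<le> i \<and> i < k \<and> k \<le> m \<and> 1 \<le> j \<and> j < l \<and> l \<le> n}
   \<union> {ncvar (i, j) * ncvar (k, l) - ncvar (k, l) * ncvar (i, j)
        - ncconst (q - inverse q) * ncvar (i, l) * ncvar (k, j) | i k j l.
        1 \<le> i \<and> i < k \<and> k \<le> m \<and> 1 \<le> j \<and> j < l \<and> l \<le> n}"

abbreviation free_matrix_algebra :: "nat \<Rightarrow> nat \<Rightarrow> (nat \<times> nat, 'k::field) ncpoly ring" where
  "free_matrix_algebra m n \<equiv> free_algebra ({1..m} \<times> {1..n})"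

definition qmatrix_ideal :: "'k::field \<Rightarrow> nat \<Rightarrow> nat \<Rightarrow> (nat \<times> nat, 'k) ncpoly set" where
  "qmatrix_ideal q m n = Idl\<^bsub>free_matrix_algebra m n\<^esub> (qmatrix_relations q m n)"

definition qmatrix :: "'k::field \<Rightarrow> nat \<Rightarrow> nat \<Rightarrow> (nat \<times> nat, 'k) ncpoly set ring" where
  "qmatrix q m n = free_matrix_algebra m n Quot qmatrix_ideal q m n"

definition qmatrix_scalar ::
    "'k::field \<Rightarrow> nat \<Rightarrow> nat \<Rightarrow> 'k \<Rightarrow> (nat \<times> nat, 'k) ncpoly set" where
  "qmatrix_scalar q m n c = qmatrix_ideal q m n +>\<^bsub>free_matrix_algebra m n\<^esub> ncconst c"

definition qmatrix_gen ::
    "'k::field \<Rightarrow> nat \<Rightarrow> nat \<Rightarrow> nat \<Rightarrow> nat \<Rightarrow> (nat \<times> nat, 'k) ncpoly set" where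
  "qmatrix_gen q m n i j = qmatrix_ideal q m n +>\<^bsub>free_matrix_algebra m n\<^esub> ncvar (i, j)"

lemma qmatrix_relations_closed:
  "qmatrix_relations q m n \<subseteq> carrier (free_matrix_algebra m n)"
  unfolding qmatrix_relations_def
  by (safe; intro free_algebra_closed ncvar_closed ncconst_closed) auto

lemma qmatrix_ideal_ideal: "ideal (qmatrix_ideal q m n) (free_matrix_algebra m n)"
  unfolding qmatrix_ideal_def
  by (rule ring.genideal_ideal[OF free_algebra_ring qmatrix_relations_closed])

lemma qmatrix_ring: "ring (qmatrix q m n)"
  unfolding qmatrix_def by (rule ideal.quotient_is_ring[OF qmatrix_ideal_ideal])

lemma qmatrix_proj_closed:
  "p \<in> carrier (free_matrix_algebra m n) \<Longrightarrow>
    qmatrix_ideal q m n +>\<^bsub>free_matrix_algebra m n\<^esub> p \<in> carrier (qmatrix q m n)"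
  using ring_hom_closed[OF ideal.rcos_ring_hom[OF qmatrix_ideal_ideal]]
  by (simp add: qmatrix_def)

lemma qmatrix_scalar_closed: "qmatrix_scalar q m n c \<in> carrier (qmatrix q m n)"
  unfolding qmatrix_scalar_def by (intro qmatrix_proj_closed ncconst_closed)

lemma qmatrix_gen_closed:
  "\<lbrakk> i \<in> {1..m}; j \<in> {1..n} \<rbrakk> \<Longrightarrow> qmatrix_gen q m n i j \<in> carrier (qmatrix q m n)"
  unfolding qmatrix_gen_def by (intro qmatrix_proj_closed ncvar_closed) auto


section \<open>Quantum minors and the quantum grassmannian\<close>

definition perm_length :: "nat \<Rightarrow> (nat \<Rightarrow> nat) \<Rightarrow> nat" where
  "perm_length s \<sigma> = card {(a, b). a < b \<and> b < s \<and> \<sigma> b < \<sigma> a}"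

text \<open>Permutations act on positions \<open>0, \<dots>, s - 1\<close>, so \<open>sorted_list_of_set I ! a\<close> is the
  \<open>a + 1\<close>-st element of \<open>I\<close>. Used only for finite \<open>I\<close> and \<open>J\<close> of the same size.\<close>

definition qminor ::
    "'k::field \<Rightarrow> nat \<Rightarrow> nat \<Rightarrow> nat set \<Rightarrow> nat set \<Rightarrow> (nat \<times> nat, 'k) ncpoly set" where
  "qminor q m n I J =
    (\<Oplus>\<^bsub>qmatrix q m n\<^esub> \<sigma> \<in> {\<sigma>. \<sigma> permutes {..<card I}}.
       qmatrix_scalar q m n ((- q) ^ perm_length (card I) \<sigma>) \<otimes>\<^bsub>qmatrix q m n\<^esub>
       foldr (\<otimes>\<^bsub>qmatrix q m n\<^esub>)
         (map (\<lambda>a. qmatrix_gen q m n (sorted_list_of_set I ! a) (sorted_list_of_set J ! \<sigma> a))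
           [0..<card I])
         \<one>\<^bsub>qmatrix q m n\<^esub>)"

definition maximal_qminors :: "'k::field \<Rightarrow> nat \<Rightarrow> nat \<Rightarrow> (nat \<times> nat, 'k) ncpoly set set" where
  "maximal_qminors q m n = {qminor q m n {1..m} J | J. J \<subseteq> {1..n} \<and> card J = m}"

text \<open>The \<open>k\<close>-subalgebra generated by a set is the subring generated by that set together with the
  scalars.\<close>

definition quantum_grassmannian ::
    "'k::field \<Rightarrow> nat \<Rightarrow> nat \<Rightarrow> (nat \<times> nat, 'k) ncpoly set ring" where
  "quantum_grassmannian q m n =
    (qmatrix q m n)
      \<lparr>carrier := generate_ring (qmatrix q m n)
         (range (qmatrix_scalar q m n) \<union> maximal_qminors q m n)\<rparr>"

lemma qminor_closed:
  assumes I: "I \<subseteq> {1..m}" and J: "J \<subseteq> {1..n}" and card: "card I = card J"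
  shows "qminor q m n I J \<in> carrier (qmatrix q m n)"
proof -
  interpret R: ring "qmatrix q m n" by (rule qmatrix_ring)
  have fin: "finite I" "finite J" using I J finite_subset by blast+
  have prod: "foldr (\<otimes>\<^bsub>qmatrix q m n\<^esub>) xs \<one>\<^bsub>qmatrix q m n\<^esub> \<in> carrier (qmatrix q m n)"
    if "set xs \<subseteq> carrier (qmatrix q m n)" for xs
    using that by (induction xs) auto
  have "qmatrix_gen q m n (sorted_list_of_set I ! a) (sorted_list_of_set J ! \<sigma> a)
      \<in> carrier (qmatrix q m n)" if "\<sigma> permutes {..<card I}" "a < card I" for \<sigma> a
  proof -
    have "\<sigma> a < card J" using permutes_in_image[OF that(1)] that(2) card by auto
    then have "sorted_list_of_set I ! a \<in> I" "sorted_list_of_set J ! \<sigma> a \<in> J"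
      using fin that(2) nth_mem[of _ "sorted_list_of_set I"] nth_mem[of _ "sorted_list_of_set J"]
      by auto
    with I J show ?thesis by (blast intro: qmatrix_gen_closed)
  qed
  then show ?thesis
    unfolding qminor_def
    by (intro R.finsum_closed Pi_I R.m_closed qmatrix_scalar_closed prod) auto
qed

lemma quantum_grassmannian_ring: "ring (quantum_grassmannian q m n)"
  unfolding quantum_grassmannian_def
  by (rule ring.generate_ring_is_ring[OF qmatrix_ring])
    (auto simp: maximal_qminors_def intro!: qmatrix_scalar_closed qminor_closed)

end

theory Submission
  imports Defs
    "HOL-Library.Multiset_Order"
    "HOL-Library.Product_Lexorder"
    "HOL-Library.Nat_Bijection"
    "HOL-Combinatorics.Multiset_Permutations"
begin

text \<open>
  Noetherianity. Moving the antisymmetrised rows of one maximal minor through another by means of the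
  Hecke relations gives, for column sets \<open>I\<close>, \<open>J\<close>, a relation \<open>[I] [J] = c [J] [I] + \<dots>\<close> with \<open>c \<noteq> 0\<close>,
  where the remaining terms \<open>[K] [L]\<close> have smaller weight for the weight \<open>C - (\<Sum>J)\<^sup>2\<close> of \<open>[J]\<close>. Hence
  products of minors commute up to units and lower terms, ordered monomials span, and every one-sided
  ideal is finitely generated by Dickson's lemma applied to leading exponents. Linear independence of
  the ordered monomials is not needed for this.

  Integrality. The quantum matrix algebra acts on functions of integer exponents by sums of shifts,
  built from triangular quantum matrices one row at a time. Each generator \<open>X\<^sub>i\<^sub>j\<close> acts with a unique
  term of largest weight, so ordered monomials are independent, the action is faithful, and leading
  terms multiply. Identities between minors are therefore checked in a ring of linear operators.
\<close>

section \<open>Noetherianity from leading terms\<close>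

text \<open>The grassmannian is given as a subalgebra, without a presentation, and no basis of it is
  determined. The commutation relations of minors are homogeneous in the total column sum, so no
  weight linear in that sum can drop; the constant \<open>C\<close> merely keeps the weight a
  natural number, as well-foundedness requires. The sorting argument runs twice: on the generators
  \<open>X_ij\<close> with weight \<open>i * j\<close>, where it makes ordered monomials span the
  quantum matrix algebra, and on the maximal minors. The quotient ring lives on cosets, whereas the
  determinant computations want a type class ring. So every identity is stated either for
  polynomials modulo the ideal of relations or for linear operators. Coming back from operators to
  polynomials is faithfulness, and a single computation of leading terms gives faithfulness and
  integrality together. This is why the integrality argument for quantum matrices precedes the
  commutation relations of minors in the grassmannian. Only nonzero coefficients and powers of
  \<open>q\<close> are ever inverted, so roots of unity are covered.\<close>

locale central_scalars =
  fixes s :: "'k::field \<Rightarrow> 'a::ring_1"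
  assumes s_add: "s (a + b) = s a + s b"
    and s_mult: "s (a * b) = s a * s b"
    and s_one: "s 1 = 1"
    and s_comm: "x * s c = s c * x"
begin

sublocale vs: vector_space "\<lambda>c x. s c * x"
  by unfold_locales (simp_all add: s_add s_mult s_one algebra_simps)

lemma s_zero [simp]: "s 0 = 0"
  using s_add[of 0 0] by simp

lemma s_minus: "s (- a) = - s a"
  using s_add[of a "- a"] by (simp add: eq_neg_iff_add_eq_0 add.commute)

lemma s_diff: "s (a - b) = s a - s b"
  using s_add[of a "- b"] by (simp add: s_minus)

lemma s_left_comm: "x * (s c * y) = s c * (x * y)"
  by (metis mult.assoc s_comm)

text \<open>Coefficients are attached to indices and not to the elements \<open>g \<beta>\<close>:
  without linear independence, different indices may give equal elements.\<close>

lemma span_family: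
  assumes "vs.subspace N" "x \<in> vs.span ({g \<beta> |\<beta>. \<beta> \<in> P} \<union> N)"
  shows "\<exists>F c. finite F \<and> F \<subseteq> P \<and> (\<forall>\<beta>\<in>F. c \<beta> \<noteq> 0) \<and> x - (\<Sum>\<beta>\<in>F. s (c \<beta>) * g \<beta>) \<in> N"
proof -
  have "\<exists>c. finite {\<beta>. c \<beta> \<noteq> 0} \<and> {\<beta>. c \<beta> \<noteq> 0} \<subseteq> P \<and> x - (\<Sum>\<beta> | c \<beta> \<noteq> 0. s (c \<beta>) * g \<beta>) \<in> N"
    using assms(2)
  proof (induction rule: vs.span_induct_alt)
    case base
    show ?case using vs.subspace_0[OF assms(1)] by (intro exI[of _ "\<lambda>_. 0"]) auto
  next
    case (step a x y)
    then obtain c where c: "finite {\<beta>. c \<beta> \<noteq> 0}" "{\<beta>. c \<beta> \<noteq> 0} \<subseteq> P"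
      "y - (\<Sum>\<beta> | c \<beta> \<noteq> 0. s (c \<beta>) * g \<beta>) \<in> N" by blast
    show ?case
    proof (cases "x \<in> N")
      case True
      have "s a * x + (y - (\<Sum>\<beta> | c \<beta> \<noteq> 0. s (c \<beta>) * g \<beta>)) \<in> N"
        using True c(3) assms(1) by (intro vs.subspace_add vs.subspace_scale)
      then show ?thesis using c by (intro exI[of _ c]) (simp add: algebra_simps)
    next
      case False
      then obtain \<alpha> where \<alpha>: "x = g \<alpha>" "\<alpha> \<in> P" using step.hyps by auto
      define d where "d = c(\<alpha> := c \<alpha> + a)"
      \<comment> \<open>Adding \<open>a\<close> may cancel the coefficient of \<alpha>, so the old
        and the new sum are compared over a set containing both supports.\<close>
      have fin: "finite (insert \<alpha> {\<beta>. c \<beta> \<noteq> 0})" using c(1) by simp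
      have sub: "{\<beta>. d \<beta> \<noteq> 0} \<subseteq> insert \<alpha> {\<beta>. c \<beta> \<noteq> 0}" by (auto simp: d_def)
      have "(\<Sum>\<beta> | d \<beta> \<noteq> 0. s (d \<beta>) * g \<beta>) = (\<Sum>\<beta>\<in>insert \<alpha> {\<beta>. c \<beta> \<noteq> 0}. s (d \<beta>) * g \<beta>)"
        using fin sub by (intro sum.mono_neutral_left) auto
      also have "\<dots> = s (d \<alpha>) * g \<alpha> + (\<Sum>\<beta>\<in>{\<beta>. c \<beta> \<noteq> 0} - {\<alpha>}. s (d \<beta>) * g \<beta>)"
        using c(1) by (subst sum.insert_remove) auto
      also have "(\<Sum>\<beta>\<in>{\<beta>. c \<beta> \<noteq> 0} - {\<alpha>}. s (d \<beta>) * g \<beta>) = (\<Sum>\<beta>\<in>{\<beta>. c \<beta> \<noteq> 0} - {\<alpha>}. s (c \<beta>) * g \<beta>)"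
        by (intro sum.cong) (auto simp: d_def)
      also have "s (d \<alpha>) * g \<alpha> + \<dots> = s a * g \<alpha> + (s (c \<alpha>) * g \<alpha> + \<dots>)"
        by (simp add: d_def s_add algebra_simps)
      also have "s (c \<alpha>) * g \<alpha> + (\<Sum>\<beta>\<in>{\<beta>. c \<beta> \<noteq> 0} - {\<alpha>}. s (c \<beta>) * g \<beta>) =
          (\<Sum>\<beta>\<in>insert \<alpha> {\<beta>. c \<beta> \<noteq> 0}. s (c \<beta>) * g \<beta>)"
        using c(1) by (subst sum.insert_remove) auto
      also have "\<dots> = (\<Sum>\<beta> | c \<beta> \<noteq> 0. s (c \<beta>) * g \<beta>)"
        using fin by (intro sum.mono_neutral_right) auto
      finally have "(\<Sum>\<beta> | d \<beta> \<noteq> 0. s (d \<beta>) * g \<beta>) = s a * x + (\<Sum>\<beta> | c \<beta> \<noteq> 0. s (c \<beta>) * g \<beta>)"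
        using \<alpha> by simp
      then show ?thesis
        using c sub \<alpha>(2) finite_subset[OF sub fin] by (intro exI[of _ d]) auto
    qed
  qed
  then show ?thesis by blast
qed

lemma span_mult_left:
  assumes "x \<in> vs.span A" "\<And>a. a \<in> A \<Longrightarrow> y * a \<in> vs.span B"
  shows "y * x \<in> vs.span B"
  using assms(1)
proof (rule vs.span_induct)
  show "vs.subspace {x. y * x \<in> vs.span B}"
    by (auto simp: vs.subspace_def distrib_left s_left_comm
        intro: vs.span_add vs.span_zero vs.span_scale)
qed (simp add: assms(2))

lemma span_mult_right:
  assumes "x \<in> vs.span A" "\<And>a. a \<in> A \<Longrightarrow> a * y \<in> vs.span B"
  shows "x * y \<in> vs.span B"
  using assms(1)
proof (rule vs.span_induct)
  show "vs.subspace {x. x * y \<in> vs.span B}"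
    by (auto simp: vs.subspace_def distrib_right mult.assoc
        intro: vs.span_add vs.span_zero vs.span_scale)
qed (simp add: assms(2))

end

section \<open>Dickson's lemma for multisets\<close>

lemma dickson_subseq:
  fixes f :: "nat \<Rightarrow> 'v multiset"
  assumes "finite V"
  shows "\<exists>r. strict_mono r \<and> (\<forall>v\<in>V. incseq (\<lambda>i. count (f (r i)) v))"
  using assms
proof (induction V)
  case empty
  show ?case using strict_mono_id by blast
next
  case (insert v V)
  then obtain r where r: "strict_mono r" "\<forall>v\<in>V. incseq (\<lambda>i. count (f (r i)) v)" by blast
  define g where "g i = count (f (r i)) v" for i
  obtain p where p: "strict_mono p" "monoseq (\<lambda>i. g (p i))"
    using seq_monosub[of g] by blast
  have "\<exists>p. strict_mono p \<and> incseq (\<lambda>i. g (p i))"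
  proof (cases "incseq (\<lambda>i. g (p i))")
    case False
    then have dec: "\<And>i j. i \<le> j \<Longrightarrow> g (p j) \<le> g (p i)"
      using p(2) by (auto simp: monoseq_iff decseq_def)
    \<comment> \<open>A decreasing sequence of naturals is constant from the index of its minimum
      on, hence increasing there.\<close>
    obtain k where k: "\<And>i. g (p k) \<le> g (p i)"
      using ex_has_least_nat[of "\<lambda>_. True" 0 "\<lambda>i. g (p i)"] by auto
    then have "incseq (\<lambda>i. g (p (k + i)))"
      by (auto simp: incseq_def) (metis dec le_add1 le_trans)
    moreover have "strict_mono (\<lambda>i. p (k + i))"
      using p(1) by (simp add: strict_mono_def)
    ultimately show ?thesis by blast
  qed (use p(1) in blast)
  then obtain p where p: "strict_mono p" "incseq (\<lambda>i. g (p i))" by blast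
  show ?case
  proof (intro exI[of _ "r \<circ> p"] conjI ballI)
    show "strict_mono (r \<circ> p)" using r(1) p(1) by (simp add: strict_mono_def)
    fix w assume "w \<in> insert v V"
    then show "incseq (\<lambda>i. count (f ((r \<circ> p) i)) w)"
      using p r(2) by (fastforce simp: g_def incseq_def strict_mono_less_eq)
  qed
qed

text \<open>The minimal elements of \<open>L\<close> suffice. They form an antichain, and infinitely
  many of them would contain a sequence that increases in every letter.\<close>

lemma dickson:
  fixes L :: "'v multiset set"
  assumes "finite V" "\<And>\<alpha>. \<alpha> \<in> L \<Longrightarrow> set_mset \<alpha> \<subseteq> V"
  shows "\<exists>F \<subseteq> L. finite F \<and> (\<forall>\<alpha>\<in>L. \<exists>\<beta>\<in>F. \<beta> \<subseteq># \<alpha>)"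
proof -
  define F where "F = {\<alpha> \<in> L. \<forall>\<beta>\<in>L. \<beta> \<subseteq># \<alpha> \<longrightarrow> \<beta> = \<alpha>}"
  have "finite F"
  proof (rule ccontr)
    assume "infinite F"
    then obtain f :: "nat \<Rightarrow> 'v multiset" where f: "inj f" "range f \<subseteq> F"
      using infinite_countable_subset by blast
    obtain r where r: "strict_mono r" "\<forall>v\<in>V. incseq (\<lambda>i. count (f (r i)) v)"
      using dickson_subseq[OF assms(1)] by blast
    have mem: "f i \<in> F" "f i \<in> L" for i using f(2) by (auto simp: F_def)
    have "f (r 0) \<subseteq># f (r 1)"
      unfolding subseteq_mset_def
    proof
      fix v
      show "count (f (r 0)) v \<le> count (f (r 1)) v"
      proof (cases "v \<in> V")
        case True
        then show ?thesis using r(2) by (simp add: incseq_def)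
      next
        case False
        then have "v \<notin># f (r 0)" using assms(2) mem by blast
        then show ?thesis by (simp add: not_in_iff)
      qed
    qed
    then have "f (r 0) = f (r 1)" using mem[of "r 0"] mem[of "r 1"] unfolding F_def by blast
    then have "r 0 = r 1" using f(1) by (simp add: inj_eq)
    then show False using r(1) by (simp add: strict_mono_eq)
  qed
  moreover have "\<exists>\<beta>\<in>F. \<beta> \<subseteq># \<alpha>" if "\<alpha> \<in> L" for \<alpha>
    using that
  proof (induction "size \<alpha>" arbitrary: \<alpha> rule: less_induct)
    case less
    show ?case
    proof (cases "\<alpha> \<in> F")
      case False
      then obtain \<beta> where "\<beta> \<in> L" "\<beta> \<subset># \<alpha>" using less.prems by (auto simp: F_def subset_mset.less_le)
      then show ?thesis using less.hyps[of \<beta>]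
        by (meson mset_subset_size subset_mset.less_imp_le subset_mset.order_trans)
    qed blast
  qed
  moreover have "F \<subseteq> L" by (auto simp: F_def)
  ultimately show ?thesis by blast
qed

text \<open>All statements hold modulo a subspace \<open>N\<close>, so that the same results apply to a free algebra
  with \<open>N\<close> an ideal of relations.\<close>

locale word_filtration = central_scalars s
  for s :: "'k::field \<Rightarrow> 'a::ring_1" +
  fixes u :: "'v::wellorder \<Rightarrow> 'a" and V :: "'v set" and wt :: "'v \<Rightarrow> nat" and N :: "'a set"
  assumes N_subspace: "vs.subspace N"
    and N_left: "\<lbrakk>v \<in> V; x \<in> N\<rbrakk> \<Longrightarrow> u v * x \<in> N"
    and N_right: "\<lbrakk>v \<in> V; x \<in> N\<rbrakk> \<Longrightarrow> x * u v \<in> N"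
    and swap: "\<lbrakk>a \<in> V; b \<in> V\<rbrakk> \<Longrightarrow> \<exists>c. c \<noteq> 0 \<and> u a * u b - s c * (u b * u a)
      \<in> vs.span ({u x * u y |x y. x \<in> V \<and> y \<in> V \<and> wt x + wt y < wt a + wt b} \<union> N)"
begin

section \<open>Ordered monomials and their leading exponents\<close>

definition mon :: "'v list \<Rightarrow> 'a" where "mon w = prod_list (map u w)"

definition std :: "'v multiset \<Rightarrow> 'a" where "std \<beta> = mon (sorted_list_of_multiset \<beta>)"

definition wtm :: "'v multiset \<Rightarrow> nat" where "wtm \<beta> = sum_mset (image_mset wt \<beta>)"

definition low :: "nat \<Rightarrow> 'a set" where
  "low n = vs.span ({mon w |w. set w \<subseteq> V \<and> wtm (mset w) < n} \<union> N)"

text \<open>The weight comes first because a swap creates terms of smaller weight. Ties are broken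
  by the multiset order, which is total, well-founded and compatible with sums.\<close>

definition prec :: "'v multiset \<Rightarrow> 'v multiset \<Rightarrow> bool" where
  "prec \<beta> \<alpha> \<longleftrightarrow> wtm \<beta> < wtm \<alpha> \<or> wtm \<beta> = wtm \<alpha> \<and> \<beta> < \<alpha>"

definition below :: "'v multiset \<Rightarrow> 'a set" where
  "below \<alpha> = vs.span ({std \<beta> |\<beta>. set_mset \<beta> \<subseteq> V \<and> prec \<beta> \<alpha>} \<union> N)"

lemma mon_simps [simp]: "mon [] = 1" "mon (a # w) = u a * mon w" "mon (v @ w) = mon v * mon w"
  by (simp_all add: mon_def)

lemma wtm_simps [simp]: "wtm {#} = 0" "wtm (add_mset a \<beta>) = wt a + wtm \<beta>"
  "wtm (\<alpha> + \<beta>) = wtm \<alpha> + wtm \<beta>"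
  by (simp_all add: wtm_def)

lemma N_below: "N \<subseteq> below \<alpha>"
  unfolding below_def by (auto intro: vs.span_base)

lemma mon_N:
  assumes "set w \<subseteq> V" "x \<in> N"
  shows "mon w * x \<in> N" "x * mon w \<in> N"
proof -
  show "mon w * x \<in> N" using assms(1) by (induction w) (use assms(2) in \<open>auto simp: mult.assoc N_left\<close>)
  show "x * mon w \<in> N" using assms
    by (induction w arbitrary: x) (auto simp: mult.assoc[symmetric] N_right)
qed

lemma mon_low: "\<lbrakk>set w \<subseteq> V; wtm (mset w) < n\<rbrakk> \<Longrightarrow> mon w \<in> low n"
  unfolding low_def by (rule vs.span_base) auto

lemma low_left:
  assumes "set v \<subseteq> V" "x \<in> low n"
  shows "mon v * x \<in> low (wtm (mset v) + n)"
  using assms(2) unfolding low_def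
proof (rule span_mult_left)
  fix a assume "a \<in> {mon w |w. set w \<subseteq> V \<and> wtm (mset w) < n} \<union> N"
  then show "mon v * a \<in> vs.span ({mon w |w. set w \<subseteq> V \<and> wtm (mset w) < wtm (mset v) + n} \<union> N)"
  proof
    assume "a \<in> {mon w |w. set w \<subseteq> V \<and> wtm (mset w) < n}"
    then obtain w where "a = mon w" "set w \<subseteq> V" "wtm (mset w) < n" by auto
    then have "mon v * a = mon (v @ w)" "set (v @ w) \<subseteq> V" "wtm (mset (v @ w)) < wtm (mset v) + n"
      using assms(1) by auto
    then show ?thesis by (intro vs.span_base) blast
  next
    assume "a \<in> N"
    then show ?thesis using mon_N[OF assms(1)] by (auto intro: vs.span_base)
  qed
qed

lemma cons_low:
  assumes "a \<in> V" "x \<in> low n"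
  shows "u a * x \<in> low (wt a + n)"
  using low_left[of "[a]" x n] assms by simp

lemma swap_mon:
  assumes "a \<in> V" "b \<in> V" "set l \<subseteq> V"
  shows "\<exists>c. c \<noteq> 0 \<and> mon (a # b # l) - s c * mon (b # a # l) \<in> low (wtm (mset (a # b # l)))"
proof -
  obtain c where c: "c \<noteq> 0" "u a * u b - s c * (u b * u a)
      \<in> vs.span ({u x * u y |x y. x \<in> V \<and> y \<in> V \<and> wt x + wt y < wt a + wt b} \<union> N)"
    using swap assms by blast
  have "(u a * u b - s c * (u b * u a)) * mon l \<in> low (wtm (mset (a # b # l)))"
    unfolding low_def
  proof (rule span_mult_right[OF c(2)])
    fix z assume "z \<in> {u x * u y |x y. x \<in> V \<and> y \<in> V \<and> wt x + wt y < wt a + wt b} \<union> N"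
    then show "z * mon l \<in> vs.span ({mon w |w. set w \<subseteq> V \<and> wtm (mset w) < wtm (mset (a # b # l))} \<union> N)"
    proof
      assume "z \<in> {u x * u y |x y. x \<in> V \<and> y \<in> V \<and> wt x + wt y < wt a + wt b}"
      then obtain x y where "z = u x * u y" "x \<in> V" "y \<in> V" "wt x + wt y < wt a + wt b" by auto
      then have "z * mon l = mon (x # y # l)" "set (x # y # l) \<subseteq> V"
        "wtm (mset (x # y # l)) < wtm (mset (a # b # l))"
        using assms(3) by (auto simp: mult.assoc)
      then show ?thesis by (metis (mono_tags, lifting) UnI1 mem_Collect_eq vs.span_base)
    next
      assume "z \<in> N"
      then show ?thesis using mon_N[OF assms(3)] by (auto intro: vs.span_base)
    qed
  qed
  then show ?thesis using c(1) by (intro exI[of _ c]) (simp add: algebra_simps)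
qed

text \<open>Equality up to a unit and lower terms. Requiring equal multisets keeps the weight, and
  with it the meaning of "lower", constant along a chain of swaps.\<close>

definition related :: "'v list \<Rightarrow> 'v list \<Rightarrow> bool" where
  "related w v \<longleftrightarrow> mset w = mset v \<and> (\<exists>c. c \<noteq> 0 \<and> mon w - s c * mon v \<in> low (wtm (mset w)))"

lemma related_refl: "related w w"
  unfolding related_def
  by (intro conjI refl exI[of _ 1]) (auto simp: s_one low_def vs.span_zero)

lemma related_trans:
  assumes "related w v" "related v z"
  shows "related w z"
proof -
  obtain c d where c: "c \<noteq> 0" "mon w - s c * mon v \<in> low (wtm (mset w))"
    and d: "d \<noteq> 0" "mon v - s d * mon z \<in> low (wtm (mset w))" and "mset w = mset z"
    using assms unfolding related_def by auto
  have "mon w - s (c * d) * mon z = (mon w - s c * mon v) + s c * (mon v - s d * mon z)"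
    by (simp add: right_diff_distrib)
  also have "\<dots> \<in> low (wtm (mset w))"
    using c(2) d(2) unfolding low_def by (intro vs.span_add vs.span_scale)
  finally show ?thesis unfolding related_def using c(1) d(1) \<open>mset w = mset z\<close>
    by (intro conjI exI[of _ "c * d"]) auto
qed

lemma related_Cons:
  assumes "a \<in> V" "related w v"
  shows "related (a # w) (a # v)"
proof -
  obtain c where c: "c \<noteq> 0" "mon w - s c * mon v \<in> low (wtm (mset w))" and "mset w = mset v"
    using assms unfolding related_def by auto
  have "mon (a # w) - s c * mon (a # v) = u a * (mon w - s c * mon v)"
    by (simp add: algebra_simps s_left_comm)
  then show ?thesis unfolding related_def using c cons_low[OF assms(1) c(2)] \<open>mset w = mset v\<close>
    by (intro conjI exI[of _ c]) auto
qed

text \<open>Each comparison made by insertion sort is one adjacent swap.\<close>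

lemma related_insort:
  assumes "a \<in> V" "set l \<subseteq> V"
  shows "related (a # l) (insort a l)"
  using assms(2)
proof (induction l)
  case (Cons b l)
  then have V: "b \<in> V" "set l \<subseteq> V" by auto
  have "related (a # b # l) (b # a # l)"
    using swap_mon[OF assms(1) V] by (simp add: related_def)
  moreover have "related (b # a # l) (b # insort a l)"
    using Cons V by (intro related_Cons) auto
  ultimately show ?case using related_trans related_refl by auto
qed (simp add: related_refl)

lemma related_sort:
  assumes "set w \<subseteq> V"
  shows "related w (sort w)"
  using assms
proof (induction w)
  case (Cons a w)
  then have V: "a \<in> V" "set w \<subseteq> V" by auto
  have "related (a # w) (a # sort w)" using Cons V by (intro related_Cons) auto
  then show ?case using related_insort[of a "sort w"] V related_trans by auto
qed (simp add: related_refl)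

text \<open>Sorting a word costs terms below its own weight, which is already below
  \<open>n\<close>; induction on the bound then removes all unsorted words.\<close>

lemma low_std: "low n \<subseteq> vs.span ({std \<beta> |\<beta>. set_mset \<beta> \<subseteq> V \<and> wtm \<beta> < n} \<union> N)" (is "_ \<subseteq> ?S n")
proof (induction n rule: less_induct)
  case (less n)
  have "mon w \<in> ?S n" if w: "set w \<subseteq> V" "wtm (mset w) < n" for w
  proof -
    obtain c where c: "mon w - s c * std (mset w) \<in> low (wtm (mset w))"
      using related_sort[OF w(1)] by (auto simp: related_def std_def)
    have "mon w - s c * std (mset w) \<in> ?S (wtm (mset w))"
      using c less[OF w(2)] by auto
    also have "\<dots> \<subseteq> ?S n" using w(2) by (intro vs.span_mono) auto
    finally have "mon w - s c * std (mset w) \<in> ?S n" .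
    moreover have "s c * std (mset w) \<in> ?S n"
      using w by (intro vs.span_scale vs.span_base UnI1 CollectI exI[of _ "mset w"]) auto
    ultimately have "(mon w - s c * std (mset w)) + s c * std (mset w) \<in> ?S n"
      by (rule vs.span_add)
    then show ?thesis by simp
  qed
  then have "{mon w |w. set w \<subseteq> V \<and> wtm (mset w) < n} \<union> N \<subseteq> ?S n"
    by (auto intro: vs.span_base)
  then show ?case unfolding low_def by (rule vs.span_minimal) (rule vs.subspace_span)
qed

lemma low_below: "low (wtm \<alpha>) \<subseteq> below \<alpha>"
proof -
  have "vs.span ({std \<beta> |\<beta>. set_mset \<beta> \<subseteq> V \<and> wtm \<beta> < wtm \<alpha>} \<union> N) \<subseteq> below \<alpha>"
    unfolding below_def by (intro vs.span_mono) (auto simp: prec_def)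
  then show ?thesis using low_std by blast
qed

lemma mon_leading:
  assumes "set w \<subseteq> V"
  shows "\<exists>c. c \<noteq> 0 \<and> mon w - s c * std (mset w) \<in> below (mset w)"
  using related_sort[OF assms] low_below[of "mset w"] by (auto simp: related_def std_def)

lemma mon_span_std: "set w \<subseteq> V \<Longrightarrow> mon w \<in> vs.span ({std \<beta> |\<beta>. set_mset \<beta> \<subseteq> V} \<union> N)"
proof -
  assume "set w \<subseteq> V"
  then have "mon w \<in> low (Suc (wtm (mset w)))" by (intro mon_low) auto
  then have "mon w \<in> vs.span ({std \<beta> |\<beta>. set_mset \<beta> \<subseteq> V \<and> wtm \<beta> < Suc (wtm (mset w))} \<union> N)"
    using low_std by blast
  also have "\<dots> \<subseteq> vs.span ({std \<beta> |\<beta>. set_mset \<beta> \<subseteq> V} \<union> N)"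
    by (intro vs.span_mono) auto
  finally show ?thesis .
qed

lemma prec_add: "prec \<beta> \<alpha> \<Longrightarrow> prec (\<gamma> + \<beta>) (\<gamma> + \<alpha>)"
  by (auto simp: prec_def)

lemma prec_trans: "prec \<gamma> \<beta> \<Longrightarrow> prec \<beta> \<alpha> \<Longrightarrow> prec \<gamma> \<alpha>"
  by (auto simp: prec_def)

lemma prec_linear: "prec \<beta> \<alpha> \<or> \<beta> = \<alpha> \<or> prec \<alpha> \<beta>"
  by (auto simp: prec_def)

lemma prec_induct [consumes 0, case_names less]:
  assumes "\<And>\<alpha>. (\<And>\<beta>. prec \<beta> \<alpha> \<Longrightarrow> P \<beta>) \<Longrightarrow> P \<alpha>"
  shows "P \<alpha>"
proof -
  have "wf (inv_image (less_than <*lex*> {(\<beta>, \<alpha>). \<beta> < \<alpha>}) (\<lambda>\<alpha> :: 'v multiset. (wtm \<alpha>, \<alpha>)))"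
    by (intro wf_inv_image wf_lex_prod wf_less_than wf)
  then show ?thesis
  proof (induction \<alpha>)
    case (less \<alpha>)
    show ?case by (rule assms, rule less) (auto simp: prec_def)
  qed
qed

lemma below_mono: "prec \<beta> \<alpha> \<Longrightarrow> below \<beta> \<subseteq> below \<alpha>"
  unfolding below_def by (intro vs.span_mono) (auto dest: prec_trans)

lemma std_below: "\<lbrakk>set_mset \<beta> \<subseteq> V; prec \<beta> \<alpha>\<rbrakk> \<Longrightarrow> std \<beta> \<in> below \<alpha>"
  unfolding below_def by (rule vs.span_base) auto

lemma std_mult_leading:
  assumes "set_mset \<beta> \<subseteq> V" "set_mset \<gamma> \<subseteq> V"
  shows "\<exists>c. c \<noteq> 0 \<and> std \<gamma> * std \<beta> - s c * std (\<gamma> + \<beta>) \<in> below (\<gamma> + \<beta>)"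
  using mon_leading[of "sorted_list_of_multiset \<gamma> @ sorted_list_of_multiset \<beta>"] assms
  by (simp add: std_def)

lemma prec_Max:
  assumes "finite F" "F \<noteq> {}"
  shows "\<exists>\<beta>\<in>F. \<forall>\<gamma>\<in>F. \<gamma> = \<beta> \<or> prec \<gamma> \<beta>"
  using assms
proof (induction rule: finite_ne_induct)
  case (insert \<alpha> F)
  then obtain \<beta> where "\<beta> \<in> F" "\<forall>\<gamma>\<in>F. \<gamma> = \<beta> \<or> prec \<gamma> \<beta>" by blast
  then show ?case using prec_linear[of \<alpha> \<beta>] by (metis insert_iff prec_trans)
qed simp

text \<open>The leading exponent belongs to a chosen expression of \<open>f\<close> and need not be
  determined by \<open>f\<close>. The expression is nonempty because \<open>f\<close> is not in
  \<open>N\<close>.\<close>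

lemma std_span_leading:
  assumes "f \<in> vs.span ({std \<beta> |\<beta>. \<beta> \<in> P} \<union> N)" "f \<notin> N" "\<And>\<beta>. \<beta> \<in> P \<Longrightarrow> set_mset \<beta> \<subseteq> V"
  shows "\<exists>\<beta>\<in>P. \<exists>c. c \<noteq> 0 \<and> f - s c * std \<beta> \<in> below \<beta>"
proof -
  obtain F c where F: "finite F" "F \<subseteq> P" "\<forall>\<beta>\<in>F. c \<beta> \<noteq> 0" "f - (\<Sum>\<beta>\<in>F. s (c \<beta>) * std \<beta>) \<in> N"
    using span_family[OF N_subspace assms(1)] by blast
  have "F \<noteq> {}" using F(4) assms(2) by auto
  then obtain \<beta> where b: "\<beta> \<in> F" "\<forall>\<gamma>\<in>F. \<gamma> = \<beta> \<or> prec \<gamma> \<beta>" using prec_Max F(1) by blast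
  have "f - s (c \<beta>) * std \<beta> = (f - (\<Sum>\<beta>\<in>F. s (c \<beta>) * std \<beta>)) + (\<Sum>\<gamma>\<in>F - {\<beta>}. s (c \<gamma>) * std \<gamma>)"
    using sum.remove[OF F(1) b(1), of "\<lambda>\<beta>. s (c \<beta>) * std \<beta>"] by simp
  also have "\<dots> \<in> below \<beta>"
  proof -
    have "f - (\<Sum>\<beta>\<in>F. s (c \<beta>) * std \<beta>) \<in> below \<beta>" using F(4) N_below by blast
    moreover have "std \<gamma> \<in> below \<beta>" if "\<gamma> \<in> F - {\<beta>}" for \<gamma>
      using that F(2) b(2) assms(3) by (intro std_below) auto
    ultimately show ?thesis
      unfolding below_def by (intro vs.span_add vs.span_sum vs.span_scale)
  qed
  finally show ?thesis using F b by blast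
qed

text \<open>The operators \<open>T \<gamma>\<close> stand for left or for right multiplication by \<open>std \<gamma>\<close>.\<close>

theorem noetherian_division:
  fixes T :: "'v multiset \<Rightarrow> 'a \<Rightarrow> 'a"
  assumes V: "finite V"
    and T_add: "\<And>\<gamma> x y. T \<gamma> (x + y) = T \<gamma> x + T \<gamma> y"
    and T_scale: "\<And>\<gamma> c x. T \<gamma> (s c * x) = s c * T \<gamma> x"
    and T_N: "\<And>\<gamma> x. \<lbrakk>set_mset \<gamma> \<subseteq> V; x \<in> N\<rbrakk> \<Longrightarrow> T \<gamma> x \<in> N"
    and T_std: "\<And>\<beta> \<gamma>. \<lbrakk>set_mset \<beta> \<subseteq> V; set_mset \<gamma> \<subseteq> V\<rbrakk> \<Longrightarrow>
      \<exists>c. c \<noteq> 0 \<and> T \<gamma> (std \<beta>) - s c * std (\<gamma> + \<beta>) \<in> below (\<gamma> + \<beta>)"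
    and J: "J \<subseteq> vs.span ({std \<beta> |\<beta>. set_mset \<beta> \<subseteq> V} \<union> N)" "vs.subspace J"
      "\<And>\<gamma> x. \<lbrakk>set_mset \<gamma> \<subseteq> V; x \<in> J\<rbrakk> \<Longrightarrow> T \<gamma> x \<in> J"
  shows "\<exists>A \<subseteq> J. finite A \<and> (\<forall>J'. A \<subseteq> J' \<longrightarrow> N \<subseteq> J' \<longrightarrow> vs.subspace J' \<longrightarrow>
    (\<forall>\<gamma> x. set_mset \<gamma> \<subseteq> V \<longrightarrow> x \<in> J' \<longrightarrow> T \<gamma> x \<in> J') \<longrightarrow> J \<subseteq> J')"
proof -
  \<comment> \<open>The exponents leading some element of \<open>J\<close>. Finitely many of them,
    \<open>F\<close>, divide all others and yield the generators \<open>g \<beta>\<close>.\<close>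
  define L where "L = {\<beta>. set_mset \<beta> \<subseteq> V \<and> (\<exists>f\<in>J. \<exists>c. c \<noteq> 0 \<and> f - s c * std \<beta> \<in> below \<beta>)}"
  obtain F where F: "F \<subseteq> L" "finite F" "\<forall>\<alpha>\<in>L. \<exists>\<beta>\<in>F. \<beta> \<subseteq># \<alpha>"
    using dickson[OF V, of L] by (auto simp: L_def)
  have "\<forall>\<beta>\<in>F. \<exists>f\<in>J. \<exists>c. c \<noteq> 0 \<and> f - s c * std \<beta> \<in> below \<beta>" using F(1) by (auto simp: L_def)
  then obtain g where g: "\<And>\<beta>. \<beta> \<in> F \<Longrightarrow> g \<beta> \<in> J \<and> (\<exists>c. c \<noteq> 0 \<and> g \<beta> - s c * std \<beta> \<in> below \<beta>)"
    by metis
  have T_below: "T \<gamma> x \<in> below (\<gamma> + \<beta>)" if x: "x \<in> below \<beta>" and \<gamma>: "set_mset \<gamma> \<subseteq> V" for \<gamma> \<beta> x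
    using x unfolding below_def
  proof (rule vs.span_induct)
    show "vs.subspace {x. T \<gamma> x \<in> vs.span ({std \<beta>' |\<beta>'. set_mset \<beta>' \<subseteq> V \<and> prec \<beta>' (\<gamma> + \<beta>)} \<union> N)}"
      using T_scale[of \<gamma> 0 0]
      by (auto simp: vs.subspace_def T_add T_scale
          intro: vs.span_add vs.span_zero vs.span_scale)
    fix x assume "x \<in> {std \<beta>' |\<beta>'. set_mset \<beta>' \<subseteq> V \<and> prec \<beta>' \<beta>} \<union> N"
    then show "T \<gamma> x \<in> vs.span ({std \<beta>' |\<beta>'. set_mset \<beta>' \<subseteq> V \<and> prec \<beta>' (\<gamma> + \<beta>)} \<union> N)"
    proof
      assume "x \<in> {std \<beta>' |\<beta>'. set_mset \<beta>' \<subseteq> V \<and> prec \<beta>' \<beta>}"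
      then obtain \<beta>' where b: "x = std \<beta>'" "set_mset \<beta>' \<subseteq> V" "prec \<beta>' \<beta>" by auto
      then obtain c where c: "T \<gamma> x - s c * std (\<gamma> + \<beta>') \<in> below (\<gamma> + \<beta>')"
        using T_std \<gamma> by blast
      have p: "prec (\<gamma> + \<beta>') (\<gamma> + \<beta>)" using prec_add b(3) .
      have "(T \<gamma> x - s c * std (\<gamma> + \<beta>')) + s c * std (\<gamma> + \<beta>') \<in> below (\<gamma> + \<beta>)"
        using c below_mono[OF p] std_below[OF _ p] b(2) \<gamma> unfolding below_def
        by (intro vs.span_add vs.span_scale) auto
      then show ?thesis by (simp add: below_def)
    next
      assume "x \<in> N"
      then show ?thesis using T_N[OF \<gamma>] by (auto intro: vs.span_base)
    qed
  qed
  show ?thesis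
  proof (intro exI[of _ "g ` F"] conjI allI impI)
    fix J' assume J': "g ` F \<subseteq> J'" "N \<subseteq> J'" "vs.subspace J'"
      "\<forall>\<gamma> x. set_mset \<gamma> \<subseteq> V \<longrightarrow> x \<in> J' \<longrightarrow> T \<gamma> x \<in> J'"
    \<comment> \<open>One division step: \<open>h\<close> is a multiple of a generator with the
      leading term of \<open>f\<close>, so \<open>f - h\<close> falls below \<beta>. The hypothesis
      is phrased to serve both inside the induction over \<open>prec\<close> and after it.\<close>
    have step: "f \<in> J'" if IH: "\<And>\<beta>' f. prec \<beta>' \<alpha> \<or> \<beta>' = \<beta> \<Longrightarrow> f \<in> J \<Longrightarrow> f \<in> below \<beta>' \<Longrightarrow> f \<in> J'"
      and f: "f \<in> J" and \<beta>: "set_mset \<beta> \<subseteq> V" and c: "c \<noteq> 0" "f - s c * std \<beta> \<in> below \<beta>" for f \<alpha> \<beta> c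
    proof -
      have "\<beta> \<in> L" unfolding L_def using f \<beta> c by blast
      then obtain \<beta>0 where b0: "\<beta>0 \<in> F" "\<beta>0 \<subseteq># \<beta>" using F(3) by blast
      define \<gamma> where "\<gamma> = \<beta> - \<beta>0"
      have sum: "\<gamma> + \<beta>0 = \<beta>" using b0(2) by (simp add: \<gamma>_def)
      then have \<gamma>: "set_mset \<gamma> \<subseteq> V" and \<beta>0: "set_mset \<beta>0 \<subseteq> V" using \<beta> by auto
      obtain d where d: "d \<noteq> 0" "g \<beta>0 - s d * std \<beta>0 \<in> below \<beta>0" using g[OF b0(1)] by blast
      obtain e where e: "e \<noteq> 0" "T \<gamma> (std \<beta>0) - s e * std \<beta> \<in> below \<beta>"
        using T_std[OF \<beta>0 \<gamma>] sum by auto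
      have "T \<gamma> (g \<beta>0) = T \<gamma> (g \<beta>0 - s d * std \<beta>0) + s d * T \<gamma> (std \<beta>0)"
        using T_add[of \<gamma> "g \<beta>0 - s d * std \<beta>0" "s d * std \<beta>0"] T_scale by simp
      then have "T \<gamma> (g \<beta>0) - s (d * e) * std \<beta> =
          T \<gamma> (g \<beta>0 - s d * std \<beta>0) + s d * (T \<gamma> (std \<beta>0) - s e * std \<beta>)"
        by (simp add: right_diff_distrib)
      also have "\<dots> \<in> below \<beta>"
        using T_below[OF d(2) \<gamma>] e(2) sum unfolding below_def
        by (intro vs.span_add vs.span_scale) auto
      finally have lead: "T \<gamma> (g \<beta>0) - s (d * e) * std \<beta> \<in> below \<beta>" .
      \<comment> \<open>The factor undoes the leading coefficient \<open>d\<close> of the generator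
        and the unit \<open>e\<close> created by \<open>T \<gamma>\<close>.\<close>
      define h where "h = s (c / (d * e)) * T \<gamma> (g \<beta>0)"
      have "s (c / (d * e)) * (T \<gamma> (g \<beta>0) - s (d * e) * std \<beta>) = h - s c * std \<beta>"
        using d(1) e(1) by (simp add: h_def right_diff_distrib)
      then have h: "h - s c * std \<beta> \<in> below \<beta>"
        using vs.span_scale[OF lead[unfolded below_def], of "c / (d * e)"] by (simp only: below_def)
      have "(f - s c * std \<beta>) - (h - s c * std \<beta>) \<in> below \<beta>"
        using c(2) h unfolding below_def by (rule vs.span_diff)
      then have "f - h \<in> below \<beta>" by simp
      moreover have "h \<in> J" "h \<in> J'"
        unfolding h_def using g[OF b0(1)] J(2,3) J' b0(1) \<gamma> by (auto intro!: vs.subspace_scale)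
      ultimately have "f - h \<in> J'" using IH[of \<beta> "f - h"] f J(2) by (auto intro: vs.subspace_diff)
      then have "(f - h) + h \<in> J'" using \<open>h \<in> J'\<close> J'(3) by (intro vs.subspace_add)
      then show ?thesis by simp
    qed
    have below: "f \<in> J'" if "f \<in> J" "f \<in> below \<alpha>" for f \<alpha>
      using that
    proof (induction \<alpha> arbitrary: f rule: prec_induct)
      case (less \<alpha>)
      show ?case
      proof (cases "f \<in> N")
        case False
        have "f \<in> vs.span ({std \<beta> |\<beta>. \<beta> \<in> {\<beta>. set_mset \<beta> \<subseteq> V \<and> prec \<beta> \<alpha>}} \<union> N)"
          using less.prems(2) by (simp add: below_def)
        from std_span_leading[OF this False] obtain \<beta> c where "set_mset \<beta> \<subseteq> V" "prec \<beta> \<alpha>"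
          "c \<noteq> 0" "f - s c * std \<beta> \<in> below \<beta>" by blast
        then show ?thesis using step[of \<alpha> \<beta>] less by blast
      qed (use J' in blast)
    qed
    show "J \<subseteq> J'"
    proof
      fix f assume f: "f \<in> J"
      show "f \<in> J'"
      proof (cases "f \<in> N")
        case False
        have "f \<in> vs.span ({std \<beta> |\<beta>. \<beta> \<in> {\<beta>. set_mset \<beta> \<subseteq> V}} \<union> N)" using J(1) f by auto
        from std_span_leading[OF this False] obtain \<beta> c where "set_mset \<beta> \<subseteq> V"
          "c \<noteq> 0" "f - s c * std \<beta> \<in> below \<beta>" by blast
        then show ?thesis using step[of \<beta> \<beta>] below f by blast
      qed (use J' in blast)
    qed
  qed (use g F in auto)
qed

end

section \<open>Commutation of quantum minors\<close>

text \<open>The exponent of \<open>- q\<close> in a Laplace expansion. The argument \<open>y\<close>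
  may lie outside \<open>R\<close>, since rows are also exchanged for outside ones.\<close>

definition rank :: "nat set \<Rightarrow> nat \<Rightarrow> nat" where "rank R y = card {t \<in> R. t < y}"

lemma rank_remove:
  assumes "finite R" "x \<in> R"
  shows "rank R y = rank (R - {x}) y + (if x < y then 1 else 0)"
proof (cases "x < y")
  case True
  have "{t \<in> R. t < y} = insert x {t \<in> R - {x}. t < y}" using assms True by auto
  then show ?thesis using assms True by (simp add: rank_def)
next
  case False
  then have "{t \<in> R. t < y} = {t \<in> R - {x}. t < y}" by auto
  then show ?thesis using False by (simp add: rank_def)
qed

lemma rank_insert:
  assumes "finite R" "x \<notin> R"
  shows "rank (insert x R) y = rank R y + (if x < y then 1 else 0)"
  using rank_remove[of "insert x R" x y] assms by simp

text \<open>The four families of relations are the entries of a single matrix equation, in which the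
  Hecke operator \<open>e\<^sub>a \<otimes> e\<^sub>b \<mapsto> q\<^bsup>[a = b]\<^esup> e\<^sub>b \<otimes> e\<^sub>a + [a < b] (q - q\<^sup>-\<^sup>1) e\<^sub>a \<otimes> e\<^sub>b\<close> may be applied either to
  the row indices or to the column indices. Index pairs of the wrong order give the same relations
  once more, so no side conditions are needed.\<close>

locale quantum_matrix = central_scalars s for s :: "'k::field \<Rightarrow> 'a::ring_1" +
  fixes q :: 'k and Y :: "nat \<Rightarrow> nat \<Rightarrow> 'a"
  assumes q: "q \<noteq> 0"
    and rel: "s (if i = k then q else 1) * (Y k a * Y i b)
        + (if i < k then s (q - inverse q) * (Y i a * Y k b) else 0)
      = s (if a = b then q else 1) * (Y i b * Y k a)
        + (if a < b then s (q - inverse q) * (Y i a * Y k b) else 0)"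
begin

lemma Y_s: "Y i a * (s c * y) = s c * (Y i a * y)"
  by (rule s_left_comm)

definition hecke :: 'k where "hecke = q - inverse q"

definition diag_coeff :: "nat \<Rightarrow> nat \<Rightarrow> 'k" where "diag_coeff a b = (if a = b then q else 1)"

text \<open>The quantum determinant with antisymmetrised rows, expanded along the columns in the
  order of the word. The word may be unsorted and may repeat letters, as happens after
  braiding.\<close>

primrec rdet :: "nat set \<Rightarrow> nat list \<Rightarrow> 'a" where
  "rdet R [] = 1"
| "rdet R (a # w) = (\<Sum>r\<in>R. s ((- q) ^ rank R r) * (Y r a * rdet (R - {r}) w))"

text \<open>The expansion of the braiding that moves the letter \<open>b\<close> from the left to the right of the word
  \<open>w\<close>: at each position the carried letter either passes, or is exchanged for a larger one.\<close>

primrec insertions :: "nat \<Rightarrow> nat list \<Rightarrow> ('k \<times> nat list \<times> nat) list" where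
  "insertions b [] = [(1, [], b)]"
| "insertions b (a # w) = map (\<lambda>(c, w', b'). (diag_coeff b a * c, a # w', b')) (insertions b w)
    @ (if b < a then map (\<lambda>(c, w', b'). (hecke * c, b # w', b')) (insertions a w) else [])"

definition insertion_sum :: "nat \<Rightarrow> nat set \<Rightarrow> nat list \<times> nat \<Rightarrow> 'a" where
  "insertion_sum k R = (\<lambda>(w, b). \<Sum>(c, w', b')\<leftarrow>insertions b w. s c * (rdet R w' * Y k b'))"

lemma sum_list_rdet_Cons:
  "(\<Sum>(c, w', b')\<leftarrow>map (\<lambda>(c, w', b'). (e * c, a # w', b')) xs. s c * (rdet R w' * Y k b')) =
    (\<Sum>r\<in>R. s ((- q) ^ rank R r) * (s e * (Y r a * (\<Sum>(c, w', b')\<leftarrow>xs. s c * (rdet (R - {r}) w' * Y k b')))))"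
  (is "?L xs = ?R xs")
proof (induction xs)
  case (Cons x xs)
  obtain c w' b' where x: "x = (c, w', b')" by (metis prod_cases3)
  have "?L (x # xs) = s (e * c) * (rdet R (a # w') * Y k b') + ?L xs" by (simp add: x)
  also note Cons
  also have "s (e * c) * (rdet R (a # w') * Y k b') + ?R xs = ?R (x # xs)"
    by (simp add: x distrib_left sum.distrib Y_s sum_distrib_left sum_distrib_right mult.assoc mult_ac)
  finally show ?case .
qed simp

lemma insertion_sum_Nil: "insertion_sum k R ([], b) = Y k b"
  by (simp add: insertion_sum_def s_one)

lemma insertion_sum_Cons: "insertion_sum k R (a # w, b) = (\<Sum>r\<in>R. s ((- q) ^ rank R r) *
    (s (diag_coeff b a) * (Y r a * insertion_sum k (R - {r}) (w, b)) +
      (if b < a then s hecke * (Y r b * insertion_sum k (R - {r}) (w, a)) else 0)))"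
  by (simp add: insertion_sum_def sum_list_rdet_Cons[simplified] distrib_left sum.distrib)

lemma rel_rows: "r \<noteq> k \<Longrightarrow> s (diag_coeff b a) * (Y r a * Y k b) + (if b < a then s hecke * (Y r b * Y k a) else 0)
    = Y k b * Y r a + (if r < k then s hecke * (Y r b * Y k a) else 0)"
  using rel[of r k b a] by (simp only: diag_coeff_def hecke_def s_one if_False mult_1_left)

lemma rel_same_row: "s (diag_coeff b a) * (Y k a * Y k b) + (if b < a then s hecke * (Y k b * Y k a) else 0)
    = s q * (Y k b * Y k a)"
  using rel[of k k b a] by (simp add: diag_coeff_def hecke_def s_one)

text \<open>For \<open>r\<close> in \<open>R\<close> with \<open>r < k\<close> this is the sign
  factor for deleting \<open>r\<close> from \<open>R\<close> divided by the one for inserting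
  \<open>k\<close> into \<open>R - {r}\<close>; the extra \<open>- q\<close> makes up for
  \<open>r\<close> being counted in \<open>rank R k\<close>.\<close>

definition exch :: "nat set \<Rightarrow> nat \<Rightarrow> nat \<Rightarrow> 'k" where
  "exch R k r = (- q) * (- q) ^ rank R r / (- q) ^ rank R k"

text \<open>The braiding may be moved to the row indices, where it acts on the antisymmetric tensor of
  \<open>R\<close>: by the scalar \<open>q\<close> for \<open>k \<in> R\<close>. The case \<open>k \<notin> R\<close> is only needed for the induction.\<close>

lemma insertion_sum_eq:
  assumes "finite R" "card R = length w"
  shows "(k \<in> R \<longrightarrow> insertion_sum k R (w, b) = s q * (Y k b * rdet R w)) \<and>
    (k \<notin> R \<longrightarrow> insertion_sum k R (w, b) = Y k b * rdet R w +
      (\<Sum>t\<in>R. if t < k then s (hecke * exch R k t) * (Y t b * rdet (insert k (R - {t})) w) else 0))"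
  using assms
proof (induction w arbitrary: R b)
  case Nil
  then show ?case by (simp add: insertion_sum_Nil)
next
  case (Cons a w)
  have IH: "k \<in> R - {r} \<Longrightarrow> insertion_sum k (R - {r}) (w, b) = s q * (Y k b * rdet (R - {r}) w)"
    "k \<notin> R - {r} \<Longrightarrow> insertion_sum k (R - {r}) (w, b) = Y k b * rdet (R - {r}) w +
      (\<Sum>t\<in>R - {r}. if t < k then s (hecke * exch (R - {r}) k t) *
          (Y t b * rdet (insert k (R - {r} - {t})) w) else 0)"
    if "r \<in> R" for r b
    using Cons.IH[of "R - {r}" b] Cons.prems that by simp_all
  define e where "e r = (- q) ^ rank R r" for r
  have rl: "s (diag_coeff b a) * (Y r a * (Y k b * z)) + (if b < a then s hecke * (Y r b * (Y k a * z)) else 0)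
    = Y k b * (Y r a * z) + (if r < k then s hecke * (Y r b * (Y k a * z)) else 0)" if "r \<noteq> k" for r k z
    using arg_cong[OF rel_rows[OF that, of b a], of "\<lambda>x. x * z"]
    by (simp add: distrib_right mult.assoc if_distrib[of "\<lambda>x. x * z"] cong: if_cong)
  have rs: "s (diag_coeff b a) * (Y k a * (Y k b * z)) + (if b < a then s hecke * (Y k b * (Y k a * z)) else 0)
    = s q * (Y k b * (Y k a * z))" for z
    using arg_cong[OF rel_same_row[of b a], of "\<lambda>x. x * z"]
    by (simp add: distrib_right mult.assoc if_distrib[of "\<lambda>x. x * z"] cong: if_cong)
  show ?case
  proof (intro conjI impI)
    assume k: "k \<in> R"
    let ?D = "\<lambda>r. rdet (R - {r}) w"
    \<comment> \<open>For \<open>r \<noteq> k\<close> the row \<open>k\<close> remains in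
      \<open>R - {r}\<close>, so the induction hypothesis supplies the scalar \<open>q\<close>, and
      \<open>rel_rows\<close> leaves a Hecke term when \<open>r < k\<close>.\<close>
    have 1: "s (e r) * (s (diag_coeff b a) * (Y r a * insertion_sum k (R - {r}) (w, b)) +
        (if b < a then s hecke * (Y r b * insertion_sum k (R - {r}) (w, a)) else 0)) =
      s (q * e r) * (Y k b * (Y r a * ?D r)) +
        (if r < k then s (hecke * q * e r) * (Y r b * (Y k a * ?D r)) else 0)" if r: "r \<in> R - {k}" for r
    proof -
      have "s (diag_coeff b a) * (Y r a * insertion_sum k (R - {r}) (w, b)) +
        (if b < a then s hecke * (Y r b * insertion_sum k (R - {r}) (w, a)) else 0) =
        s q * (s (diag_coeff b a) * (Y r a * (Y k b * ?D r)) +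
            (if b < a then s hecke * (Y r b * (Y k a * ?D r)) else 0))"
        using IH(1) k r by (simp add: Y_s distrib_left mult.commute)
      also have "\<dots> = s q * (Y k b * (Y r a * ?D r) + (if r < k then s hecke * (Y r b * (Y k a * ?D r)) else 0))"
        using rl[of r k "?D r"] r by simp
      finally show ?thesis by (simp add: distrib_left mult.commute mult.left_commute)
    qed
    \<comment> \<open>Deleting \<open>k\<close> itself leads to the other case of the induction
      hypothesis, where exchanging \<open>t\<close> for \<open>k\<close> gives back
      \<open>R - {t}\<close>.\<close>
    have 2: "s (diag_coeff b a) * (Y k a * insertion_sum k (R - {k}) (w, b)) +
        (if b < a then s hecke * (Y k b * insertion_sum k (R - {k}) (w, a)) else 0) =
      s q * (Y k b * (Y k a * ?D k)) +
        (\<Sum>t\<in>R - {k}. if t < k then s (hecke * exch (R - {k}) k t) * (Y t b * (Y k a * ?D t)) else 0)"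
    proof -
      have Tk: "insertion_sum k (R - {k}) (w, b) = Y k b * ?D k +
          (\<Sum>t\<in>R - {k}. if t < k then s (hecke * exch (R - {k}) k t) * (Y t b * ?D t) else 0)" for b
      proof -
        have "insert k (R - {k} - {t}) = R - {t}" if "t < k" for t using k that by auto
        then show ?thesis using IH(2)[of k b] k by (simp cong: if_cong)
      qed
      have "s (diag_coeff b a) * (Y k a * insertion_sum k (R - {k}) (w, b)) +
        (if b < a then s hecke * (Y k b * insertion_sum k (R - {k}) (w, a)) else 0) =
        (s (diag_coeff b a) * (Y k a * (Y k b * ?D k)) + (if b < a then s hecke * (Y k b * (Y k a * ?D k))
            else 0)) +
        (\<Sum>t\<in>R - {k}. if t < k then s (hecke * exch (R - {k}) k t) *
          (s (diag_coeff b a) * (Y k a * (Y t b * ?D t)) + (if b < a then s hecke * (Y k b * (Y t a * ?D t))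
              else 0)) else 0)"
        unfolding Tk by (cases "b < a";
          simp add: distrib_left sum_distrib_left sum.distrib[symmetric] Y_s if_distrib[of "\<lambda>x. _ * x"]
            mult.commute[where 'a='k] algebra_simps cong: if_cong sum.cong;
          intro sum.cong refl; simp)
      also have "\<dots> = s q * (Y k b * (Y k a * ?D k)) +
        (\<Sum>t\<in>R - {k}. if t < k then s (hecke * exch (R - {k}) k t) * (Y t b * (Y k a * ?D t)) else 0)"
        by (subst rs, intro arg_cong2[of _ _ _ _ "(+)"] refl sum.cong) (simp add: rl)
      finally show ?thesis .
    qed
    \<comment> \<open>Makes the exchange terms of the summand \<open>r = k\<close> cancel the Hecke
      terms of the remaining summands.\<close>
    have coef: "e k * exch (R - {k}) k t = - q * e t" if "t < k" "t \<in> R" for t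
      using rank_remove[OF Cons.prems(1) k, of t] rank_remove[OF Cons.prems(1) k, of k] that q
      by (simp add: exch_def e_def)
    have "insertion_sum k R (a # w, b) = (\<Sum>r\<in>R. s (e r) *
      (s (diag_coeff b a) * (Y r a * insertion_sum k (R - {r}) (w, b)) +
          (if b < a then s hecke * (Y r b * insertion_sum k (R - {r}) (w, a)) else 0)))"
      by (simp add: insertion_sum_Cons e_def)
    also have "\<dots> = s (e k) * (s q * (Y k b * (Y k a * ?D k)) +
        (\<Sum>t\<in>R - {k}. if t < k then s (hecke * exch (R - {k}) k t) * (Y t b * (Y k a * ?D t)) else 0)) +
      (\<Sum>r\<in>R - {k}. s (q * e r) * (Y k b * (Y r a * ?D r)) +
        (if r < k then s (hecke * q * e r) * (Y r b * (Y k a * ?D r)) else 0))"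
      by (subst sum.remove[OF Cons.prems(1) k], subst 2) (simp add: 1)
    also have "\<dots> = s (q * e k) * (Y k b * (Y k a * ?D k)) +
      (\<Sum>r\<in>R - {k}. s (q * e r) * (Y k b * (Y r a * ?D r)) +
       ((if r < k then s (hecke * (e k * exch (R - {k}) k r)) * (Y r b * (Y k a * ?D r)) else 0) +
        (if r < k then s (hecke * q * e r) * (Y r b * (Y k a * ?D r)) else 0)))"
      by (simp add: distrib_left sum_distrib_left sum.distrib if_distrib[of "\<lambda>x. _ * x"] mult_ac cong: if_cong)
    also have "\<dots> = s (q * e k) * (Y k b * (Y k a * ?D k)) +
      (\<Sum>r\<in>R - {k}. s (q * e r) * (Y k b * (Y r a * ?D r)))"
      by (intro arg_cong2[of _ _ _ _ "(+)"] refl sum.cong) (auto simp: coef mult.assoc s_minus)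
    also have "\<dots> = (\<Sum>r\<in>R. s (q * e r) * (Y k b * (Y r a * ?D r)))"
      by (subst sum.remove[OF Cons.prems(1) k]) simp
    also have "\<dots> = s q * (Y k b * rdet R (a # w))"
      by (simp add: sum_distrib_left Y_s e_def)
    finally show "insertion_sum k R (a # w, b) = s q * (Y k b * rdet R (a # w))" .
  next
    assume k: "k \<notin> R"
    let ?D = "\<lambda>r. rdet (R - {r}) w" and ?G = "\<lambda>t r. Y t b * (Y r a * rdet (insert k (R - {t} - {r})) w)"
    have comm: "R - {r} - {t} = R - {t} - {r}" for r t by blast
    have 1: "s (diag_coeff b a) * (Y r a * insertion_sum k (R - {r}) (w, b)) +
        (if b < a then s hecke * (Y r b * insertion_sum k (R - {r}) (w, a)) else 0) =
      Y k b * (Y r a * ?D r) + (if r < k then s hecke * (Y r b * (Y k a * ?D r)) else 0) +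
      (\<Sum>t\<in>R - {r}. if t < k then s (hecke * exch (R - {r}) k t) *
          (?G t r + (if r < t then s hecke * ?G r t else 0)) else 0)"
      if r: "r \<in> R" for r
    proof -
      let ?E = "\<lambda>t. rdet (insert k (R - {r} - {t})) w"
      have "s (diag_coeff b a) * (Y r a * insertion_sum k (R - {r}) (w, b)) +
        (if b < a then s hecke * (Y r b * insertion_sum k (R - {r}) (w, a)) else 0) =
        (s (diag_coeff b a) * (Y r a * (Y k b * ?D r)) + (if b < a then s hecke * (Y r b * (Y k a * ?D r))
            else 0)) +
        (\<Sum>t\<in>R - {r}. if t < k then s (hecke * exch (R - {r}) k t) *
          (s (diag_coeff b a) * (Y r a * (Y t b * ?E t)) + (if b < a then s hecke * (Y r b * (Y t a * ?E t))
              else 0)) else 0)"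
        using IH(2)[OF r] k by (cases "b < a";
          simp add: distrib_left sum_distrib_left sum.distrib[symmetric] Y_s if_distrib[of "\<lambda>x. _ * x"]
            mult.commute[where 'a='k] algebra_simps cong: if_cong sum.cong;
          intro sum.cong refl; simp)
      also have "\<dots> = Y k b * (Y r a * ?D r) + (if r < k then s hecke * (Y r b * (Y k a * ?D r)) else 0) +
        (\<Sum>t\<in>R - {r}. if t < k then s (hecke * exch (R - {r}) k t) *
          (Y t b * (Y r a * ?E t) + (if r < t then s hecke * (Y r b * (Y t a * ?E t)) else 0)) else 0)"
      proof -
        have "r \<noteq> k" using r k by blast
        show ?thesis
          by (subst rl[OF \<open>r \<noteq> k\<close>], intro arg_cong2[of _ _ _ _ "(+)"] refl sum.cong) (simp add: rl)
      qed
      finally show ?thesis by (simp add: comm cong: if_cong)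
    qed
    \<comment> \<open>Rows \<open>t\<close> and \<open>r\<close> can be produced in two ways, both
      of which contribute only if \<open>t < r < k\<close>. There the identity rests on
      \<open>- q + (q - inverse q) = - inverse q\<close>; in the other cases the ranks agree
      directly.\<close>
    have coef: "e r * exch (R - {r}) k t + (if t < r \<and> r < k then hecke * (e t * exch (R - {t}) k r) else 0) =
        exch R k t * (- q) ^ rank (insert k (R - {t})) r" if "t \<in> R" "r \<in> R" "t \<noteq> r" "t < k" for r t
    proof -
      note fin = Cons.prems(1)
      have R: "rank R x = rank (R - {r}) x + (if r < x then 1 else 0)"
        "rank R x = rank (R - {t}) x + (if t < x then 1 else 0)" for x
        by (rule rank_remove[OF fin that(2)], rule rank_remove[OF fin that(1)])
      have I: "rank (insert k (R - {t})) r = rank (R - {t}) r + (if k < r then 1 else 0)"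
        using rank_insert[of "R - {t}" k r] fin k by simp
      have "r \<noteq> k" "t \<noteq> k" using that k by auto
      note trk = that(3,4)
      then consider "r < t" "r < k" | "t < r" "r < k" | "t < r" "k < r" using \<open>r \<noteq> k\<close> trk by linarith
      then show ?thesis
      proof cases
        case 1
        then have "rank R t = Suc (rank (R - {r}) t)" "rank R k = Suc (rank (R - {r}) k)"
          "rank (insert k (R - {t})) r = rank R r"
          using R(1)[of t] R(1)[of k] R(2)[of r] I that by auto
        then show ?thesis using 1 q by (simp add: exch_def e_def)
      next
        case 2
        then have *: "rank (R - {r}) t = rank R t" "rank R k = Suc (rank (R - {r}) k)" "rank R r = Suc
            (rank (R - {t}) r)"
          "rank (R - {t}) k = rank (R - {r}) k" "rank (insert k (R - {t})) r = rank (R - {t}) r"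
          using R(1)[of t] R(1)[of k] R(2)[of r] R(2)[of k] I that by auto
        show ?thesis using 2 q unfolding exch_def e_def hecke_def * by (simp add: field_simps)
      next
        case 3
        then have "rank (R - {r}) t = rank R t" "rank (R - {r}) k = rank R k"
          "rank (insert k (R - {t})) r = rank R r"
          using R(1)[of t] R(1)[of k] R(2)[of r] I that by auto
        then show ?thesis using 3 q by (simp add: exch_def e_def)
      qed
    qed
    \<comment> \<open>The coefficient of the summand in which the expansion of
      \<open>insert k (R - {t})\<close> picks the row \<open>k\<close> itself.\<close>
    have coef_k: "exch R k t * (- q) ^ rank (insert k (R - {t})) k = e t" if "t \<in> R" "t < k" for t
      using rank_remove[OF Cons.prems(1) that(1), of k] rank_insert[of "R - {t}" k k] that Cons.prems(1) k q
      by (simp add: exch_def e_def)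
    have "insertion_sum k R (a # w, b) = (\<Sum>r\<in>R. s (e r) *
      (s (diag_coeff b a) * (Y r a * insertion_sum k (R - {r}) (w, b)) +
          (if b < a then s hecke * (Y r b * insertion_sum k (R - {r}) (w, a)) else 0)))"
      by (simp add: insertion_sum_Cons e_def)
    also have "\<dots> = (\<Sum>r\<in>R. s (e r) * (Y k b * (Y r a * ?D r)) +
       ((if r < k then s (hecke * e r) * (Y r b * (Y k a * ?D r)) else 0) +
       (\<Sum>t\<in>R - {r}. if t < k then s (hecke * (e r * exch (R - {r}) k t)) * (?G t r) +
         (if r < t then s (hecke * (hecke * (e r * exch (R - {r}) k t))) * ?G r t else 0) else 0)))"
      by (intro sum.cong refl, subst 1)
        (auto simp: distrib_left sum_distrib_left if_distrib[of "\<lambda>x. _ * x"] mult_ac add.assoc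
          intro!: sum.cong cong: if_cong)
    also have "\<dots> = Y k b * rdet R (a # w) +
       ((\<Sum>t\<in>R. (if t < k then s (hecke * e t) * (Y t b * (Y k a * ?D t)) else 0)) +
       (\<Sum>r\<in>R. \<Sum>t\<in>R - {r}. if t < k then s (hecke * (e r * exch (R - {r}) k t)) * (?G t r) +
         (if r < t then s (hecke * (hecke * (e r * exch (R - {r}) k t))) * ?G r t else 0) else 0))"
      by (simp add: sum.distrib sum_distrib_left Y_s e_def)
    \<comment> \<open>Hecke terms carry \<open>t\<close> and \<open>r\<close> in interchanged roles.
      Swapping the summations and renaming collects both kinds at \<open>?G t r\<close>.\<close>
    also have "(\<Sum>r\<in>R. \<Sum>t\<in>R - {r}. if t < k then s (hecke * (e r * exch (R - {r}) k t)) * (?G t r) +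
         (if r < t then s (hecke * (hecke * (e r * exch (R - {r}) k t))) * ?G r t else 0) else 0) =
       (\<Sum>t\<in>R. \<Sum>r\<in>R. if t \<noteq> r \<and> t < k then s (hecke * (e r * exch (R - {r}) k t)) * ?G t r else 0) +
       (\<Sum>r\<in>R. \<Sum>t\<in>R. if r < t \<and> t < k then s (hecke * (hecke * (e r * exch (R - {r}) k t))) * ?G r t else 0)"
    proof -
      have "(\<Sum>r\<in>R. \<Sum>t\<in>R - {r}. if t < k then s (hecke * (e r * exch (R - {r}) k t)) * (?G t r) +
         (if r < t then s (hecke * (hecke * (e r * exch (R - {r}) k t))) * ?G r t else 0) else 0) =
        (\<Sum>r\<in>R. \<Sum>t\<in>R. (if t \<noteq> r \<and> t < k then s (hecke * (e r * exch (R - {r}) k t)) * ?G t r else 0) +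
         (if r < t \<and> t < k then s (hecke * (hecke * (e r * exch (R - {r}) k t))) * ?G r t else 0))"
        using Cons.prems(1) by (intro sum.cong refl sum.mono_neutral_cong_left) auto
      also have "\<dots> = (\<Sum>r\<in>R. \<Sum>t\<in>R. if t \<noteq> r \<and> t < k then s (hecke * (e r * exch (R - {r}) k t)) * ?G t r
          else 0) +
         (\<Sum>r\<in>R. \<Sum>t\<in>R. if r < t \<and> t < k then s (hecke * (hecke * (e r * exch (R - {r}) k t))) * ?G r t else 0)"
        by (simp add: sum.distrib)
      finally show ?thesis by (subst (asm) sum.swap) simp
    qed
    also have "\<dots> = (\<Sum>t\<in>R. \<Sum>r\<in>R. if t \<noteq> r \<and> t < k then
        s (hecke * (e r * exch (R - {r}) k t + (if t < r \<and> r < k then hecke * (e t * exch (R - {t}) k r)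
            else 0))) * ?G t r else 0)"
      unfolding sum.distrib[symmetric]
      by (intro sum.cong refl) (auto simp: s_add distrib_left distrib_right)
    also have "\<dots> = (\<Sum>t\<in>R. \<Sum>r\<in>R. if t \<noteq> r \<and> t < k then
        s (hecke * (exch R k t * (- q) ^ rank (insert k (R - {t})) r)) * ?G t r else 0)"
    proof (intro sum.cong refl)
      fix t r assume t: "t \<in> R" and r: "r \<in> R"
      show "(if t \<noteq> r \<and> t < k then
          s (hecke * (e r * exch (R - {r}) k t + (if t < r \<and> r < k then hecke * (e t * exch (R - {t}) k r)
              else 0))) * ?G t r else 0) =
        (if t \<noteq> r \<and> t < k then s (hecke * (exch R k t * (- q) ^ rank (insert k (R - {t})) r)) * ?G t r else 0)"
      proof (cases "t \<noteq> r \<and> t < k")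
        case True
        then show ?thesis by (subst coef[OF t r]) simp_all
      next
        case False
        then show ?thesis by (simp only: if_False)
      qed
    qed
    also have "(\<Sum>t\<in>R. if t < k then s (hecke * e t) * (Y t b * (Y k a * ?D t)) else 0) + \<dots> =
       (\<Sum>t\<in>R. if t < k then s (hecke * exch R k t) * (Y t b * rdet (insert k (R - {t})) (a # w)) else 0)"
      unfolding sum.distrib[symmetric]
    proof (intro sum.cong refl)
      fix t assume t: "t \<in> R"
      show "(if t < k then s (hecke * e t) * (Y t b * (Y k a * ?D t)) else 0) +
        (\<Sum>r\<in>R. if t \<noteq> r \<and> t < k then s (hecke * (exch R k t * (- q) ^ rank (insert k (R - {t})) r)) * ?G t r
            else 0) =
        (if t < k then s (hecke * exch R k t) * (Y t b * rdet (insert k (R - {t})) (a # w)) else 0)"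
      proof (cases "t < k")
        case True
        have "s (hecke * exch R k t) * (Y t b * rdet (insert k (R - {t})) (a # w)) =
          (\<Sum>r\<in>insert k (R - {t}). s (hecke * (exch R k t * (- q) ^ rank (insert k (R - {t})) r)) *
            (Y t b * (Y r a * rdet (insert k (R - {t}) - {r}) w)))"
          by (simp add: sum_distrib_left Y_s mult.assoc del: sum.insert sum.insert_if)
        also have "\<dots> = s (hecke * e t) * (Y t b * (Y k a * ?D t)) +
          (\<Sum>r\<in>R - {t}. s (hecke * (exch R k t * (- q) ^ rank (insert k (R - {t})) r)) *
            (Y t b * (Y r a * rdet (insert k (R - {t}) - {r}) w)))"
          using Cons.prems(1) k by (subst sum.insert) (simp_all add: coef_k[OF t True])
        also have "(\<Sum>r\<in>R - {t}. s (hecke * (exch R k t * (- q) ^ rank (insert k (R - {t})) r)) *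
            (Y t b * (Y r a * rdet (insert k (R - {t}) - {r}) w))) =
          (\<Sum>r\<in>R - {t}. s (hecke * (exch R k t * (- q) ^ rank (insert k (R - {t})) r)) * ?G t r)"
        proof (intro sum.cong refl)
          fix r assume "r \<in> R - {t}"
          then have "insert k (R - {t}) - {r} = insert k (R - {t} - {r})" using k by auto
          then show "s (hecke * (exch R k t * (- q) ^ rank (insert k (R - {t})) r)) *
            (Y t b * (Y r a * rdet (insert k (R - {t}) - {r}) w)) =
            s (hecke * (exch R k t * (- q) ^ rank (insert k (R - {t})) r)) * ?G t r" by simp
        qed
        also have "\<dots> = (\<Sum>r\<in>R. if t \<noteq> r \<and> t < k then
            s (hecke * (exch R k t * (- q) ^ rank (insert k (R - {t})) r)) * ?G t r else 0)"
          using Cons.prems(1) True by (intro sum.mono_neutral_cong_left) auto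
        finally show ?thesis using True by simp
      qed simp
    qed
    finally show "insertion_sum k R (a # w, b) = Y k b * rdet R (a # w) +
      (\<Sum>t\<in>R. if t < k then s (hecke * exch R k t) * (Y t b * rdet (insert k (R - {t})) (a # w)) else 0)" .
  qed
qed

corollary gen_mult_rdet:
  assumes "finite R" "card R = length w" "k \<in> R"
  shows "s q * (Y k b * rdet R w) = (\<Sum>(c, w', b')\<leftarrow>insertions b w. s c * (rdet R w' * Y k b'))"
  using insertion_sum_eq[of R w k b] assms by (simp add: insertion_sum_def)

text \<open>The last letter of \<open>v\<close> stands next to \<open>w\<close> and is therefore
  moved first, so the recursion treats the tail of \<open>v\<close> before its head.\<close>

primrec word_insertions :: "nat list \<Rightarrow> nat list \<Rightarrow> ('k \<times> nat list \<times> nat list) list" where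
  "word_insertions [] w = [(1, w, [])]"
| "word_insertions (b # v) w = concat (map (\<lambda>(c, w', v'). map (\<lambda>(d, w'', b'). (c * d, w'', b' # v'))
    (insertions b w'))
    (word_insertions v w))"

text \<open>The head of the list is the term in which \<open>b\<close> passes every letter. Any
  exchange leaves the smaller letter in the word and carries the larger one away, so the word loses
  exactly what the carried letter gains.\<close>

lemma insertions_head:
  "\<exists>c rest. c \<noteq> 0 \<and> insertions b w = (c, w, b) # rest \<and> (\<forall>(d, w', b') \<in> set rest.
    sum_list w' < sum_list w \<and> sum_list w' + b' = sum_list w + b)"
proof (induction w arbitrary: b)
  case (Cons a w)
  obtain c rest where c: "c \<noteq> 0" "insertions b w = (c, w, b) # rest"
    "\<forall>(d, w', b') \<in> set rest. sum_list w' < sum_list w \<and> sum_list w' + b' = sum_list w + b"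
    using Cons by blast
  obtain c1 rest1 where c1: "insertions a w = (c1, w, a) # rest1"
    "\<forall>(d, w', b') \<in> set rest1. sum_list w' < sum_list w \<and> sum_list w' + b' = sum_list w + a"
    using Cons by blast
  show ?case
    by (intro exI[of _ "diag_coeff b a * c"] exI[of _ "tl (insertions b (a # w))"])
      (use c c1 q in \<open>auto simp: diag_coeff_def\<close>)
qed auto

lemma insertions_set: "(c, w', b') \<in> set (insertions b w) \<Longrightarrow>
    length w' = length w \<and> set w' \<subseteq> insert b (set w) \<and> b' \<in> insert b (set w)"
proof (induction w arbitrary: b c w' b')
  case (Cons a w)
  then consider d v where "(d, v, b') \<in> set (insertions b w)" "w' = a # v"
    | d v where "(d, v, b') \<in> set (insertions a w)" "w' = b # v"
    by (auto split: if_splits)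
  then show ?case by cases (use Cons.IH in fastforce)+
qed auto

lemma word_insertions_set: "(c, w', v') \<in> set (word_insertions v w) \<Longrightarrow>
    length w' = length w \<and> length v' = length v \<and> set w' \<subseteq> set v \<union> set w \<and> set v' \<subseteq> set v \<union> set w"
proof (induction v arbitrary: c w' v')
  case (Cons b v)
  then obtain d w1 v1 e b' where "(d, w1, v1) \<in> set (word_insertions v w)" "(e, w', b') \<in> set
      (insertions b w1)" "v' = b' # v1"
    by auto
  then show ?case using Cons.IH[of d w1 v1] insertions_set[of e w' b' b w1] by auto
qed auto

lemma word_insertions_head:
  "\<exists>c rest. c \<noteq> 0 \<and> word_insertions v w = (c, w, v) # rest \<and> (\<forall>(d, w', v') \<in> set rest.
    sum_list w' < sum_list w \<and> sum_list w' + sum_list v' = sum_list w + sum_list v)"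
proof (induction v)
  case (Cons b v)
  obtain c rest where c: "c \<noteq> 0" "word_insertions v w = (c, w, v) # rest"
    "\<forall>(d, w', v') \<in> set rest. sum_list w' < sum_list w \<and> sum_list w' + sum_list v' = sum_list w + sum_list v"
    using Cons by blast
  obtain c1 rest1 where c1: "c1 \<noteq> 0" "insertions b w = (c1, w, b) # rest1"
    "\<forall>(d, w', b') \<in> set rest1. sum_list w' < sum_list w \<and> sum_list w' + b' = sum_list w + b"
    using insertions_head by blast
  have le: "sum_list w' \<le> sum_list w1 \<and> sum_list w' + b' = sum_list w1 + b"
    if "(d, w', b') \<in> set (insertions b w1)" for d w' b' w1
    using insertions_head[of b w1] that by fastforce
  show ?case
    by (intro exI[of _ "c * c1"] exI[of _ "tl (word_insertions (b # v) w)"])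
      (use c c1 in \<open>auto dest!: le\<close>)
qed auto

text \<open>Every row of \<open>R\<close> lies in \<open>F\<close>, so \<open>gen_mult_rdet\<close>
  moves each letter of \<open>v\<close> across at the price of one factor \<open>q\<close>. Two row
  sets are needed because \<open>R\<close> shrinks along the induction while \<open>F\<close>
  stays.\<close>

lemma rdet_mult_rdet:
  assumes "finite F" "card F = length w" "R \<subseteq> F" "card R = length v"
  shows "s (q ^ length v) * (rdet R v * rdet F w) = (\<Sum>(c, w', v')\<leftarrow>word_insertions v w. s c *
      (rdet F w' * rdet R v'))"
  using assms(3,4)
proof (induction v arbitrary: R)
  case Nil
  then show ?case by (simp add: s_one)
next
  case (Cons b v)
  have fin: "finite R" using assms(1) Cons.prems(1) finite_subset by blast
  have Y: "s q * (Y r b * (rdet F w' * z)) = (\<Sum>(d, w'', b')\<leftarrow>insertions b w'. s d * (rdet F w'' * (Y r b' * z)))"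
    if "length w' = length w" "r \<in> R" for w' r z
  proof -
    have "s q * (Y r b * (rdet F w' * z)) = (s q * (Y r b * rdet F w')) * z" by (simp add: mult.assoc)
    also have "\<dots> = (\<Sum>(d, w'', b')\<leftarrow>insertions b w'. s d * (rdet F w'' * Y r b')) * z"
      using gen_mult_rdet[of F w' r b] assms that Cons.prems by auto
    also have "\<dots> = (\<Sum>(d, w'', b')\<leftarrow>insertions b w'. s d * (rdet F w'' * (Y r b' * z)))"
      by (simp add: sum_list_mult_const[symmetric] case_prod_unfold mult.assoc)
    finally show ?thesis .
  qed
  have inner: "(\<Sum>(d, w'', b')\<leftarrow>xs. s (c * d) * (rdet F w'' * rdet R (b' # v'))) =
     (\<Sum>r\<in>R. s (c * (- q) ^ rank R r) * (\<Sum>(d, w'', b')\<leftarrow>xs. s d * (rdet F w'' * (Y r b' * rdet (R - {r}) v'))))"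
    for xs c v'
  proof (induction xs)
    case (Cons x xs)
    obtain d w'' b' where x: "x = (d, w'', b')" by (metis prod_cases3)
    have "s (c * d) * (rdet F w'' * rdet R (b' # v')) =
      (\<Sum>r\<in>R. s (c * (- q) ^ rank R r) * (s d * (rdet F w'' * (Y r b' * rdet (R - {r}) v'))))"
      by (simp add: sum_distrib_left s_left_comm[of "rdet F w''"] mult_ac)
    then show ?case
      using Cons by (simp add: x distrib_left sum.distrib)
  qed simp
  have outer: "(\<Sum>(c, w', v')\<leftarrow>concat (map (\<lambda>(c, w', v'). map (\<lambda>(d, w'', b'). (c * d, w'', b' # v'))
      (insertions b w')) xs).
      s c * (rdet F w' * rdet R v')) =
     (\<Sum>r\<in>R. s ((- q) ^ rank R r) * (s q * (Y r b * (\<Sum>(c, w', v')\<leftarrow>xs. s c * (rdet F w' * rdet (R - {r}) v')))))"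
    if "\<forall>(c, w', v') \<in> set xs. length w' = length w" for xs
    using that
  proof (induction xs)
    case (Cons x xs)
    obtain c w' v' where x: "x = (c, w', v')" by (metis prod_cases3)
    have "(\<Sum>(c, w', v')\<leftarrow>map (\<lambda>(d, w'', b'). (c * d, w'', b' # v')) (insertions b w'). s c *
        (rdet F w' * rdet R v')) =
      (\<Sum>(d, w'', b')\<leftarrow>insertions b w'. s (c * d) * (rdet F w'' * rdet R (b' # v')))"
      by (simp only: map_map comp_def case_prod_unfold fst_conv snd_conv)
    also have "\<dots> = (\<Sum>r\<in>R. s (c * (- q) ^ rank R r) * (s q * (Y r b * (rdet F w' * rdet (R - {r}) v'))))"
      unfolding inner using Cons.prems x by (intro sum.cong refl) (simp add: Y)
    also have "\<dots> = (\<Sum>r\<in>R. s ((- q) ^ rank R r) * (s q * (Y r b * (s c * (rdet F w' * rdet (R - {r}) v')))))"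
      by (simp add: Y_s mult_ac)
    finally show ?case
      using Cons by (simp add: x distrib_left sum.distrib)
  qed simp
  have "s (q ^ length (b # v)) * (rdet R (b # v) * rdet F w) =
     (\<Sum>r\<in>R. s ((- q) ^ rank R r) * (s q * (Y r b * (s (q ^ length v) * (rdet (R - {r}) v * rdet F w)))))"
    by (simp add: sum_distrib_left sum_distrib_right mult.assoc Y_s mult_ac)
  also have "\<dots> = (\<Sum>r\<in>R. s ((- q) ^ rank R r) *
      (s q * (Y r b * (\<Sum>(c, w', v')\<leftarrow>word_insertions v w. s c * (rdet F w' * rdet (R - {r}) v')))))"
    using Cons.prems fin by (intro sum.cong refl) (subst Cons.IH, auto)
  also have "\<dots> = (\<Sum>(c, w', v')\<leftarrow>word_insertions (b # v) w. s c * (rdet F w' * rdet R v'))"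
    by (subst outer[symmetric]) (use word_insertions_set[of _ _ _ v w] in \<open>auto simp only:
        word_insertions.simps split: prod.split\<close>)
  finally show ?case .
qed

section \<open>Antisymmetry in the columns and sorting of column words\<close>

lemma rdet_swap:
  assumes "finite R" "b \<le> a"
  shows "rdet R (a # b # w) = s (- q) * rdet R (b # a # w)"
    and "rdet R (a # a # w) = 0"
proof -
  let ?e = "\<lambda>r t. (- q) ^ rank R r * (- q) ^ rank (R - {r}) t"
  let ?Z = "\<lambda>a b r t. s (?e r t) * (Y r a * (Y t b * rdet (R - {r} - {t}) w))"
  have exp: "rdet R (a # b # w) = (\<Sum>r\<in>R. \<Sum>t\<in>R. if r < t then ?Z a b r t + ?Z a b t r else 0)" for a b
  proof -
    have "rdet R (a # b # w) = (\<Sum>r\<in>R. \<Sum>t\<in>R - {r}. ?Z a b r t)"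
      by (simp add: sum_distrib_left Y_s)
    also have "\<dots> = (\<Sum>r\<in>R. \<Sum>t\<in>R. (if r < t then ?Z a b r t else 0) + (if t < r then ?Z a b r t else 0))"
      using assms(1) by (intro sum.cong refl sum.mono_neutral_cong_left) auto
    also have "\<dots> = (\<Sum>r\<in>R. \<Sum>t\<in>R. if r < t then ?Z a b r t else 0) + (\<Sum>t\<in>R. \<Sum>r\<in>R. if t < r then ?Z a b r t
        else 0)"
      by (subst (3) sum.swap) (simp add: sum.distrib)
    also have "\<dots> = (\<Sum>r\<in>R. \<Sum>t\<in>R. if r < t then ?Z a b r t + ?Z a b t r else 0)"
      unfolding sum.distrib[symmetric] by (intro sum.cong refl) simp
    finally show ?thesis .
  qed
  \<comment> \<open>Interchanging the rows \<open>r < t\<close> changes the sign factor by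
    \<open>- q\<close>, so each pair of rows contributes a 2 x 2 determinant.\<close>
  have pair: "?Z a b r t + ?Z a b t r = s (?e r t) * ((Y r a * Y t b + s (- q) * (Y t a * Y r b)) * rdet
      (R - {r} - {t}) w)"
    if "r < t" "r \<in> R" "t \<in> R" for a b r t
  proof -
    have "rank R t = Suc (rank (R - {r}) t)" "rank R r = rank (R - {t}) r"
      using rank_remove[OF assms(1) that(2), of t] rank_remove[OF assms(1) that(3), of r] that(1) by auto
    then have "?e t r = ?e r t * (- q)" by simp
    moreover have "R - {t} - {r} = R - {r} - {t}" by blast
    ultimately show ?thesis by (simp only:) (simp add: right_diff_distrib left_diff_distrib mult.assoc mult_ac)
  qed
  have "Y r a * Y t b + s (- q) * (Y t a * Y r b) = s (- q) * (Y r b * Y t a + s (- q) * (Y t b * Y r a))"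
    if "r < t" "b < a" for r t
  proof -
    have 1: "Y t a * Y r b = Y r b * Y t a - s (q - inverse q) * (Y r a * Y t b)"
      using rel[of r t a b] that by (simp add: s_one algebra_simps)
    have 2: "Y t b * Y r a = Y r a * Y t b"
      using rel[of r t b a] that by (simp add: s_one)
    have 3: "- q * - q = q * q" "q * (q - inverse q) + 1 = q * q" using q by (auto simp: algebra_simps)
    have "Y r a * Y t b + s (- q) * (Y t a * Y r b) =
      s (q * (q - inverse q) + 1) * (Y r a * Y t b) + s (- q) * (Y r b * Y t a)"
      unfolding 1 by (simp add: right_diff_distrib s_add distrib_right s_one s_minus)
    also have "\<dots> = s (- q) * (Y r b * Y t a + s (- q) * (Y t b * Y r a))"
      unfolding 3 2 by (simp add: right_diff_distrib)
    finally show ?thesis .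
  qed
  moreover have zero: "Y r a * Y t a + s (- q) * (Y t a * Y r a) = 0" if "r < t" for r t
  proof -
    have "Y t a * Y r a = s q * (Y r a * Y t a) - s (q - inverse q) * (Y r a * Y t a)"
      using rel[of r t a a] that by (simp add: s_one algebra_simps)
    also have "\<dots> = s (inverse q) * (Y r a * Y t a)" by (simp add: s_diff left_diff_distrib)
    finally have "s (- q) * (Y t a * Y r a) = s (- q * inverse q) * (Y r a * Y t a)" by simp
    then show ?thesis using q by (simp add: s_minus s_one)
  qed
  ultimately have "Y r a * Y t b + s (- q) * (Y t a * Y r b) = s (- q) *
      (Y r b * Y t a + s (- q) * (Y t b * Y r a))"
    if "r < t" for r t
    using assms(2) that by (cases "a = b") auto
  then show "rdet R (a # b # w) = s (- q) * rdet R (b # a # w)"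
    unfolding exp sum_distrib_left
    by (intro sum.cong refl) (simp add: pair mult.assoc mult.commute mult.left_commute del: vs.scale_minus_left)
  show "rdet R (a # a # w) = 0"
    unfolding exp by (intro sum.neutral ballI) (simp add: pair zero[simplified])
qed

text \<open>The constant must not depend on \<open>R\<close>: expanding along the first column, the
  induction hypothesis is applied to all sets \<open>R - {r}\<close> at once and a common factor is
  pulled out.\<close>

lemma rdet_insort: "\<exists>c. \<forall>R. finite R \<longrightarrow> rdet R (a # l) = s c * rdet R (insort a l)"
proof (induction l)
  case (Cons b l)
  then obtain c where c: "\<And>R. finite R \<Longrightarrow> rdet R (a # l) = s c * rdet R (insort a l)" by blast
  show ?case
  proof (cases "a \<le> b")
    case False
    have "rdet R (a # b # l) = s (- q * c) * rdet R (insort a (b # l))" if R: "finite R" for R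
    proof -
      have "rdet R (b # a # l) = s c * rdet R (b # insort a l)"
        using R by (simp only: rdet.simps(2)[of _ b])
          (simp only: c finite_Diff Y_s sum_distrib_left vs.scale_scale mult.commute)
      then show ?thesis using rdet_swap(1)[OF R, of b a l] False by (simp del: rdet.simps)
    qed
    then show ?thesis by blast
  qed (use s_one in \<open>auto intro!: exI[of _ 1]\<close>)
qed (use s_one in \<open>auto intro!: exI[of _ 1]\<close>)

lemma rdet_sort: "\<exists>c. \<forall>R. finite R \<longrightarrow> rdet R w = s c * rdet R (sort w)"
proof (induction w)
  case (Cons a w)
  then obtain c where c: "\<And>R. finite R \<Longrightarrow> rdet R w = s c * rdet R (sort w)" by blast
  obtain d where d: "\<And>R. finite R \<Longrightarrow> rdet R (a # sort w) = s d * rdet R (insort a (sort w))"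
    using rdet_insort by blast
  have "rdet R (a # w) = s (c * d) * rdet R (sort (a # w))" if R: "finite R" for R
  proof -
    have "rdet R (a # w) = s c * rdet R (a # sort w)"
      using R by (simp only: rdet.simps(2)[of _ a])
        (simp only: c finite_Diff Y_s sum_distrib_left vs.scale_scale mult.commute)
    then show ?thesis using d[OF R] by simp
  qed
  then show ?case by blast
qed (use s_one in \<open>auto intro!: exI[of _ 1]\<close>)

text \<open>In a sorted word equal letters are adjacent, where \<open>rdet_swap\<close> gives zero;
  letters in front of them are removed by expansion.\<close>

lemma rdet_not_distinct:
  assumes "sorted w" "\<not> distinct w" "finite R"
  shows "rdet R w = 0"
  using assms
proof (induction w arbitrary: R)
  case (Cons a w)
  show ?case
  proof (cases "a \<in> set w")
    case True
    then obtain b v where w: "w = b # v" by (cases w) auto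
    have "b = a" using True Cons.prems(1) w by auto
    then show ?thesis using rdet_swap(2)[OF Cons.prems(3) order.refl, of a v] w by (simp del: rdet.simps)
  next
    case False
    then show ?thesis using Cons by simp
  qed
qed simp

lemma rdet_cases:
  "(\<exists>c. \<forall>R. finite R \<longrightarrow> rdet R w = s c * rdet R (sorted_list_of_set (set w))) \<and>
   (\<not> distinct w \<longrightarrow> (\<forall>R. finite R \<longrightarrow> rdet R w = 0))"
proof -
  obtain c where c: "\<And>R. finite R \<Longrightarrow> rdet R w = s c * rdet R (sort w)" using rdet_sort by blast
  show ?thesis
  proof (cases "distinct w")
    case True
    then have "sort w = sorted_list_of_set (set w)"
      by (simp add: sorted_list_of_set_sort_remdups distinct_remdups_id)
    then show ?thesis using c True by auto
  next
    case False
    then have "rdet R w = 0" if "finite R" for R using c[OF that] rdet_not_distinct[of "sort w" R] that by simp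
    then show ?thesis using s_zero by (auto intro!: exI[of _ 0])
  qed
qed

section \<open>Agreement of row and column expansions\<close>

primrec cdet :: "nat list \<Rightarrow> nat set \<Rightarrow> 'a" where
  "cdet [] J = 1"
| "cdet (r # v) J = (\<Sum>j\<in>J. s ((- q) ^ rank J j) * (Y r j * cdet v (J - {j})))"

lemma rank_Min: "rank R (Min R) = 0" if "finite R"
proof -
  have "{t \<in> R. t < Min R} = {}" using Min_le[OF that] leD by blast
  then show ?thesis by (simp add: rank_def)
qed

text \<open>The commutation argument antisymmetrises rows, the definition of a minor antisymmetrises
  columns. Expanding both along the first row and the first column leaves, apart from the corner,
  products of antidiagonal entries \<open>(r, Min J)\<close> and \<open>(Min R, j)\<close>, and
  these commute.\<close>

lemma rdet_eq_cdet:
  assumes "finite R" "finite J" "card R = card J"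
  shows "rdet R (sorted_list_of_set J) = cdet (sorted_list_of_set R) J"
  using assms
proof (induction "card R" arbitrary: R J rule: less_induct)
  case less
  note fin = less.prems(1,2)
  show ?case
  proof (cases "R = {}")
    case True
    then show ?thesis using less.prems by simp
  next
    case False
    then have J: "J \<noteq> {}" using less.prems by auto
    let ?r = "Min R" and ?j = "Min J"
    let ?R = "R - {?r}" and ?J = "J - {?j}"
    have mem: "?r \<in> R" "?j \<in> J" using False J fin by auto
    have listR: "sorted_list_of_set R = ?r # sorted_list_of_set ?R"
      using sorted_list_of_set_nonempty[OF fin(1) False] .
    have listJ: "sorted_list_of_set J = ?j # sorted_list_of_set ?J"
      using sorted_list_of_set_nonempty[OF fin(2) J] .
    have card: "card ?R < card R" "card ?R = card ?J"
      using card_Diff1_less[OF fin(1) mem(1)] mem less.prems(3) by auto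
    have rankR: "rank R t = Suc (rank ?R t)" if "t \<in> ?R" for t
    proof -
      have "?r < t" using that fin Min_le[of R t] by (auto simp: less_le)
      then show ?thesis using rank_remove[OF fin(1) mem(1), of t] by simp
    qed
    have rankJ: "rank J t = Suc (rank ?J t)" if "t \<in> ?J" for t
    proof -
      have "?j < t" using that fin Min_le[of J t] by (auto simp: less_le)
      then show ?thesis using rank_remove[OF fin(2) mem(2), of t] by simp
    qed
    let ?C = "\<lambda>r j. cdet (sorted_list_of_set (R - {?r} - {r})) (J - {?j} - {j})"
    \<comment> \<open>The induction hypothesis turns the column expansion of the complementary minor
      into a row expansion, so that its first row can be split off.\<close>
    have minor_r: "rdet (R - {r}) (sorted_list_of_set ?J) = (\<Sum>j\<in>?J. s ((- q) ^ rank ?J j) * (Y ?r j * ?C r j))"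
      if r: "r \<in> ?R" for r
    proof -
      have "rdet (R - {r}) (sorted_list_of_set ?J) = cdet (sorted_list_of_set (R - {r})) ?J"
        using less.hyps[of "R - {r}" ?J] card_Diff1_less[OF fin(1), of r] r fin mem less.prems(3) by auto
      moreover have "sorted_list_of_set (R - {r}) = ?r # sorted_list_of_set (R - {?r} - {r})"
      proof -
        have "Min (R - {r}) = ?r" using r fin mem by (intro Min_eqI) auto
        moreover have "R - {r} - {?r} = R - {?r} - {r}" by blast
        ultimately show ?thesis using sorted_list_of_set_nonempty[of "R - {r}"] r fin mem by auto
      qed
      ultimately show ?thesis by simp
    qed
    \<comment> \<open>The same with rows and columns exchanged; a second use of the induction
      hypothesis brings the twice reduced minors to the common form \<open>?C r j\<close>.\<close>
    have minor_j: "cdet (sorted_list_of_set ?R) (J - {j}) = (\<Sum>r\<in>?R. s ((- q) ^ rank ?R r) * (Y r ?j * ?C r j))"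
      if j: "j \<in> ?J" for j
    proof -
      have "cdet (sorted_list_of_set ?R) (J - {j}) = rdet ?R (sorted_list_of_set (J - {j}))"
        using less.hyps[of ?R "J - {j}"] card j fin mem less.prems(3) by auto
      also have "sorted_list_of_set (J - {j}) = ?j # sorted_list_of_set (J - {?j} - {j})"
      proof -
        have "Min (J - {j}) = ?j" using j fin mem by (intro Min_eqI) auto
        moreover have "J - {j} - {?j} = J - {?j} - {j}" by blast
        ultimately show ?thesis using sorted_list_of_set_nonempty[of "J - {j}"] j fin mem by auto
      qed
      also have "rdet ?R \<dots> = (\<Sum>r\<in>?R. s ((- q) ^ rank ?R r) * (Y r ?j * ?C r j))"
        unfolding rdet.simps
      proof (intro sum.cong refl)
        fix r assume r: "r \<in> ?R"
        have "card (?R - {r}) < card R" using r fin mem card(1) by (simp add: card_Diff1_less card_mono)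
        then have "rdet (?R - {r}) (sorted_list_of_set (?J - {j})) = ?C r j"
          using less.hyps[of "?R - {r}" "?J - {j}"] r j fin card by auto
        then show "s ((- q) ^ rank ?R r) * (Y r ?j * rdet (?R - {r}) (sorted_list_of_set (?J - {j}))) =
          s ((- q) ^ rank ?R r) * (Y r ?j * ?C r j)" by simp
      qed
      finally show ?thesis .
    qed
    have comm: "Y r ?j * Y ?r j = Y ?r j * Y r ?j" if "r \<in> ?R" "j \<in> ?J" for r j
    proof -
      have "?r < r" "?j < j" using that fin Min_le[of R r] Min_le[of J j] by (auto simp: less_le)
      then show ?thesis using rel[of r ?r j ?j] by (simp add: s_one)
    qed
    have "rdet R (sorted_list_of_set J) = Y ?r ?j * rdet ?R (sorted_list_of_set ?J) +
      (\<Sum>r\<in>?R. s ((- q) ^ rank R r) * (Y r ?j * rdet (R - {r}) (sorted_list_of_set ?J)))"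
      unfolding listJ rdet.simps by (subst sum.remove[OF fin(1) mem(1)]) (simp add: rank_Min fin s_one)
    also have "(\<Sum>r\<in>?R. s ((- q) ^ rank R r) * (Y r ?j * rdet (R - {r}) (sorted_list_of_set ?J))) =
      (\<Sum>r\<in>?R. \<Sum>j\<in>?J. s ((- q) ^ rank R r * (- q) ^ rank ?J j) * (Y r ?j * (Y ?r j * ?C r j)))"
      by (intro sum.cong refl) (simp add: minor_r sum_distrib_left Y_s)
    also have "\<dots> = (\<Sum>r\<in>?R. \<Sum>j\<in>?J. s ((- q) ^ rank J j * (- q) ^ rank ?R r) * (Y ?r j * (Y r ?j * ?C r j)))"
    proof (intro sum.cong refl)
      fix r j assume rj: "r \<in> ?R" "j \<in> ?J"
      have "Y r ?j * (Y ?r j * ?C r j) = Y ?r j * (Y r ?j * ?C r j)"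
        using comm[OF rj] by (simp flip: mult.assoc)
      moreover have "(- q) ^ rank R r * (- q) ^ rank ?J j = (- q) ^ rank J j * (- q) ^ rank ?R r"
        unfolding rankR[OF rj(1)] rankJ[OF rj(2)] by simp
      ultimately show "s ((- q) ^ rank R r * (- q) ^ rank ?J j) * (Y r ?j * (Y ?r j * ?C r j)) =
        s ((- q) ^ rank J j * (- q) ^ rank ?R r) * (Y ?r j * (Y r ?j * ?C r j))" by (simp only:)
    qed
    also have "\<dots> = (\<Sum>j\<in>?J. s ((- q) ^ rank J j) * (Y ?r j * cdet (sorted_list_of_set ?R) (J - {j})))"
      by (subst sum.swap, intro sum.cong refl) (simp add: minor_j sum_distrib_left Y_s)
    also have "Y ?r ?j * rdet ?R (sorted_list_of_set ?J) + \<dots> = cdet (sorted_list_of_set R) J"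
      unfolding listR cdet.simps
      by (subst sum.remove[OF fin(2) mem(2)])
          (use less.hyps[OF card(1) _ _ card(2)] fin in \<open>simp add: rank_Min s_one\<close>)
    finally show ?thesis .
  qed
qed

section \<open>Commutation of minors on a common set of rows\<close>

abbreviation minor :: "nat set \<Rightarrow> nat set \<Rightarrow> 'a" where
  "minor R J \<equiv> rdet R (sorted_list_of_set J)"

lemma rdet_minor:
  assumes "finite R"
  shows "rdet R w = 0 \<or> distinct w \<and> (\<exists>c. rdet R w = s c * minor R (set w))"
  using rdet_cases[of w] assms by blast

text \<open>This is \<open>rdet_mult_rdet\<close> with \<open>R = F\<close>. The head of
  \<open>word_insertions\<close> gives the interchanged product; in the remaining terms the words
  either repeat a letter and vanish or can be sorted, which turns sums of letters into sums of
  column sets.\<close>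

lemma minor_commutation_le:
  assumes "finite F" "finite I" "finite J" "card I = card F" "card J = card F"
  shows "\<exists>c. c \<noteq> 0 \<and> minor F I * minor F J - s c * (minor F J * minor F I) \<in>
    vs.span {minor F K * minor F L |K L. K \<subseteq> I \<union> J \<and> L \<subseteq> I \<union> J \<and> card K = card F \<and> card L = card F \<and>
      \<Sum>K < \<Sum>J \<and> \<Sum>K + \<Sum>L = \<Sum>I + \<Sum>J}" (is "\<exists>c. c \<noteq> 0 \<and> _ \<in> vs.span ?S")
proof -
  let ?v = "sorted_list_of_set I" and ?w = "sorted_list_of_set J"
  obtain c rest where c: "c \<noteq> 0" "word_insertions ?v ?w = (c, ?w, ?v) # rest" "\<forall>(d, w', v') \<in> set rest.
    sum_list w' < sum_list ?w \<and> sum_list w' + sum_list v' = sum_list ?w + sum_list ?v"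
    using word_insertions_head by blast
  have sum: "sum_list w = \<Sum>(set w)" if "distinct w" for w :: "nat list"
    using sum_list_distinct_conv_sum_set[OF that, of "\<lambda>x. x"] by simp
  have tm: "s d * (rdet F w' * rdet F v') \<in> vs.span ?S" if mem: "(d, w', v') \<in> set rest" for d w' v'
  proof (cases "rdet F w' = 0 \<or> rdet F v' = 0")
    case False
    obtain c1 c2 where 1: "distinct w'" "rdet F w' = s c1 * minor F (set w')"
      and 2: "distinct v'" "rdet F v' = s c2 * minor F (set v')"
      using False rdet_minor[OF assms(1)] by blast
    have len: "length w' = card F" "length v' = card F" "set w' \<subseteq> I \<union> J" "set v' \<subseteq> I \<union> J"
      using word_insertions_set[of d w' v' ?v ?w] mem c(2) assms by auto
    have "sum_list w' < sum_list ?w" "sum_list w' + sum_list v' = sum_list ?w + sum_list ?v"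
      using c(3) mem by auto
    then have "minor F (set w') * minor F (set v') \<in> ?S"
      using 1(1) 2(1) len assms
      by (intro CollectI exI[of _ "set w'"] exI[of _ "set v'"]) (auto simp: sum distinct_card)
    then have "s (d * (c1 * c2)) * (minor F (set w') * minor F (set v')) \<in> vs.span ?S"
      by (intro vs.span_scale vs.span_base)
    also have "s (d * (c1 * c2)) * (minor F (set w') * minor F (set v')) = s d * (rdet F w' * rdet F v')"
      unfolding 1(2) 2(2) by (simp add: mult.assoc s_left_comm[of "minor F (set w')"])
    finally show ?thesis .
  qed (auto simp: vs.span_zero)
  have rest: "(\<Sum>(d, w', v')\<leftarrow>xs. s d * (rdet F w' * rdet F v')) \<in> vs.span ?S" if "set xs \<subseteq> set rest" for xs
    using that by (induction xs) (auto intro: vs.span_zero vs.span_add tm)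
  let ?p = "q ^ card F" and ?r = "\<Sum>(d, w', v')\<leftarrow>rest. s d * (rdet F w' * rdet F v')"
  have "minor F I * minor F J = s (inverse ?p) * (s ?p * (minor F I * minor F J))"
    using q by (simp add: s_one)
  also have "s ?p * (minor F I * minor F J) = s c * (minor F J * minor F I) + ?r"
  proof -
    have "s (q ^ length ?v) * (minor F I * minor F J) =
        (\<Sum>(c, w', v')\<leftarrow>word_insertions ?v ?w. s c * (rdet F w' * rdet F v'))"
      by (rule rdet_mult_rdet) (use assms(1,4,5) in simp_all)
    then show ?thesis using assms(4) by (simp add: c(2))
  qed
  also have "s (inverse ?p) * \<dots> = s (inverse ?p * c) * (minor F J * minor F I) + s (inverse ?p) * ?r"
    by (simp only: distrib_left vs.scale_scale)
  finally have "minor F I * minor F J - s (inverse ?p * c) * (minor F J * minor F I) = s (inverse ?p) * ?r"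
    by (simp only: add_diff_cancel_left')
  then show ?thesis
    using vs.span_scale[OF rest[OF order.refl], of "inverse ?p"] c(1) q
    by (intro exI[of _ "inverse ?p * c"]) auto
qed

lemma minor_commutation:
  assumes "finite F" "finite I" "finite J" "card I = card F" "card J = card F"
  shows "\<exists>c. c \<noteq> 0 \<and> minor F I * minor F J - s c * (minor F J * minor F I) \<in>
    vs.span {minor F K * minor F L |K L. K \<subseteq> I \<union> J \<and> L \<subseteq> I \<union> J \<and> card K = card F \<and> card L = card F \<and>
      (\<Sum>K)\<^sup>2 + (\<Sum>L)\<^sup>2 > (\<Sum>I)\<^sup>2 + (\<Sum>J)\<^sup>2}" (is "\<exists>c. c \<noteq> 0 \<and> _ \<in> vs.span (?S I J)")
proof -
  have sq: "k\<^sup>2 + l\<^sup>2 > i\<^sup>2 + j\<^sup>2" if "k < j" "j \<le> i" "k + l = i + j" for i j k l :: nat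
  proof -
    obtain d where d: "j = k + d" "d > 0" using \<open>k < j\<close> less_imp_add_positive by blast
    obtain e where e: "i = k + d + e" using \<open>j \<le> i\<close> d(1) nat_le_iff_add by metis
    have l: "l = k + d + e + d" using that(3) d e by simp
    show ?thesis unfolding l e d(1) using d(2) by (simp add: power2_eq_square algebra_simps)
  qed
  have main: "\<exists>c. c \<noteq> 0 \<and> minor F I * minor F J - s c * (minor F J * minor F I) \<in> vs.span (?S I J)"
    if "\<Sum>J \<le> \<Sum>I" "finite I" "finite J" "card I = card F" "card J = card F" for I J
  proof -
    have "{minor F K * minor F L |K L. K \<subseteq> I \<union> J \<and> L \<subseteq> I \<union> J \<and> card K = card F \<and> card L = card F \<and>
      \<Sum>K < \<Sum>J \<and> \<Sum>K + \<Sum>L = \<Sum>I + \<Sum>J} \<subseteq> ?S I J"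
      using sq[OF _ that(1)] by blast
    then show ?thesis using minor_commutation_le[OF assms(1) that(2-5)] vs.span_mono by blast
  qed
  show ?thesis
  proof (cases "\<Sum>J \<le> \<Sum>I")
    case False
    then obtain c where c: "c \<noteq> 0" "minor F J * minor F I - s c * (minor F I * minor F J) \<in> vs.span (?S J I)"
      using main[of I J] assms by auto
    have "s (- inverse c) * (minor F J * minor F I - s c * (minor F I * minor F J)) =
      minor F I * minor F J - s (inverse c) * (minor F J * minor F I)"
      using c(1) by (simp add: right_diff_distrib s_one)
    then show ?thesis
      using vs.span_scale[OF c(2), of "- inverse c"] c(1)
      by (intro exI[of _ "inverse c"]) (simp add: Un_commute add.commute)
  qed (use main assms in blast)
qed

end

section \<open>Inversions and the expansion over permutations\<close>

fun inversions :: "nat list \<Rightarrow> nat" where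
  "inversions [] = 0"
| "inversions (x # xs) = card {y \<in> set xs. y < x} + inversions xs"

lemma inversions_eq_card:
  "distinct xs \<Longrightarrow> inversions xs = card {(a, b). a < b \<and> b < length xs \<and> xs ! b < xs ! a}"
proof (induction xs)
  case (Cons x xs)
  let ?A = "{b. b < length xs \<and> xs ! b < x}" and ?B = "{(a, b). a < b \<and> b < length xs \<and> xs ! b < xs ! a}"
  have split: "{(a, b). a < b \<and> b < length (x # xs) \<and> (x # xs) ! b < (x # xs) ! a} =
      (\<lambda>b. (0, Suc b)) ` ?A \<union> (\<lambda>(a, b). (Suc a, Suc b)) ` ?B"
  proof (rule Set.set_eqI)
    fix z :: "nat \<times> nat"
    obtain a b where "z = (a, b)" by force
    then show "z \<in> {(a, b). a < b \<and> b < length (x # xs) \<and> (x # xs) ! b < (x # xs) ! a} \<longleftrightarrow>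
        z \<in> (\<lambda>b. (0, Suc b)) ` ?A \<union> (\<lambda>(a, b). (Suc a, Suc b)) ` ?B"
      by (cases a; cases b) auto
  qed
  have "finite ?B" by (rule finite_subset[of _ "{..<length xs} \<times> {..<length xs}"]) auto
  then have "card ((\<lambda>b. (0::nat, Suc b)) ` ?A \<union> (\<lambda>(a, b). (Suc a, Suc b)) ` ?B) = card ?A + card ?B"
    by (subst card_Un_disjoint) (auto simp: card_image inj_on_def)
  moreover have "card ?A = card {y \<in> set xs. y < x}"
  proof (rule bij_betw_same_card)
    show "bij_betw (\<lambda>b. xs ! b) ?A {y \<in> set xs. y < x}"
      unfolding bij_betw_def
    proof
      show "inj_on ((!) xs) ?A"
        using Cons.prems by (intro inj_on_subset[OF inj_on_nth[of xs "{..<length xs}"]]) auto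
      show "(!) xs ` ?A = {y \<in> set xs. y < x}" by (auto simp: in_set_conv_nth)
    qed
  qed
  ultimately show ?case unfolding split using Cons by simp
qed simp

lemma bij_betw_permute_list:
  assumes "distinct xs"
  shows "bij_betw (\<lambda>\<sigma>. permute_list \<sigma> xs) {\<sigma>. \<sigma> permutes {..<length xs}} (permutations_of_set (set xs))"
  unfolding bij_betw_def
proof
  show "inj_on (\<lambda>\<sigma>. permute_list \<sigma> xs) {\<sigma>. \<sigma> permutes {..<length xs}}"
  proof (intro inj_onI ext)
    fix \<sigma> \<tau> i
    assume \<sigma>: "\<sigma> \<in> {\<sigma>. \<sigma> permutes {..<length xs}}" and \<tau>: "\<tau> \<in> {\<sigma>. \<sigma> permutes {..<length xs}}"
      and eq: "permute_list \<sigma> xs = permute_list \<tau> xs"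
    show "\<sigma> i = \<tau> i"
    proof (cases "i < length xs")
      case True
      then have "xs ! \<sigma> i = xs ! \<tau> i"
        using eq permute_list_nth[of \<sigma> xs i] permute_list_nth[of \<tau> xs i] \<sigma> \<tau> by auto
      moreover have "\<sigma> i < length xs" "\<tau> i < length xs"
        using permutes_in_image[of \<sigma> "{..<length xs}" i] permutes_in_image[of \<tau> "{..<length xs}" i] \<sigma> \<tau> True
            by auto
      ultimately show ?thesis using nth_eq_iff_index_eq[OF assms] by blast
    next
      case False
      then show ?thesis using \<sigma> \<tau> by (simp add: permutes_def)
    qed
  qed
  show "(\<lambda>\<sigma>. permute_list \<sigma> xs) ` {\<sigma>. \<sigma> permutes {..<length xs}} = permutations_of_set (set xs)"
  proof (intro equalityI subsetI)
    fix ys assume "ys \<in> permutations_of_set (set xs)"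
    then have "mset ys = mset xs"
      using assms by (auto simp: permutations_of_set_def set_eq_iff_mset_eq_distinct)
    then obtain \<sigma> where "\<sigma> permutes {..<length xs}" "permute_list \<sigma> xs = ys"
      by (rule mset_eq_permutation)
    then show "ys \<in> (\<lambda>\<sigma>. permute_list \<sigma> xs) ` {\<sigma>. \<sigma> permutes {..<length xs}}" by blast
  qed (use assms in \<open>auto simp: permutations_of_set_def\<close>)
qed

lemma perm_length_eq_inversions:
  assumes "\<sigma> permutes {..<length xs}" "sorted_wrt (<) xs"
  shows "perm_length (length xs) \<sigma> = inversions (permute_list \<sigma> xs)"
proof -
  have dist: "distinct xs" using assms(2) by (simp add: strict_sorted_iff)
  have "xs ! i < xs ! j \<longleftrightarrow> i < j" if "i < length xs" "j < length xs" for i j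
    using that assms(2) sorted_wrt_nth_less[OF assms(2)[unfolded strict_sorted_iff[symmetric]]]
    by (metis linorder_neqE_nat order_less_asym order_less_irrefl)
  moreover have "\<sigma> i < length xs" if "i < length xs" for i
    using permutes_in_image[OF assms(1), of i] that by simp
  ultimately have "{(a, b). a < b \<and> b < length xs \<and> \<sigma> b < \<sigma> a} =
    {(a, b). a < b \<and> b < length (permute_list \<sigma> xs) \<and> permute_list \<sigma> xs ! b < permute_list \<sigma> xs ! a}"
    using permute_list_nth[OF assms(1)] by auto
  then show ?thesis
    using inversions_eq_card[of "permute_list \<sigma> xs"] dist assms(1) by (simp add: perm_length_def)
qed

text \<open>The first entry \<open>j\<close> of a permutation of \<open>J\<close> takes part in
  exactly \<open>rank J j\<close> inversions, the exponent in the expansion of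
  \<open>cdet\<close>.\<close>

lemma (in quantum_matrix) cdet_permutations:
  assumes "finite J" "length v = card J"
  shows "cdet v J = (\<Sum>l\<in>permutations_of_set J. s ((- q) ^ inversions l) * prod_list
      (map (case_prod Y) (zip v l)))"
  using assms
proof (induction v arbitrary: J)
  case Nil
  then show ?case by (simp add: s_one)
next
  case (Cons r v)
  have ne: "J \<noteq> {}" using Cons.prems by auto
  have "(\<Sum>l\<in>permutations_of_set J. s ((- q) ^ inversions l) * prod_list (map (case_prod Y) (zip (r # v) l))) =
    (\<Sum>j\<in>J. \<Sum>l\<in>(#) j ` permutations_of_set (J - {j}). s ((- q) ^ inversions l) * prod_list
        (map (case_prod Y) (zip (r # v) l)))"
    unfolding permutations_of_set_nonempty[OF ne]
    by (rule sum.UNION_disjoint) (use Cons.prems in auto)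
  also have "\<dots> = (\<Sum>j\<in>J. s ((- q) ^ rank J j) * (Y r j * cdet v (J - {j})))"
  proof (intro sum.cong refl)
    fix j assume j: "j \<in> J"
    have "(\<Sum>l\<in>(#) j ` permutations_of_set (J - {j}). s ((- q) ^ inversions l) * prod_list
        (map (case_prod Y) (zip (r # v) l))) =
      (\<Sum>l\<in>permutations_of_set (J - {j}). s ((- q) ^ inversions (j # l)) *
          (Y r j * prod_list (map (case_prod Y) (zip v l))))"
      by (subst sum.reindex) (auto simp: inj_on_def)
    also have "\<dots> = (\<Sum>l\<in>permutations_of_set (J - {j}).
        s ((- q) ^ rank J j) * (Y r j * (s ((- q) ^ inversions l) * prod_list (map (case_prod Y) (zip v l)))))"
    proof (intro sum.cong refl)
      fix l assume "l \<in> permutations_of_set (J - {j})"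
      then have "{y \<in> set l. y < j} = {t \<in> J. t < j}" by (auto dest: permutations_of_setD)
      then have "inversions (j # l) = rank J j + inversions l" by (simp add: rank_def)
      then show "s ((- q) ^ inversions (j # l)) * (Y r j * prod_list (map (case_prod Y) (zip v l))) =
        s ((- q) ^ rank J j) * (Y r j * (s ((- q) ^ inversions l) * prod_list (map (case_prod Y) (zip v l))))"
        by (simp only: power_add Y_s vs.scale_scale)
    qed
    also have "\<dots> = s ((- q) ^ rank J j) * (Y r j * cdet v (J - {j}))"
      using Cons.IH[of "J - {j}"] Cons.prems j by (simp add: sum_distrib_left)
    finally show "(\<Sum>l\<in>(#) j ` permutations_of_set (J - {j}). s ((- q) ^ inversions l) * prod_list
        (map (case_prod Y) (zip (r # v) l))) =
      s ((- q) ^ rank J j) * (Y r j * cdet v (J - {j}))" .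
  qed
  finally show ?case by simp
qed

lemma (in quantum_matrix) cdet_permutes:
  assumes "finite J" "length v = card J"
  shows "cdet v J = (\<Sum>\<sigma> | \<sigma> permutes {..<card J}. s ((- q) ^ perm_length (card J) \<sigma>) *
    prod_list (map (\<lambda>a. Y (v ! a) (sorted_list_of_set J ! \<sigma> a)) [0..<card J]))"
proof -
  let ?l = "sorted_list_of_set J"
  have len: "length ?l = card J" by simp
  have "cdet v J = (\<Sum>l\<in>permutations_of_set (set ?l). s ((- q) ^ inversions l) * prod_list
      (map (case_prod Y) (zip v l)))"
    using cdet_permutations[OF assms] assms(1) by simp
  also have "\<dots> = (\<Sum>\<sigma> | \<sigma> permutes {..<length ?l}. s ((- q) ^ inversions (permute_list \<sigma> ?l)) *
      prod_list (map (case_prod Y) (zip v (permute_list \<sigma> ?l))))"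
    by (rule sum.reindex_bij_betw[OF bij_betw_permute_list, symmetric]) simp
  also have "\<dots> = (\<Sum>\<sigma> | \<sigma> permutes {..<card J}. s ((- q) ^ perm_length (card J) \<sigma>) *
    prod_list (map (\<lambda>a. Y (v ! a) (?l ! \<sigma> a)) [0..<card J]))"
  proof (intro sum.cong)
    fix \<sigma> assume "\<sigma> \<in> {\<sigma>. \<sigma> permutes {..<card J}}"
    then have \<sigma>: "\<sigma> permutes {..<length ?l}" by simp
    have "map (case_prod Y) (zip v (permute_list \<sigma> ?l)) = map (\<lambda>a. Y (v ! a) (?l ! \<sigma> a)) [0..<card J]"
      using assms(2) permute_list_nth[OF \<sigma>] by (intro nth_equalityI) auto
    moreover have "inversions (permute_list \<sigma> ?l) = perm_length (card J) \<sigma>"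
      using perm_length_eq_inversions[OF \<sigma>] by simp
    ultimately show "s ((- q) ^ inversions (permute_list \<sigma> ?l)) * prod_list
        (map (case_prod Y) (zip v (permute_list \<sigma> ?l))) =
      s ((- q) ^ perm_length (card J) \<sigma>) * prod_list (map (\<lambda>a. Y (v ! a) (?l ! \<sigma> a)) [0..<card J])"
      by simp
  qed simp
  finally show ?thesis .
qed

section \<open>A faithful representation of quantum matrices\<close>

typedef (overloaded) ('i, 'k :: field) lin =
  "{F :: ('i \<Rightarrow> 'k) \<Rightarrow> 'i \<Rightarrow> 'k. (\<forall>f g. F (\<lambda>x. f x + g x) = (\<lambda>x. F f x + F g x)) \<and>
     (\<forall>c f. F (\<lambda>x. c * f x) = (\<lambda>x. c * F f x))}"
  by (rule exI[of _ "\<lambda>f. f"]) simp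

setup_lifting type_definition_lin

lemma Rep_lin_scale: "Rep_lin F (\<lambda>x. c * f x) = (\<lambda>x. c * Rep_lin F f x)"
  using Rep_lin[of F] by auto

instantiation lin :: (type, field) ring_1
begin

lift_definition zero_lin :: "('a, 'b) lin" is "\<lambda>f x. 0" by simp
lift_definition one_lin :: "('a, 'b) lin" is "\<lambda>f. f" by simp
lift_definition plus_lin :: "('a, 'b) lin \<Rightarrow> ('a, 'b) lin \<Rightarrow> ('a, 'b) lin"
  is "\<lambda>F G f x. F f x + G f x" by (auto simp: algebra_simps)
lift_definition minus_lin :: "('a, 'b) lin \<Rightarrow> ('a, 'b) lin \<Rightarrow> ('a, 'b) lin"
  is "\<lambda>F G f x. F f x - G f x" by (auto simp: algebra_simps)
lift_definition uminus_lin :: "('a, 'b) lin \<Rightarrow> ('a, 'b) lin"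
  is "\<lambda>F f x. - F f x" by auto
lift_definition times_lin :: "('a, 'b) lin \<Rightarrow> ('a, 'b) lin \<Rightarrow> ('a, 'b) lin"
  is "\<lambda>F G f. F (G f)" by simp

instance
proof
  show "(0 :: ('a, 'b) lin) \<noteq> 1"
  proof
    assume "(0 :: ('a, 'b) lin) = 1"
    then have "Rep_lin (0 :: ('a, 'b) lin) (\<lambda>x. 1) undefined = Rep_lin (1 :: ('a, 'b) lin) (\<lambda>x. 1) undefined"
      by simp
    then show False by (simp add: zero_lin.rep_eq one_lin.rep_eq)
  qed
qed (transfer; simp add: algebra_simps fun_eq_iff)+

end

lift_definition scal :: "'k \<Rightarrow> ('i, 'k::field) lin" is "\<lambda>c f x. c * f x"
  by (auto simp: algebra_simps)

lemma central_scal: "central_scalars (scal :: 'k \<Rightarrow> ('i, 'k::field) lin)"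
  by unfold_locales (transfer; auto simp: algebra_simps fun_eq_iff)+

lemmas lin_rep = zero_lin.rep_eq one_lin.rep_eq plus_lin.rep_eq minus_lin.rep_eq uminus_lin.rep_eq
  times_lin.rep_eq scal.rep_eq

lemma Rep_lin_sum: "Rep_lin (sum F A) f x = (\<Sum>a\<in>A. Rep_lin (F a) f x)"
  by (induction A rule: infinite_finite_induct) (simp_all add: lin_rep)

lemma lin_eqI: "(\<And>f x. Rep_lin F f x = Rep_lin G f x) \<Longrightarrow> F = G"
  by (metis Rep_lin_inject ext)

section \<open>Quantum matrices from a quantum torus\<close>

type_synonym expo = "nat \<times> nat \<Rightarrow> int"

text \<open>Operators substitute the shifted exponent into a function, so the support moves the
  opposite way: \<open>shift r d a\<close> realises multiplication by the inverse of the variable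
  \<open>d\<close> and by the variable \<open>a\<close> of row \<open>r\<close>.\<close>

definition shift :: "nat \<Rightarrow> nat \<Rightarrow> nat \<Rightarrow> expo \<Rightarrow> expo" where
  "shift r x y \<alpha> = (\<lambda>z. \<alpha> z + (of_bool (z = (r, x)) - of_bool (z = (r, y))))"

text \<open>Only differences matter: \<open>psum r (Suc d) \<alpha> - psum r a \<alpha>\<close> is
  the sum of the exponents in the columns from \<open>a\<close> to \<open>d\<close>.\<close>

definition psum :: "nat \<Rightarrow> nat \<Rightarrow> expo \<Rightarrow> int" where "psum r n \<alpha> = (\<Sum>c<n. \<alpha> (r, c))"

text \<open>In a quantum torus with \<open>t\<^sub>j t\<^sub>l = q t\<^sub>l t\<^sub>j\<close> for \<open>j < l\<close> and \<open>K\<^sub>d t\<^sub>d = q t\<^sub>d K\<^sub>d\<close>, the triangular matrix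
  with entries \<open>K\<^sub>d t\<^sub>d\<^sup>-\<^sup>1 t\<^sub>a\<close> for \<open>a < d\<close> and \<open>K\<^sub>d\<close> on the diagonal is a quantum matrix. The following
  operators realise it on functions of the exponents in row \<open>r\<close>.\<close>

lift_definition lop :: "'k::field \<Rightarrow> nat \<Rightarrow> nat \<Rightarrow> nat \<Rightarrow> (expo, 'k) lin"
  is "\<lambda>q r d a f \<alpha>. if a \<le> d then q powi (psum r (Suc d) \<alpha> - psum r a \<alpha>) * f (shift r d a \<alpha>) else 0"
  by (auto simp: algebra_simps fun_eq_iff)

lemma psum_shift: "psum r n (shift r x y \<alpha>) = psum r n \<alpha> + of_bool (x < n) - of_bool (y < n)"
proof -
  have "(\<Sum>c<n. of_bool (c = x) :: int) = of_bool (x < n)" for x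
    by (simp add: of_bool_def sum.delta)
  then show ?thesis by (simp add: psum_def shift_def sum.distrib sum_subtractf)
qed

lemma psum_shift_other: "r \<noteq> r' \<Longrightarrow> psum r n (shift r' x y \<alpha>) = psum r n \<alpha>"
  by (simp add: psum_def shift_def)

text \<open>The four \<open>of_bool\<close> terms are the change that the first shift makes to the
  partial sums read by the second operator.\<close>

lemma lop_lop:
  fixes q :: "'k::field"
  assumes "q \<noteq> 0"
  shows "Rep_lin (lop q r d a * lop q r e b) f \<alpha> = (if a \<le> d \<and> b \<le> e then
    q powi psum r (Suc d) \<alpha> * q powi psum r (Suc e) \<alpha> / (q powi psum r a \<alpha> * q powi psum r b \<alpha>) *
    q powi (of_bool (d \<le> e) - of_bool (a \<le> e) - of_bool (d < b) + of_bool (a < b)) * f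
        (shift r e b (shift r d a \<alpha>)) else 0)"
  using assms by (simp add: lin_rep lop.rep_eq psum_shift power_int_add power_int_diff less_Suc_eq_le mult_ac)

text \<open>All products involved are multiples of one and the same shift, so for each relative
  order of \<open>d\<close>, \<open>e\<close> and of \<open>a\<close>, \<open>b\<close> only powers
  of \<open>q\<close> are compared. Entries outside the triangle are zero and form the second
  case.\<close>

lemma lop_rel:
  fixes q :: "'k::field"
  assumes q: "q \<noteq> 0"
  shows "scal (if d = e then q else 1) * (lop q r e a * lop q r d b)
        + (if d < e then scal (q - inverse q) * (lop q r d a * lop q r e b) else 0)
      = scal (if a = b then q else 1) * (lop q r d b * lop q r e a)
        + (if a < b then scal (q - inverse q) * (lop q r d a * lop q r e b) else 0)" (is "?l = ?r")
proof (rule lin_eqI)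
  fix f :: "expo \<Rightarrow> 'k" and \<alpha>
  have sh: "shift r d b (shift r e a \<alpha>) = shift r e b (shift r d a \<alpha>)"
    "shift r e a (shift r d b \<alpha>) = shift r e b (shift r d a \<alpha>)"
    by (auto simp: shift_def)
  define F where "F = f (shift r e b (shift r d a \<alpha>))"
  define C where "C = q powi psum r (Suc d) \<alpha> * q powi psum r (Suc e) \<alpha> /
      (q powi psum r a \<alpha> * q powi psum r b \<alpha>)"
  have C: "q powi psum r (Suc e) \<alpha> * q powi psum r (Suc d) \<alpha> / (q powi psum r a \<alpha> * q powi psum r b \<alpha>) = C"
    "q powi psum r (Suc d) \<alpha> * q powi psum r (Suc e) \<alpha> / (q powi psum r b \<alpha> * q powi psum r a \<alpha>) = C"
    by (simp_all add: C_def mult.commute)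
  note terms = lop_lop[OF q, of r e a d b f \<alpha>, unfolded sh C, folded F_def]
    lop_lop[OF q, of r d a e b f \<alpha>, folded F_def C_def]
    lop_lop[OF q, of r d b e a f \<alpha>, unfolded sh C, folded F_def]
  have rep: "Rep_lin (scal c * G + (if P then scal c' * G' else 0)) f \<alpha> =
    c * Rep_lin G f \<alpha> + (if P then c' * Rep_lin G' f \<alpha> else 0)" for c c' G G' P
    by (simp add: lin_rep)
  show "Rep_lin ?l f \<alpha> = Rep_lin ?r f \<alpha>"
    unfolding rep terms
  proof (cases "a \<le> d \<and> b \<le> d \<and> a \<le> e \<and> b \<le> e")
    case True
    then show "(if d = e then q else 1) * (if a \<le> e \<and> b \<le> d then C * q powi
        (of_bool (e \<le> d) - of_bool (a \<le> d) - of_bool (e < b) + of_bool (a < b)) * F else 0) +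
      (if d < e then (q - inverse q) * (if a \<le> d \<and> b \<le> e then C * q powi
          (of_bool (d \<le> e) - of_bool (a \<le> e) - of_bool (d < b) + of_bool (a < b)) * F else 0) else 0) =
      (if a = b then q else 1) * (if b \<le> d \<and> a \<le> e then C * q powi
          (of_bool (d \<le> e) - of_bool (b \<le> e) - of_bool (d < a) + of_bool (b < a)) * F else 0) +
      (if a < b then (q - inverse q) * (if a \<le> d \<and> b \<le> e then C * q powi
          (of_bool (d \<le> e) - of_bool (a \<le> e) - of_bool (d < b) + of_bool (a < b)) * F else 0) else 0)"
      using q by (cases d e rule: linorder_cases; cases a b rule: linorder_cases) (simp_all add: field_simps)
  next
    case False
    then show "(if d = e then q else 1) * (if a \<le> e \<and> b \<le> d then C * q powi
        (of_bool (e \<le> d) - of_bool (a \<le> d) - of_bool (e < b) + of_bool (a < b)) * F else 0) +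
      (if d < e then (q - inverse q) * (if a \<le> d \<and> b \<le> e then C * q powi
          (of_bool (d \<le> e) - of_bool (a \<le> e) - of_bool (d < b) + of_bool (a < b)) * F else 0) else 0) =
      (if a = b then q else 1) * (if b \<le> d \<and> a \<le> e then C * q powi
          (of_bool (d \<le> e) - of_bool (b \<le> e) - of_bool (d < a) + of_bool (b < a)) * F else 0) +
      (if a < b then (q - inverse q) * (if a \<le> d \<and> b \<le> e then C * q powi
          (of_bool (d \<le> e) - of_bool (a \<le> e) - of_bool (d < b) + of_bool (a < b)) * F else 0) else 0)"
      by (cases d e rule: linorder_cases; cases a b rule: linorder_cases; auto)
  qed
qed

lemma lop_comm:
  assumes "r \<noteq> r'"
  shows "lop q r d a * lop q r' e b = lop q r' e b * lop q r d a"
proof (rule lin_eqI)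
  fix f \<alpha>
  have "shift r d a (shift r' e b \<alpha>) = shift r' e b (shift r d a \<alpha>)" by (auto simp: shift_def)
  then show "Rep_lin (lop q r d a * lop q r' e b) f \<alpha> = Rep_lin (lop q r' e b * lop q r d a) f \<alpha>"
    using assms by (simp add: lin_rep lop.rep_eq psum_shift_other)
qed

text \<open>A row is added by multiplying with a commuting triangular quantum matrix (the comultiplication
  of quantum matrices) and appending its bottom row, which sits at the index \<open>n + 1\<close>.\<close>

fun Xop :: "'k::field \<Rightarrow> nat \<Rightarrow> nat \<Rightarrow> nat \<Rightarrow> nat \<Rightarrow> (expo, 'k) lin" where
  "Xop q n 0 i a = 0"
| "Xop q n (Suc m) i a = (if i = Suc m then lop q (Suc m) (Suc n) a
     else \<Sum>c\<in>{1..n}. Xop q n m i c * lop q (Suc m) c a)"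

lemma Xop_zero: "m < i \<Longrightarrow> Xop q n m i a = 0"
  by (induction m arbitrary: a) auto

lemma Xop_lop_comm: "m < r \<Longrightarrow> lop q r d a * Xop q n m i c = Xop q n m i c * lop q r d a"
proof (induction m arbitrary: i c)
  case (Suc m)
  have "lop q r d a * (Xop q n m i j * lop q (Suc m) j c) = Xop q n m i j * lop q (Suc m) j c * lop q r d a"
      for j
  proof -
    have "lop q r d a * Xop q n m i j = Xop q n m i j * lop q r d a" using Suc by simp
    moreover have "lop q r d a * lop q (Suc m) j c = lop q (Suc m) j c * lop q r d a"
      using Suc.prems by (intro lop_comm) simp
    ultimately show ?thesis
      by (simp only: mult.assoc[symmetric]) (simp only: mult.assoc)
  qed
  then show ?case
    using Suc lop_comm[of r "Suc m" q d a "Suc n" c] by (simp add: sum_distrib_left sum_distrib_right)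
qed simp

text \<open>For two old rows the induction hypothesis carries the Hecke operator from the rows to
  the summation indices and \<open>lop_rel\<close> carries it on to the columns. If the new row is
  involved, \<open>lop_rel\<close> alone suffices because its index \<open>n + 1\<close> exceeds
  every \<open>c\<close>. Rows beyond it are zero, so no range conditions arise.\<close>

lemma Xop_rel:
  fixes q :: "'k::field"
  assumes q: "q \<noteq> 0"
  shows "scal (if i = k then q else 1) * (Xop q n m k a * Xop q n m i b)
        + (if i < k then scal (q - inverse q) * (Xop q n m i a * Xop q n m k b) else 0)
      = scal (if a = b then q else 1) * (Xop q n m i b * Xop q n m k a)
        + (if a < b then scal (q - inverse q) * (Xop q n m i a * Xop q n m k b) else 0)"
proof (induction m arbitrary: i k a b)
  case (Suc m)
  interpret central_scalars "scal :: 'k \<Rightarrow> (expo, 'k) lin" by (rule central_scal)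
  let ?h = "scal (q - inverse q) :: (expo, 'k) lin"
  let ?Y = "Xop q n m" and ?L = "lop q (Suc m)" and ?N = "Suc n" and ?U = "Xop q n (Suc m)"
  have lm: "?L d x * (?Y j c * z) = ?Y j c * (?L d x * z)" for d x j c z
    using Xop_lop_comm[of m "Suc m" q d x n j c] by (simp only: mult.assoc[symmetric] lessI)
  have expand: "?U j x = (\<Sum>c\<in>{1..n}. ?Y j c * ?L c x)" if "j \<noteq> Suc m" for j x
    using that by simp
  have last: "?U (Suc m) x = ?L ?N x" for x by simp
  have prod: "?U j x * ?U l y = (\<Sum>c\<in>{1..n}. \<Sum>d\<in>{1..n}. ?Y j c * (?Y l d * (?L c x * ?L d y)))"
    if "j \<noteq> Suc m" "l \<noteq> Suc m" for j l x y
    unfolding expand[OF that(1)] expand[OF that(2)] by (simp add: sum_product mult.assoc lm)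
  have prod_last: "?U j x * ?U (Suc m) y = (\<Sum>c\<in>{1..n}. ?Y j c * (?L c x * ?L ?N y))"
    "?U (Suc m) y * ?U j x = (\<Sum>c\<in>{1..n}. ?Y j c * (?L ?N y * ?L c x))" if "j \<noteq> Suc m" for j x y
    unfolding expand[OF that] last by (simp_all add: sum_distrib_left sum_distrib_right mult.assoc lm)
  have pull: "scal c * (\<Sum>j\<in>A. z j) = (\<Sum>j\<in>A. scal c * z j)" "scal c * (?Y j x * z') = ?Y j x * (scal c * z')"
    for c z z' j x and A :: "nat set"
    by (simp_all add: sum_distrib_left s_left_comm)
  have if_pull: "(if P then (\<Sum>j\<in>A. z j) else 0) = (\<Sum>j\<in>A. if P then z j else 0)"
    "(if P then ?Y j x * z' else 0) = ?Y j x * (if P then z' else 0)"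
    for P z z' j x and A :: "nat set"
    by auto
  consider "i = Suc m" "k = Suc m" | "i = Suc m" "k < Suc m" | "i = Suc m" "Suc m < k"
    | "k = Suc m" "i < Suc m" | "k = Suc m" "Suc m < i" | "i \<noteq> Suc m" "k \<noteq> Suc m"
    by linarith
  then show ?case
  proof cases
    case 1
    then show ?thesis using lop_rel[OF q, of ?N ?N "Suc m" a b] by simp
  next
    case 2
    then have k: "k \<noteq> Suc m" by simp
    have "?Y k c * (scal (if ?N = c then q else 1) * (?L c a * ?L ?N b)) =
      ?Y k c * (scal (if a = b then q else 1) * (?L ?N b * ?L c a) + (if a < b then ?h * (?L ?N a * ?L c b)
          else 0))"
      if "c \<in> {1..n}" for c
      using lop_rel[OF q, of ?N c "Suc m" a b] that by simp
    then have "(\<Sum>c\<in>{1..n}. ?Y k c * (scal (if ?N = c then q else 1) * (?L c a * ?L ?N b))) =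
      (\<Sum>c\<in>{1..n}. ?Y k c * (scal (if a = b then q else 1) * (?L ?N b * ?L c a) +
          (if a < b then ?h * (?L ?N a * ?L c b) else 0)))"
      by (rule sum.cong[OF refl])
    moreover have "(\<Sum>c\<in>{1..n}. ?Y k c * (scal (if ?N = c then q else 1) * (?L c a * ?L ?N b))) =
      (\<Sum>c\<in>{1..n}. ?Y k c * (?L c a * ?L ?N b))"
      by (intro sum.cong) (auto simp: s_one)
    ultimately show ?thesis
      unfolding \<open>i = Suc m\<close> prod_last[OF k] pull if_pull using 2
      by (simp only: sum.distrib distrib_left if_pull) (simp add: s_one)
  next
    case 3
    then show ?thesis by (simp add: Xop_zero)
  next
    case 4
    then have i: "i \<noteq> Suc m" by simp
    have "?Y i c * (scal (if c = ?N then q else 1) * (?L ?N a * ?L c b) + ?h * (?L c a * ?L ?N b)) =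
      ?Y i c * (scal (if a = b then q else 1) * (?L c b * ?L ?N a) + (if a < b then ?h * (?L c a * ?L ?N b)
          else 0))"
      if "c \<in> {1..n}" for c
      using lop_rel[OF q, of c ?N "Suc m" a b] that by simp
    then have "(\<Sum>c\<in>{1..n}. ?Y i c * (scal (if c = ?N then q else 1) * (?L ?N a * ?L c b) + ?h *
        (?L c a * ?L ?N b))) =
      (\<Sum>c\<in>{1..n}. ?Y i c * (scal (if a = b then q else 1) * (?L c b * ?L ?N a) +
          (if a < b then ?h * (?L c a * ?L ?N b) else 0)))"
      by (rule sum.cong[OF refl])
    moreover have "(\<Sum>c\<in>{1..n}. ?Y i c * (scal (if c = ?N then q else 1) * (?L ?N a * ?L c b) + ?h *
        (?L c a * ?L ?N b))) =
      (\<Sum>c\<in>{1..n}. ?Y i c * (?L ?N a * ?L c b)) + (\<Sum>c\<in>{1..n}. ?Y i c * (?h * (?L c a * ?L ?N b)))"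
      unfolding sum.distrib[symmetric] by (intro sum.cong) (auto simp: s_one distrib_left)
    ultimately show ?thesis
      unfolding \<open>k = Suc m\<close> prod_last[OF i] pull if_pull using 4
      by (simp only: sum.distrib distrib_left if_pull) (simp add: s_one)
  next
    case 5
    then show ?thesis by (simp add: Xop_zero)
  next
    case 6
    let ?LL = "\<lambda>c x d y. ?L c x * ?L d y"
    have lhs: "scal (if i = k then q else 1) * (?U k a * ?U i b) + (if i < k then ?h * (?U i a * ?U k b)
        else 0) =
      (\<Sum>c\<in>{1..n}. \<Sum>d\<in>{1..n}. (scal (if i = k then q else 1) * (?Y k c * ?Y i d)
        + (if i < k then ?h * (?Y i c * ?Y k d) else 0)) * ?LL c a d b)"
      unfolding prod[OF 6] prod[OF 6(2,1)]
      by (cases "i < k") (simp_all only: if_True if_False add_0_right distrib_right sum.distrib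
          sum_distrib_left mult.assoc)
    have "(\<Sum>c\<in>{1..n}. \<Sum>d\<in>{1..n}. (scal (if i = k then q else 1) * (?Y k c * ?Y i d)
        + (if i < k then ?h * (?Y i c * ?Y k d) else 0)) * ?LL c a d b) =
      (\<Sum>c\<in>{1..n}. \<Sum>d\<in>{1..n}. (scal (if c = d then q else 1) * (?Y i d * ?Y k c)
        + (if c < d then ?h * (?Y i c * ?Y k d) else 0)) * ?LL c a d b)"
      by (simp only: Suc.IH)
    also have "\<dots> = (\<Sum>c\<in>{1..n}. \<Sum>d\<in>{1..n}. scal (if c = d then q else 1) * (?Y i d * (?Y k c * ?LL c a d b)))
        + (\<Sum>c\<in>{1..n}. \<Sum>d\<in>{1..n}. if c < d then ?h * (?Y i c * (?Y k d * ?LL c a d b)) else 0)"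
      unfolding sum.distrib[symmetric] by (intro sum.cong refl) (simp add: distrib_right mult.assoc)
    also have "(\<Sum>c\<in>{1..n}. \<Sum>d\<in>{1..n}. scal (if c = d then q else 1) * (?Y i d * (?Y k c * ?LL c a d b))) =
      (\<Sum>c\<in>{1..n}. \<Sum>d\<in>{1..n}. scal (if c = d then q else 1) * (?Y i c * (?Y k d * ?LL d a c b)))"
      by (subst sum.swap, intro sum.cong refl) auto
    also have "\<dots> + (\<Sum>c\<in>{1..n}. \<Sum>d\<in>{1..n}. if c < d then ?h * (?Y i c * (?Y k d * ?LL c a d b)) else 0) =
      (\<Sum>c\<in>{1..n}. \<Sum>d\<in>{1..n}. ?Y i c * (?Y k d *
        (scal (if c = d then q else 1) * ?LL d a c b + (if c < d then ?h * ?LL c a d b else 0))))"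
      unfolding sum.distrib[symmetric] by (intro sum.cong refl) (simp add: distrib_left pull)
    also have "\<dots> = (\<Sum>c\<in>{1..n}. \<Sum>d\<in>{1..n}. ?Y i c * (?Y k d *
        (scal (if a = b then q else 1) * ?LL c b d a + (if a < b then ?h * ?LL c a d b else 0))))"
      by (intro sum.cong refl arg_cong2[of _ _ _ _ "(*)"] lop_rel[OF q])
    also have "\<dots> = scal (if a = b then q else 1) * (?U i b * ?U k a) + (if a < b then ?h * (?U i a * ?U k b)
        else 0)"
      unfolding prod[OF 6] by (cases "a < b") (simp_all add: distrib_left sum.distrib pull)
    finally show ?thesis unfolding lhs .
  qed
qed simp

lemma quantum_matrix_Xop: "q \<noteq> 0 \<Longrightarrow> quantum_matrix scal q (Xop q n m)"
  by (intro quantum_matrix.intro central_scal quantum_matrix_axioms.intro Xop_rel)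

text \<open>Since \<open>(i, a) \<mapsto> i * a\<close> is strictly supermodular, \<open>Xop q n m i a\<close> has a single term of largest
  weight, a shift.\<close>

definition wt :: "nat \<Rightarrow> nat \<Rightarrow> expo \<Rightarrow> int" where
  "wt m n \<alpha> = (\<Sum>(r, c)\<in>{1..m} \<times> {1..n}. int (r * c) * \<alpha> (r, c))"

text \<open>The auxiliary column \<open>n + 1\<close> carries no weight, whence the two
  conditions.\<close>

lemma wt_shift:
  assumes "1 \<le> r" "r \<le> m" "1 \<le> x" "1 \<le> y"
  shows "wt m n (shift r x y \<alpha>) = wt m n \<alpha> + (if x \<le> n then int (r * x) else 0) -
      (if y \<le> n then int (r * y) else 0)"
proof -
  have unit: "(\<Sum>(i, c)\<in>{1..m} \<times> {1..n}. int (i * c) * of_bool ((i, c) = (r, x))) =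
      (if x \<le> n then int (r * x) else 0)"
    if "1 \<le> x" for x
  proof -
    have "(\<Sum>(i, c)\<in>{1..m} \<times> {1..n}. int (i * c) * of_bool ((i, c) = (r, x))) =
      (\<Sum>z\<in>{1..m} \<times> {1..n}. if z = (r, x) then int (r * x) else 0)"
      by (intro sum.cong) auto
    then show ?thesis using assms that by (simp add: sum.delta)
  qed
  show ?thesis
    unfolding wt_def shift_def
    using unit[OF assms(3)] unit[OF assms(4)]
    by (simp add: distrib_left right_diff_distrib sum.distrib sum_subtractf case_prod_unfold)
qed

definition supp_le :: "nat \<Rightarrow> nat \<Rightarrow> int \<Rightarrow> (expo \<Rightarrow> 'k::field) \<Rightarrow> bool" where
  "supp_le m n w f \<longleftrightarrow> (\<forall>\<alpha>. f \<alpha> \<noteq> 0 \<longrightarrow> wt m n \<alpha> \<le> w)"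

text \<open>Passing through column \<open>c\<close> of the added row \<open>Suc m\<close> falls
  short of the weight \<open>w + i * a\<close> by \<open>(Suc m - i) * (c - a)\<close>.
  Triangularity forces \<open>a \<le> c\<close>, so only \<open>c = a\<close> reaches the top. The
  weight refers to all \<open>M\<close> rows while the induction is on the number \<open>m\<close>
  of rows built so far.\<close>

lemma Xop_leading:
  fixes q :: "'k::field"
  assumes "q \<noteq> 0" "m \<le> M" "1 \<le> i" "i \<le> m" "1 \<le> a" "a \<le> n" "supp_le M n w f"
  shows "supp_le M n (w + int (i * a)) (Rep_lin (Xop q n m i a) f) \<and>
    (\<forall>\<alpha>. wt M n \<alpha> = w + int (i * a) \<longrightarrow> (Rep_lin (Xop q n m i a) f \<alpha> \<noteq> 0 \<longleftrightarrow> f (shift i (Suc n) a \<alpha>) \<noteq> 0))"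
  using assms(2-)
proof (induction m arbitrary: a w f)
  case (Suc m)
  show ?case
  proof (cases "i = Suc m")
    case True
    have "wt M n \<alpha> \<le> w + int (i * a)" if "f (shift i (Suc n) a \<alpha>) \<noteq> 0" for \<alpha>
    proof -
      have "wt M n (shift i (Suc n) a \<alpha>) \<le> w" using that Suc.prems(6) by (simp add: supp_le_def)
      then show ?thesis using wt_shift[of i M "Suc n" a n \<alpha>] Suc.prems by simp
    qed
    then show ?thesis using True assms(1) Suc.prems(5) by (auto simp: lop.rep_eq supp_le_def)
  next
    case False
    then have im: "i \<le> m" using Suc.prems by simp
    define g where "g c = Rep_lin (lop q (Suc m) c a) f" for c
    have X: "Rep_lin (Xop q n (Suc m) i a) f \<alpha> = (\<Sum>c\<in>{1..n}. Rep_lin (Xop q n m i c) (g c) \<alpha>)" for \<alpha>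
      using False by (simp add: Rep_lin_sum lin_rep g_def)
    have g: "supp_le M n (w + int (Suc m * a) - int (Suc m * c)) (g c)" if c: "c \<in> {1..n}" "a \<le> c" for c
    proof -
      have "wt M n \<alpha> \<le> w + int (Suc m * a) - int (Suc m * c)" if "g c \<alpha> \<noteq> 0" for \<alpha>
      proof -
        have "f (shift (Suc m) c a \<alpha>) \<noteq> 0" using that by (auto simp: g_def lop.rep_eq split: if_splits)
        then have "wt M n (shift (Suc m) c a \<alpha>) \<le> w" using Suc.prems(6) by (simp add: supp_le_def)
        then show ?thesis using wt_shift[of "Suc m" M c a n \<alpha>] Suc.prems c by simp
      qed
      then show ?thesis by (simp add: supp_le_def)
    qed
    have level: "w + int (Suc m * a) - int (Suc m * c) + int (i * c) = w + int (i * a) - int (Suc m - i)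
        * int (c - a)"
      if "a \<le> c" for c
      using that im by (simp add: of_nat_diff algebra_simps)
    have less: "wt M n \<alpha> < w + int (i * a)"
      if "c \<in> {1..n}" "c \<noteq> a" "Rep_lin (Xop q n m i c) (g c) \<alpha> \<noteq> 0" for c \<alpha>
    proof (cases "a \<le> c")
      case True
      have "supp_le M n (w + int (Suc m * a) - int (Suc m * c) + int (i * c)) (Rep_lin (Xop q n m i c) (g c))"
        using Suc.IH[OF _ _ im _ _ g[OF that(1) True]] Suc.prems that(1) by auto
      then have "wt M n \<alpha> \<le> w + int (i * a) - int (Suc m - i) * int (c - a)"
        using that(3) unfolding level[OF True] by (simp add: supp_le_def)
      moreover have "int (Suc m - i) * int (c - a) > 0" using that True im by simp
      ultimately show ?thesis by linarith
    next
      case False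
      then have "g c = (\<lambda>x. 0)" by (auto simp: g_def lop.rep_eq)
      then have "Rep_lin (Xop q n m i c) (g c) \<alpha> = 0"
        using Rep_lin_scale[of "Xop q n m i c" 0 "\<lambda>x. 0"] \<open>g c = (\<lambda>x. 0)\<close> by (simp only: mult_zero_left)
      then show ?thesis using that by simp
    qed
    have ga: "supp_le M n w (g a)" using g[of a] Suc.prems by simp
    note IHa = Suc.IH[OF _ Suc.prems(2) im Suc.prems(4,5) ga]
    have "supp_le M n (w + int (i * a)) (Rep_lin (Xop q n (Suc m) i a) f)"
      unfolding supp_le_def
    proof (intro allI impI)
      fix \<alpha> assume "Rep_lin (Xop q n (Suc m) i a) f \<alpha> \<noteq> 0"
      then obtain c where c: "c \<in> {1..n}" "Rep_lin (Xop q n m i c) (g c) \<alpha> \<noteq> 0"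
        unfolding X by (meson sum.neutral)
      then show "wt M n \<alpha> \<le> w + int (i * a)"
        using less[OF c(1) _ c(2)] IHa Suc.prems(1) by (cases "c = a") (auto simp: supp_le_def)
    qed
    moreover have "Rep_lin (Xop q n (Suc m) i a) f \<alpha> \<noteq> 0 \<longleftrightarrow> f (shift i (Suc n) a \<alpha>) \<noteq> 0"
      if \<alpha>: "wt M n \<alpha> = w + int (i * a)" for \<alpha>
    proof -
      have "Rep_lin (Xop q n (Suc m) i a) f \<alpha> = Rep_lin (Xop q n m i a) (g a) \<alpha>"
      proof -
        have "Rep_lin (Xop q n m i c) (g c) \<alpha> = 0" if "c \<in> {1..n} - {a}" for c
          using less[of c \<alpha>] that \<alpha> by auto
        then have "(\<Sum>c\<in>{1..n} - {a}. Rep_lin (Xop q n m i c) (g c) \<alpha>) = 0" by (intro sum.neutral) blast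
        then show ?thesis unfolding X using Suc.prems by (subst sum.remove[of _ a]) auto
      qed
      \<comment> \<open>On the diagonal the added row acts by a power of \<open>q\<close>, which
        does not affect vanishing.\<close>
      moreover have "shift (Suc m) a a \<beta> = \<beta>" for \<beta> by (simp add: shift_def)
      ultimately show ?thesis using IHa \<alpha> Suc.prems(1) assms(1) by (auto simp: g_def lop.rep_eq)
    qed
    ultimately show ?thesis by blast
  qed
qed simp

definition wordop :: "'k::field \<Rightarrow> nat \<Rightarrow> nat \<Rightarrow> (nat \<times> nat) list \<Rightarrow> (expo, 'k) lin" where
  "wordop q m n w = prod_list (map (\<lambda>(i, a). Xop q n m i a) w)"

text \<open>The exponent that the leading terms reach from zero: a letter \<open>(i, a)\<close>
  raises column \<open>a\<close> of row \<open>i\<close> by one and lowers the auxiliary column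
  \<open>n + 1\<close> by one.\<close>

definition point :: "nat \<Rightarrow> (nat \<times> nat) multiset \<Rightarrow> expo" where
  "point n \<beta> = (\<lambda>(i, a). if a = Suc n then - int (size (filter_mset (\<lambda>z. fst z = i) \<beta>)) else int
      (count \<beta> (i, a)))"

definition vac :: "expo \<Rightarrow> 'k::field" where "vac \<alpha> = (if \<alpha> = (\<lambda>_. 0) then 1 else 0)"

definition weight :: "(nat \<times> nat) multiset \<Rightarrow> nat" where
  "weight \<beta> = (\<Sum>(i, a)\<in>#\<beta>. i * a)"

lemma point_inj:
  assumes "set_mset \<beta> \<subseteq> {1..m} \<times> {1..n}" "set_mset \<gamma> \<subseteq> {1..m} \<times> {1..n}" "point n \<beta> = point n \<gamma>"
  shows "\<beta> = \<gamma>"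
proof (rule multiset_eqI)
  fix z :: "nat \<times> nat"
  show "count \<beta> z = count \<gamma> z"
  proof (cases "z \<in> {1..m} \<times> {1..n}")
    case True
    then show ?thesis using fun_cong[OF assms(3), of z] by (auto simp: point_def)
  next
    case False
    then have "z \<notin># \<beta>" "z \<notin># \<gamma>" using assms by blast+
    then show ?thesis by (simp add: not_in_iff)
  qed
qed

lemma point_add:
  assumes "1 \<le> a" "a \<le> n"
  shows "\<alpha> = point n (add_mset (i, a) \<beta>) \<longleftrightarrow> shift i (Suc n) a \<alpha> = point n \<beta>"
proof -
  have pt: "point n (add_mset (i, a) \<beta>) = (\<lambda>z. point n \<beta> z + of_bool (z = (i, a)) - of_bool (z = (i, Suc n)))"
    using assms by (auto simp: point_def fun_eq_iff)
  have "\<alpha> = (\<lambda>z. p z + of_bool (z = (i, a)) - of_bool (z = (i, Suc n))) \<longleftrightarrow> shift i (Suc n) a \<alpha> = p" for p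
    unfolding shift_def fun_eq_iff by (intro iff_allI) linarith
  then show ?thesis unfolding pt .
qed

lemma wt_point:
  assumes "set_mset \<beta> \<subseteq> {1..m} \<times> {1..n}"
  shows "wt m n (point n \<beta>) = int (weight \<beta>)"
  using assms
proof (induction \<beta>)
  case empty
  then show ?case by (simp add: wt_def point_def weight_def case_prod_unfold sum.neutral)
next
  case (add z \<beta>)
  obtain i a where z: "z = (i, a)" by force
  then have ia: "1 \<le> i" "i \<le> m" "1 \<le> a" "a \<le> n" using add.prems by auto
  have "shift i (Suc n) a (point n (add_mset z \<beta>)) = point n \<beta>"
    using point_add[of a n _ i \<beta>] ia z by blast
  then have "wt m n (point n (add_mset z \<beta>)) = wt m n (point n \<beta>) + int (i * a)"
    using wt_shift[of i m "Suc n" a n "point n (add_mset z \<beta>)"] ia by simp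
  then show ?case using add z by (simp add: weight_def)
qed

text \<open>The point of largest weight depends only on the multiset of letters, and
  \<open>point_inj\<close> separates different multisets whatever the value of
  \<open>q\<close>.\<close>

lemma wordop_leading:
  fixes q :: "'k::field"
  assumes "q \<noteq> 0" "set w \<subseteq> {1..m} \<times> {1..n}"
  shows "supp_le m n (weight (mset w)) (Rep_lin (wordop q m n w) vac) \<and>
    (\<forall>\<alpha>. wt m n \<alpha> = weight (mset w) \<longrightarrow>
      (Rep_lin (wordop q m n w) vac \<alpha> \<noteq> 0 \<longleftrightarrow> \<alpha> = point n (mset w)))"
  using assms(2)
proof (induction w)
  case Nil
  have "wt m n (\<lambda>_. 0) = 0" by (simp add: wt_def)
  moreover have "point n {#} = (\<lambda>_. 0)" by (auto simp: point_def)
  ultimately show ?case by (auto simp: wordop_def weight_def lin_rep vac_def supp_le_def)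
next
  case (Cons z w)
  obtain i a where z: "z = (i, a)" by force
  then have ia: "1 \<le> i" "i \<le> m" "1 \<le> a" "a \<le> n" using Cons.prems by auto
  let ?f = "Rep_lin (wordop q m n w) vac :: expo \<Rightarrow> 'k"
  have IH: "supp_le m n (weight (mset w)) ?f"
    "wt m n \<alpha> = weight (mset w) \<Longrightarrow> ?f \<alpha> \<noteq> 0 \<longleftrightarrow> \<alpha> = point n (mset w)" for \<alpha>
    using Cons by auto
  have weight: "int (weight (mset (z # w))) = int (weight (mset w)) + int (i * a)"
    by (simp add: weight_def z)
  have X: "Rep_lin (wordop q m n (z # w)) vac = Rep_lin (Xop q n m i a) ?f"
    by (simp add: wordop_def z lin_rep)
  note lead = Xop_leading[OF assms(1) order.refl ia IH(1)]
  have "Rep_lin (Xop q n m i a) ?f \<alpha> \<noteq> 0 \<longleftrightarrow> \<alpha> = point n (mset (z # w))"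
    if "wt m n \<alpha> = weight (mset (z # w))" for \<alpha>
  proof -
    have "wt m n (shift i (Suc n) a \<alpha>) = weight (mset w)"
      using wt_shift[of i m "Suc n" a n \<alpha>] ia that weight by simp
    then show ?thesis
      using lead that weight IH(2) point_add[OF ia(3,4), of \<alpha> i "mset w"] z by auto
  qed
  then show ?case using lead X weight by auto
qed

section \<open>Evaluation of noncommutative polynomials\<close>

lemma ncpoly_sum_singles: "p = (\<Sum>w\<in>Poly_Mapping.keys p. Poly_Mapping.single w (Poly_Mapping.lookup p w))"
proof (rule poly_mapping_eqI)
  fix v
  show "Poly_Mapping.lookup p v =
    Poly_Mapping.lookup (\<Sum>w\<in>Poly_Mapping.keys p. Poly_Mapping.single w (Poly_Mapping.lookup p w)) v"
    by (auto simp: lookup_sum lookup_single when_def in_keys_iff sum.delta)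
qed

lemma central_ncconst: "central_scalars (ncconst :: 'k \<Rightarrow> ('v, 'k::field) ncpoly)"
proof
  fix x :: "('v, 'k) ncpoly" and c :: 'k
  show "x * ncconst c = ncconst c * x"
    by (subst (1 2) ncpoly_sum_singles[of x])
      (simp add: ncconst_def sum_distrib_left sum_distrib_right mult_single mult.commute)
qed (simp_all add: ncconst_def single_add mult_single)

context central_scalars
begin

text \<open>The algebra homomorphism provided by the universal property of the free algebra.\<close>

definition ev :: "('v \<Rightarrow> 'a) \<Rightarrow> ('v, 'k) ncpoly \<Rightarrow> 'a" where
  "ev u p = (\<Sum>w\<in>Poly_Mapping.keys p. s (Poly_Mapping.lookup p w) * prod_list (map u (letters w)))"

lemma ev_superset:
  assumes "finite A" "Poly_Mapping.keys p \<subseteq> A"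
  shows "ev u p = (\<Sum>w\<in>A. s (Poly_Mapping.lookup p w) * prod_list (map u (letters w)))"
  unfolding ev_def using assms by (intro sum.mono_neutral_left) (auto simp: in_keys_iff)

lemma ev_add: "ev u (p + r) = ev u p + ev u r"
proof -
  let ?A = "Poly_Mapping.keys p \<union> Poly_Mapping.keys r"
  have "ev u (p + r) = (\<Sum>w\<in>?A. s (Poly_Mapping.lookup (p + r) w) * prod_list (map u (letters w)))"
    using Poly_Mapping.keys_add[of p r] by (intro ev_superset) auto
  also have "\<dots> = ev u p + ev u r"
    unfolding ev_superset[of ?A p u, simplified] ev_superset[of ?A r u, simplified]
    by (simp add: lookup_add s_add distrib_right sum.distrib)
  finally show ?thesis .
qed

lemma ev_zero [simp]: "ev u 0 = 0"
  by (simp add: ev_def)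

lemma ev_sum: "ev u (sum p A) = (\<Sum>a\<in>A. ev u (p a))"
  by (induction A rule: infinite_finite_induct) (simp_all add: ev_add)

lemma ev_single: "ev u (Poly_Mapping.single w c) = s c * prod_list (map u (letters w))"
  by (simp add: ev_def)

lemma ev_mult: "ev u (p * r) = ev u p * ev u r"
proof -
  have single: "ev u (Poly_Mapping.single w c * Poly_Mapping.single v d) =
      ev u (Poly_Mapping.single w c) * ev u (Poly_Mapping.single v d)" for w v c d
    by (simp add: mult_single ev_single mult.assoc s_left_comm[of "prod_list _"])
  have "ev u (p * r) = ev u ((\<Sum>w\<in>Poly_Mapping.keys p. Poly_Mapping.single w (Poly_Mapping.lookup p w)) *
      (\<Sum>w\<in>Poly_Mapping.keys r. Poly_Mapping.single w (Poly_Mapping.lookup r w)))"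
    using ncpoly_sum_singles[of p] ncpoly_sum_singles[of r] by simp
  also have "\<dots> = ev u (\<Sum>w\<in>Poly_Mapping.keys p. Poly_Mapping.single w (Poly_Mapping.lookup p w)) *
      ev u (\<Sum>w\<in>Poly_Mapping.keys r. Poly_Mapping.single w (Poly_Mapping.lookup r w))"
    unfolding sum_product ev_sum single ..
  also have "\<dots> = ev u p * ev u r"
    using ncpoly_sum_singles[of p] ncpoly_sum_singles[of r] by simp
  finally show ?thesis .
qed

lemma ev_minus: "ev u (p - r) = ev u p - ev u r"
  using ev_add[of u "p - r" r] by (simp add: algebra_simps)

lemma ev_const: "ev u (ncconst c) = s c"
  by (simp add: ncconst_def ev_single)

lemma ev_one: "ev u 1 = 1"
  using ev_const[of u 1] by (simp add: ncconst_def s_one)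

lemma ev_var: "ev u (ncvar v) = u v"
  by (simp add: ncvar_def ev_single s_one)

lemma ev_word: "ev u (prod_list (map ncvar w)) = prod_list (map u w)"
  by (induction w) (simp_all add: ev_one ev_mult ev_var)

end

interpretation nc: central_scalars "ncconst :: 'k \<Rightarrow> ('v, 'k::field) ncpoly"
  by (rule central_ncconst)

interpretation sc: central_scalars "scal :: 'k \<Rightarrow> (expo, 'k::field) lin"
  by (rule central_scal)

section \<open>The quantum matrix algebra as an algebra of operators\<close>

definition genop :: "'k::field \<Rightarrow> nat \<Rightarrow> nat \<Rightarrow> nat \<times> nat \<Rightarrow> (expo, 'k) lin" where
  "genop q m n = (\<lambda>(i, a). Xop q n m i a)"

abbreviation rep :: "'k::field \<Rightarrow> nat \<Rightarrow> nat \<Rightarrow> (nat \<times> nat, 'k) ncpoly \<Rightarrow> (expo, 'k) lin" where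
  "rep q m n \<equiv> sc.ev (genop q m n)"

lemma free_algebra_simps [simp]:
  "x \<oplus>\<^bsub>free_algebra V\<^esub> y = x + y" "x \<otimes>\<^bsub>free_algebra V\<^esub> y = x * y"
  "\<zero>\<^bsub>free_algebra V\<^esub> = 0" "\<one>\<^bsub>free_algebra V\<^esub> = 1"
  by (simp_all add: free_algebra_def)

lemma zero_one_free_algebra: "0 \<in> carrier (free_algebra V)" "1 \<in> carrier (free_algebra V)"
  by (simp_all add: free_algebra_def)

lemma free_algebra_a_inv:
  fixes x :: "('v, 'k::field) ncpoly"
  assumes "x \<in> carrier (free_algebra V)"
  shows "\<ominus>\<^bsub>free_algebra V\<^esub> x = - x"
proof -
  interpret R: ring "free_algebra V :: ('v, 'k) ncpoly ring" by (rule free_algebra_ring)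
  show ?thesis
    using R.minus_equality[of "- x" x] assms free_algebra_uminus_closed[OF assms] by simp
qed

lemma qmatrix_relations_rep:
  assumes "q \<noteq> 0" "p \<in> qmatrix_relations q m n"
  shows "rep q m n p = 0"
proof -
  interpret quantum_matrix scal q "Xop q n m" by (rule quantum_matrix_Xop[OF assms(1)])
  have 1: "Xop q n m i j * Xop q n m i l = scal q * Xop q n m i l * Xop q n m i j" if "j < l" for i j l
    using rel[of i i l j] that by (simp add: sc.s_one mult.assoc)
  have 2: "Xop q n m i j * Xop q n m k j = scal q * Xop q n m k j * Xop q n m i j" if "i < k" for i k j
    using rel[of k i j j] that by (simp add: sc.s_one mult.assoc)
  have 3: "Xop q n m i l * Xop q n m k j = Xop q n m k j * Xop q n m i l" if "i < k" "j < l" for i k j l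
    using rel[of k i l j] that by (simp add: sc.s_one)
  have 4: "Xop q n m i j * Xop q n m k l = Xop q n m k l * Xop q n m i j
      + scal (q - inverse q) * Xop q n m i l * Xop q n m k j" if "i < k" "j < l" for i k j l
    using rel[of k i j l] 3[OF that] that by (simp add: sc.s_one mult.assoc)
  show ?thesis
    using assms(2) unfolding qmatrix_relations_def
    by (auto simp: sc.ev_minus sc.ev_mult sc.ev_var sc.ev_const genop_def 1 2 4 intro!: 3)
qed

text \<open>The polynomials acting as zero form an ideal, and it contains the relations.\<close>

lemma qmatrix_ideal_rep:
  assumes "q \<noteq> 0" "p \<in> qmatrix_ideal q m n"
  shows "rep q m n p = 0"
proof -
  let ?R = "free_matrix_algebra m n :: (nat \<times> nat, 'a) ncpoly ring"
  interpret R: ring ?R by (rule free_algebra_ring)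
  let ?K = "{p \<in> carrier ?R. rep q m n p = 0}"
  have "ideal ?K ?R"
  proof (rule idealI[OF free_algebra_ring])
    show "subgroup ?K (add_monoid ?R)"
    proof (rule R.add.subgroupI)
      have "0 \<in> ?K" using zero_one_free_algebra(1) by simp
      then show "?K \<noteq> {}" by blast
      show "\<ominus>\<^bsub>?R\<^esub> a \<in> ?K" if "a \<in> ?K" for a
        using that free_algebra_uminus_closed[of a] sc.ev_minus[of "genop q m n" 0 a]
        by (auto simp: free_algebra_a_inv)
    qed (auto simp: sc.ev_add free_algebra_closed)
  qed (auto simp: sc.ev_mult free_algebra_closed)
  moreover have "qmatrix_relations q m n \<subseteq> ?K"
    using qmatrix_relations_closed qmatrix_relations_rep[OF assms(1)] by blast
  ultimately have "qmatrix_ideal q m n \<subseteq> ?K"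
    unfolding qmatrix_ideal_def by (rule R.genideal_minimal)
  then show ?thesis using assms(2) by blast
qed

lemma qmatrix_ideal_facts:
  fixes q :: "'k::field"
  shows "0 \<in> qmatrix_ideal q m n"
    "\<lbrakk>x \<in> qmatrix_ideal q m n; y \<in> qmatrix_ideal q m n\<rbrakk> \<Longrightarrow> x + y \<in> qmatrix_ideal q m n"
    "\<lbrakk>x \<in> qmatrix_ideal q m n; y \<in> carrier (free_matrix_algebra m n)\<rbrakk> \<Longrightarrow> y * x \<in> qmatrix_ideal q m n"
    "\<lbrakk>x \<in> qmatrix_ideal q m n; y \<in> carrier (free_matrix_algebra m n)\<rbrakk> \<Longrightarrow> x * y \<in> qmatrix_ideal q m n"
    "qmatrix_ideal q m n \<subseteq> carrier (free_matrix_algebra m n :: (nat \<times> nat, 'k) ncpoly ring)"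
    "qmatrix_relations q m n \<subseteq> qmatrix_ideal q m n"
proof -
  interpret I: ideal "qmatrix_ideal q m n" "free_matrix_algebra m n" by (rule qmatrix_ideal_ideal)
  show "0 \<in> qmatrix_ideal q m n" using additive_subgroup.zero_closed[OF I.is_additive_subgroup] by simp
  show "x + y \<in> qmatrix_ideal q m n" if "x \<in> qmatrix_ideal q m n" "y \<in> qmatrix_ideal q m n"
    using additive_subgroup.a_closed[OF I.is_additive_subgroup that] by simp
  show "y * x \<in> qmatrix_ideal q m n"
    if "x \<in> qmatrix_ideal q m n" "y \<in> carrier (free_matrix_algebra m n)"
    using I.I_l_closed[OF that] by simp
  show "x * y \<in> qmatrix_ideal q m n"
    if "x \<in> qmatrix_ideal q m n" "y \<in> carrier (free_matrix_algebra m n)"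
    using I.I_r_closed[OF that] by simp
  show "qmatrix_ideal q m n \<subseteq> carrier (free_matrix_algebra m n)" by (rule I.a_subset)
  show "qmatrix_relations q m n \<subseteq> qmatrix_ideal q m n"
    unfolding qmatrix_ideal_def using ring.genideal_self[OF free_algebra_ring qmatrix_relations_closed] .
qed

lemma qmatrix_ideal_subspace: "nc.vs.subspace (qmatrix_ideal q m n)"
  unfolding nc.vs.subspace_def by (auto intro: qmatrix_ideal_facts)

text \<open>The only relation with a lower term is the fourth, and there
  \<open>i * l + k * j < i * j + k * l\<close>; all others are commutations up to a unit.\<close>

lemma word_filtration_qmatrix:
  fixes q :: "'k::field"
  assumes "q \<noteq> 0"
  shows "word_filtration ncconst ncvar ({1..m} \<times> {1..n}) (\<lambda>(i, j). i * j) (qmatrix_ideal q m n)"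
proof (intro word_filtration.intro central_ncconst word_filtration_axioms.intro qmatrix_ideal_subspace)
  let ?V = "{1..m} \<times> {1..n} :: (nat \<times> nat) set" and ?I = "qmatrix_ideal q m n"
  show "ncvar v * x \<in> ?I" "x * ncvar v \<in> ?I" if "v \<in> ?V" "x \<in> ?I" for v x
    using qmatrix_ideal_facts(3,4)[OF that(2) ncvar_closed[OF that(1)]] by simp_all
  fix a b :: "nat \<times> nat"
  assume ab: "a \<in> ?V" "b \<in> ?V"
  let ?u = "ncvar :: nat \<times> nat \<Rightarrow> (nat \<times> nat, 'k) ncpoly" and ?wt = "\<lambda>(i, j). i * j :: nat"
  let ?S = "\<lambda>a b. {?u x * ?u y |x y. x \<in> ?V \<and> y \<in> ?V \<and> ?wt x + ?wt y < ?wt a + ?wt b} \<union> ?I"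
  define Sp where "Sp a b = nc.vs.span (?S a b)" for a b :: "nat \<times> nat"
  define P where "P a b \<longleftrightarrow> (\<exists>c. c \<noteq> 0 \<and> ?u a * ?u b - ncconst c * (?u b * ?u a) \<in> Sp a b)"
    for a b :: "nat \<times> nat"
  have I: "x \<in> Sp a b" if "x \<in> ?I" for x a b
    using that unfolding Sp_def by (intro nc.vs.span_base) auto
  have rels: "x \<in> ?I" if "x \<in> qmatrix_relations q m n" for x
    using that qmatrix_ideal_facts(6) by blast
  \<comment> \<open>The relations are listed for one order of the letters. Solving for the opposite
    product gives the other order, with the same bound on weights.\<close>
  have sym: "P b a" if P: "P a b" for a b
  proof -
    obtain c where c: "c \<noteq> 0" "?u a * ?u b - ncconst c * (?u b * ?u a) \<in> Sp a b"
      using P by (auto simp: P_def)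
    have "ncconst (- inverse c) * (?u a * ?u b - ncconst c * (?u b * ?u a)) =
      ?u b * ?u a - ncconst (inverse c) * (?u a * ?u b)"
      using c(1) by (simp add: right_diff_distrib nc.s_one)
    then show ?thesis
      using nc.vs.span_scale[OF c(2)[unfolded Sp_def], of "- inverse c"] c(1) unfolding P_def Sp_def
      by (intro exI[of _ "inverse c"]) (simp add: add.commute)
  qed
  have main: "P (i, j) (k, l)"
    if ord: "i < k \<or> i = k \<and> j < l" and that: "(i, j) \<in> ?V" "(k, l) \<in> ?V" for i j k l
  proof -
    consider "i = k" "j < l" | "i < k" "j = l" | "i < k" "l < j" | "i < k" "j < l"
      using ord by linarith
    then show ?thesis
    proof cases
      case 1
      then have "?u (i, j) * ?u (i, l) - ncconst q * ?u (i, l) * ?u (i, j) \<in> qmatrix_relations q m n"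
        using that unfolding qmatrix_relations_def by auto
      then show ?thesis unfolding P_def using assms 1 I[OF rels]
        by (intro exI[of _ q]) (simp add: mult.assoc)
    next
      case 2
      then have "?u (i, j) * ?u (k, j) - ncconst q * ?u (k, j) * ?u (i, j) \<in> qmatrix_relations q m n"
        using that unfolding qmatrix_relations_def by auto
      then show ?thesis unfolding P_def using assms 2 I[OF rels]
        by (intro exI[of _ q]) (simp add: mult.assoc)
    next
      case 3
      then have "?u (i, j) * ?u (k, l) - ?u (k, l) * ?u (i, j) \<in> qmatrix_relations q m n"
        using that unfolding qmatrix_relations_def by auto
      then show ?thesis unfolding P_def using I[OF rels]
        by (intro exI[of _ 1]) (simp add: nc.s_one)
    next
      case 4
      have "?u (i, j) * ?u (k, l) - ?u (k, l) * ?u (i, j) - ncconst (q - inverse q) * ?u (i, l) * ?u (k, j)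
          \<in> qmatrix_relations q m n"
        using 4 that unfolding qmatrix_relations_def by auto
      moreover have "?u (i, l) * ?u (k, j) \<in> ?S (i, j) (k, l)"
      proof -
        obtain e where e: "k = i + e" "e > 0" using 4(1) less_imp_add_positive by blast
        obtain g where g: "l = j + g" "g > 0" using 4(2) less_imp_add_positive by blast
        have "i * l + k * j < i * j + k * l" using e g by (simp add: algebra_simps)
        then show ?thesis using that
          by (intro UnI1 CollectI exI[of _ "(i, l)"] exI[of _ "(k, j)"]) auto
      qed
      ultimately have x: "(?u (i, j) * ?u (k, l) - ?u (k, l) * ?u (i, j) - ncconst (q - inverse q) * ?u
          (i, l) * ?u (k, j))
          + ncconst (q - inverse q) * (?u (i, l) * ?u (k, j)) \<in> Sp (i, j) (k, l)"
        using I[OF rels] unfolding Sp_def by (intro nc.vs.span_add nc.vs.span_scale)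
            (simp_all only: nc.vs.span_base)
      then show ?thesis unfolding P_def
        by (intro exI[of _ 1]) (simp add: nc.s_one mult.assoc)
    qed
  qed
  obtain i j k l where ij: "a = (i, j)" "b = (k, l)" by force
  consider "a = b" | "i < k \<or> i = k \<and> j < l" | "k < i \<or> k = i \<and> l < j" using ij by fastforce
  then have "P a b"
  proof cases
    case 1
    then show ?thesis unfolding P_def using I[OF qmatrix_ideal_facts(1)]
      by (intro exI[of _ 1]) (simp add: nc.s_one)
  next
    case 2
    then show ?thesis using main ab ij by blast
  next
    case 3
    then show ?thesis using main[of k i l j] sym ab ij by blast
  qed
  then show "\<exists>c. c \<noteq> 0 \<and> ?u a * ?u b - ncconst c * (?u b * ?u a) \<in> Sp a b"
    unfolding P_def Sp_def .
qed

lemma free_algebra_span: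
  assumes "p \<in> carrier (free_algebra V)"
  shows "p \<in> nc.vs.span {prod_list (map ncvar w) |w. set w \<subseteq> V}"
proof -
  have "prod_list (map ncvar l) = Poly_Mapping.single (Word l) (1 :: 'b)" for l :: "'a list"
  proof (induction l)
    case Nil
    then show ?case by (metis list.map(1) prod_list.Nil single_one zero_word_def)
  qed (simp add: ncvar_def mult_single plus_word_def)
  then have "Poly_Mapping.single w c = ncconst c * prod_list (map ncvar (letters w))" for w ::
      "'a word" and c :: 'b
    by (simp add: ncconst_def mult_single)
  then have "p = (\<Sum>w\<in>Poly_Mapping.keys p. ncconst (Poly_Mapping.lookup p w) * prod_list
      (map ncvar (letters w)))"
    using ncpoly_sum_singles[of p] by simp
  also have "\<dots> \<in> nc.vs.span {prod_list (map ncvar w) |w. set w \<subseteq> V}"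
    using assms by (intro nc.vs.span_sum nc.vs.span_scale nc.vs.span_base) (auto simp: free_algebra_def)
  finally show ?thesis .
qed

text \<open>Write both factors through ordered monomials and let \<beta> and \<gamma> be the
  greatest exponents. The product applied to \<open>vac\<close> is then read off at the point of
  \<open>\<beta> + \<gamma>\<close>, where every other pair of monomials contributes zero.\<close>

lemma rep_domain:
  fixes q :: "'k::field"
  assumes q: "q \<noteq> 0"
    and p: "p \<in> carrier (free_matrix_algebra m n)" "p \<notin> qmatrix_ideal q m n"
    and r: "r \<in> carrier (free_matrix_algebra m n)" "r \<notin> qmatrix_ideal q m n"
  shows "rep q m n p * rep q m n r \<noteq> 0"
proof -
  let ?V = "{1..m} \<times> {1..n} :: (nat \<times> nat) set" and ?I = "qmatrix_ideal q m n"
  interpret W: word_filtration ncconst ncvar ?V "\<lambda>(i, j). i * j" ?I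
    by (rule word_filtration_qmatrix[OF q])
  have wtm: "W.wtm \<beta> = weight \<beta>" for \<beta> by (simp add: W.wtm_def weight_def)
  have normal: "\<exists>F c. finite F \<and> F \<noteq> {} \<and> (\<forall>\<beta>\<in>F. set_mset \<beta> \<subseteq> ?V \<and> c \<beta> \<noteq> 0) \<and>
      rep q m n p = (\<Sum>\<beta>\<in>F. scal (c \<beta>) * wordop q m n (sorted_list_of_multiset \<beta>))"
    if p: "p \<in> carrier (free_matrix_algebra m n)" "p \<notin> ?I" for p
  proof -
    have "prod_list (map ncvar w) \<in> nc.vs.span ({W.std \<beta> |\<beta>. \<beta> \<in> {\<beta>. set_mset \<beta> \<subseteq> ?V}} \<union> ?I)"
      if "set w \<subseteq> ?V" for w
      using W.mon_span_std[OF that] by (simp add: W.mon_def)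
    then have "nc.vs.span {prod_list (map ncvar w) |w. set w \<subseteq> ?V} \<subseteq>
        nc.vs.span ({W.std \<beta> |\<beta>. \<beta> \<in> {\<beta>. set_mset \<beta> \<subseteq> ?V}} \<union> ?I)"
      by (intro nc.vs.span_minimal nc.vs.subspace_span) auto
    then have "p \<in> nc.vs.span ({W.std \<beta> |\<beta>. \<beta> \<in> {\<beta>. set_mset \<beta> \<subseteq> ?V}} \<union> ?I)"
      using free_algebra_span[OF p(1)] by blast
    from nc.span_family[OF qmatrix_ideal_subspace this]
    obtain F c where F: "finite F" "F \<subseteq> {\<beta>. set_mset \<beta> \<subseteq> ?V}" "\<forall>\<beta>\<in>F. c \<beta> \<noteq> 0"
      "p - (\<Sum>\<beta>\<in>F. ncconst (c \<beta>) * W.std \<beta>) \<in> ?I" by blast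
    have "F \<noteq> {}" using F(4) p(2) by auto
    moreover have "rep q m n p = (\<Sum>\<beta>\<in>F. scal (c \<beta>) * wordop q m n (sorted_list_of_multiset \<beta>))"
      using qmatrix_ideal_rep[OF q F(4)]
      by (simp add: sc.ev_minus sc.ev_sum sc.ev_mult sc.ev_const W.std_def W.mon_def sc.ev_word wordop_def
          genop_def)
    ultimately show ?thesis using F by blast
  qed
  obtain F c where F: "finite F" "F \<noteq> {}" "\<And>\<beta>. \<beta> \<in> F \<Longrightarrow> set_mset \<beta> \<subseteq> ?V \<and> c \<beta> \<noteq> 0"
    "rep q m n p = (\<Sum>\<beta>\<in>F. scal (c \<beta>) * wordop q m n (sorted_list_of_multiset \<beta>))"
    using normal[OF p] by blast
  obtain G d where G: "finite G" "G \<noteq> {}" "\<And>\<beta>. \<beta> \<in> G \<Longrightarrow> set_mset \<beta> \<subseteq> ?V \<and> d \<beta> \<noteq> 0"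
    "rep q m n r = (\<Sum>\<beta>\<in>G. scal (d \<beta>) * wordop q m n (sorted_list_of_multiset \<beta>))"
    using normal[OF r] by blast
  obtain \<beta> where \<beta>: "\<beta> \<in> F" "\<forall>\<beta>'\<in>F. \<beta>' = \<beta> \<or> W.prec \<beta>' \<beta>" using W.prec_Max[OF F(1,2)] by blast
  obtain \<gamma> where \<gamma>: "\<gamma> \<in> G" "\<forall>\<gamma>'\<in>G. \<gamma>' = \<gamma> \<or> W.prec \<gamma>' \<gamma>" using W.prec_Max[OF G(1,2)] by blast
  let ?w = "\<lambda>\<beta> \<gamma>. sorted_list_of_multiset \<beta> @ sorted_list_of_multiset \<gamma>"
  let ?\<alpha> = "point n (\<beta> + \<gamma>)"
  have V: "set_mset (\<beta>' + \<gamma>') \<subseteq> ?V" if "\<beta>' \<in> F" "\<gamma>' \<in> G" for \<beta>' \<gamma>' using F(3) G(3) that by auto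
  have wt: "wt m n ?\<alpha> = int (weight (\<beta> + \<gamma>))" using wt_point[OF V[OF \<beta>(1) \<gamma>(1)]] .
  have lead: "Rep_lin (wordop q m n (?w \<beta>' \<gamma>')) vac ?\<alpha> \<noteq> 0 \<longleftrightarrow> \<beta>' = \<beta> \<and> \<gamma>' = \<gamma>"
    if "\<beta>' \<in> F" "\<gamma>' \<in> G" for \<beta>' \<gamma>'
  proof -
    have mset: "mset (?w \<beta>' \<gamma>') = \<beta>' + \<gamma>'" by simp
    have w: "set (?w \<beta>' \<gamma>') \<subseteq> ?V" using V[OF that] by simp
    note L = wordop_leading[OF q w, unfolded mset]
    have le: "weight \<beta>' \<le> weight \<beta>" "weight \<gamma>' \<le> weight \<gamma>"
      using \<beta>(2) \<gamma>(2) that wtm by (auto simp: W.prec_def)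
    have add: "weight (\<beta> + \<gamma>) = weight \<beta> + weight \<gamma>" for \<beta> \<gamma> by (simp add: weight_def)
    show ?thesis
    proof (cases "weight \<beta>' = weight \<beta> \<and> weight \<gamma>' = weight \<gamma>")
      case True
      then have "Rep_lin (wordop q m n (?w \<beta>' \<gamma>')) vac ?\<alpha> \<noteq> 0 \<longleftrightarrow> ?\<alpha> = point n (\<beta>' + \<gamma>')"
        using L wt add by simp
      also have "\<dots> \<longleftrightarrow> \<beta> + \<gamma> = \<beta>' + \<gamma>'"
        using point_inj[OF V[OF \<beta>(1) \<gamma>(1)] V[OF that]] by auto
      also have "\<dots> \<longleftrightarrow> \<beta>' = \<beta> \<and> \<gamma>' = \<gamma>"
      \<comment> \<open>With equal weights \<open>prec\<close> compares the multisets themselves,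
        and two inequalities whose sums are equal must be equalities.\<close>
      proof -
        have "\<beta>' \<le> \<beta>" "\<gamma>' \<le> \<gamma>"
          using \<beta>(2) \<gamma>(2) that True wtm by (auto simp: W.prec_def)
        then show ?thesis
          by (metis add_less_le_mono add_le_less_mono less_irrefl order_le_less)
      qed
      finally show ?thesis .
    next
      case False
      then have "int (weight (\<beta>' + \<gamma>')) < wt m n ?\<alpha>" using le wt add by auto
      then show ?thesis using L False by (auto simp: supp_le_def)
    qed
  qed
  have "Rep_lin (rep q m n p * rep q m n r) vac ?\<alpha> =
    (\<Sum>\<beta>'\<in>F. \<Sum>\<gamma>'\<in>G. c \<beta>' * (d \<gamma>' * Rep_lin (wordop q m n (?w \<beta>' \<gamma>')) vac ?\<alpha>))"
  proof -
    have "scal x * A * (scal y * B) = scal x * (scal y * (A * B))" for x y and A B :: "(expo, 'k) lin"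
      by (simp add: mult.assoc sc.s_left_comm[of A])
    then have "rep q m n p * rep q m n r =
      (\<Sum>\<beta>'\<in>F. \<Sum>\<gamma>'\<in>G. scal (c \<beta>') * (scal (d \<gamma>') * wordop q m n (?w \<beta>' \<gamma>')))"
      unfolding F(4) G(4) sum_product by (simp add: wordop_def)
    then show ?thesis by (simp add: Rep_lin_sum lin_rep mult.assoc)
  qed
  also have "\<dots> = (\<Sum>\<beta>'\<in>F. \<Sum>\<gamma>'\<in>G. if \<beta>' = \<beta> \<and> \<gamma>' = \<gamma> then
      c \<beta> * (d \<gamma> * Rep_lin (wordop q m n (?w \<beta> \<gamma>)) vac ?\<alpha>) else 0)"
    using lead by (intro sum.cong refl) auto
  also have "\<dots> = (\<Sum>\<beta>'\<in>F. if \<beta>' = \<beta> then c \<beta> * (d \<gamma> * Rep_lin (wordop q m n (?w \<beta> \<gamma>)) vac ?\<alpha>) else 0)"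
    using G(1) \<gamma>(1) by (intro sum.cong refl) (auto simp: sum.delta)
  also have "\<dots> = c \<beta> * (d \<gamma> * Rep_lin (wordop q m n (?w \<beta> \<gamma>)) vac ?\<alpha>)"
    using F(1) \<beta>(1) by (simp add: sum.delta)
  also have "\<dots> \<noteq> 0" using F(3)[OF \<beta>(1)] G(3)[OF \<gamma>(1)] lead[OF \<beta>(1) \<gamma>(1)] by auto
  finally show ?thesis by (metis zero_lin.rep_eq)
qed

text \<open>Faithfulness is the case \<open>r = 1\<close> of \<open>rep_domain\<close>.\<close>

lemma rep_eq_zero_iff:
  fixes q :: "'k::field"
  assumes "q \<noteq> 0" "p \<in> carrier (free_matrix_algebra m n)"
  shows "rep q m n p = 0 \<longleftrightarrow> p \<in> qmatrix_ideal q m n"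
proof
  have "1 \<notin> qmatrix_ideal q m n"
    using qmatrix_ideal_rep[OF assms(1), of 1 m n] by (auto simp: sc.ev_one)
  then show "p \<in> qmatrix_ideal q m n" if "rep q m n p = 0"
    using rep_domain[OF assms, of 1] zero_one_free_algebra that by auto
qed (rule qmatrix_ideal_rep[OF assms(1)])

section \<open>The quantum grassmannian\<close>

text \<open>Keeps \<open>{1..m}\<close> in the form in which the definitions state it.\<close>

declare One_nat_def [simp del]

section \<open>The projection onto the quotient ring\<close>

definition proj :: "'k::field \<Rightarrow> nat \<Rightarrow> nat \<Rightarrow> (nat \<times> nat, 'k) ncpoly \<Rightarrow> (nat \<times> nat, 'k) ncpoly set" where
  "proj q m n p = qmatrix_ideal q m n +>\<^bsub>free_matrix_algebra m n\<^esub> p"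

lemma proj_closed:
  "p \<in> carrier (free_matrix_algebra m n) \<Longrightarrow> proj q m n p \<in> carrier (qmatrix q m n)"
  unfolding proj_def by (rule qmatrix_proj_closed)

lemma proj_scalar: "qmatrix_scalar q m n c = proj q m n (ncconst c)"
  and proj_gen: "qmatrix_gen q m n i j = proj q m n (ncvar (i, j))"
  by (simp_all add: qmatrix_scalar_def qmatrix_gen_def proj_def)

lemma proj_hom:
  fixes q :: "'k::field"
  assumes "p \<in> carrier (free_matrix_algebra m n)" "r \<in> carrier (free_matrix_algebra m n)"
  shows "proj q m n (p + r) = proj q m n p \<oplus>\<^bsub>qmatrix q m n\<^esub> proj q m n r"
    and "proj q m n (p * r) = proj q m n p \<otimes>\<^bsub>qmatrix q m n\<^esub> proj q m n r"
  using ring_hom_add[OF ideal.rcos_ring_hom[OF qmatrix_ideal_ideal[of q]] assms]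
    ring_hom_mult[OF ideal.rcos_ring_hom[OF qmatrix_ideal_ideal[of q]] assms]
  by (simp_all add: qmatrix_def proj_def)

lemma proj_one: "proj q m n 1 = \<one>\<^bsub>qmatrix q m n\<^esub>"
  using ring_hom_one[OF ideal.rcos_ring_hom[OF qmatrix_ideal_ideal[of q]]]
  by (simp add: qmatrix_def proj_def)

lemma proj_eq_iff:
  fixes q :: "'k::field"
  assumes "p \<in> carrier (free_matrix_algebra m n)" "r \<in> carrier (free_matrix_algebra m n)"
  shows "proj q m n p = proj q m n r \<longleftrightarrow> p - r \<in> qmatrix_ideal q m n"
  using ring.quotient_eq_iff_same_a_r_cos[OF free_algebra_ring qmatrix_ideal_ideal[of q] assms]
    free_algebra_a_inv[OF assms(2)] by (simp add: a_minus_def proj_def)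

lemma proj_zero: "proj q m n 0 = \<zero>\<^bsub>qmatrix q m n\<^esub>"
proof -
  interpret R: ring "qmatrix q m n" by (rule qmatrix_ring)
  have z: "0 \<in> carrier (free_matrix_algebra m n)" by (rule zero_one_free_algebra)
  have "proj q m n 0 = proj q m n 0 \<oplus>\<^bsub>qmatrix q m n\<^esub> proj q m n 0"
    using proj_hom(1)[OF z z, of q] by simp
  then show ?thesis using R.add.l_cancel_one'[OF proj_closed[OF z] proj_closed[OF z]] by blast
qed

lemma proj_eq_zero_iff:
  "p \<in> carrier (free_matrix_algebra m n) \<Longrightarrow>
    proj q m n p = \<zero>\<^bsub>qmatrix q m n\<^esub> \<longleftrightarrow> p \<in> qmatrix_ideal q m n"
  using proj_eq_iff[OF _ zero_one_free_algebra(1), of p m n q] by (simp add: proj_zero)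

lemma proj_surj:
  assumes "x \<in> carrier (qmatrix q m n)"
  obtains p where "p \<in> carrier (free_matrix_algebra m n)" "x = proj q m n p"
  using assms by (auto simp: qmatrix_def FactRing_def A_RCOSETS_def' proj_def)

lemma proj_uminus:
  fixes q :: "'k::field"
  assumes "p \<in> carrier (free_matrix_algebra m n)"
  shows "proj q m n (- p) = \<ominus>\<^bsub>qmatrix q m n\<^esub> proj q m n p"
proof -
  interpret R: ring "qmatrix q m n" by (rule qmatrix_ring)
  have "proj q m n (- p) \<oplus>\<^bsub>qmatrix q m n\<^esub> proj q m n p = \<zero>\<^bsub>qmatrix q m n\<^esub>"
    using proj_hom(1)[OF free_algebra_uminus_closed[OF assms] assms, of q, symmetric] proj_zero by simp
  then show ?thesis
    using R.minus_equality proj_closed assms free_algebra_uminus_closed by metis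
qed

lemma proj_sum:
  fixes q :: "'k::field"
  assumes "finite A" "\<And>a. a \<in> A \<Longrightarrow> p a \<in> carrier (free_matrix_algebra m n)"
  shows "(\<Sum>a\<in>A. p a) \<in> carrier (free_matrix_algebra m n) \<and>
    proj q m n (\<Sum>a\<in>A. p a) = (\<Oplus>\<^bsub>qmatrix q m n\<^esub>a\<in>A. proj q m n (p a))"
  using assms
proof (induction A rule: finite_induct)
  case empty
  interpret R: ring "qmatrix q m n" by (rule qmatrix_ring)
  show ?case by (simp add: proj_zero zero_one_free_algebra)
next
  case (insert a A)
  interpret R: ring "qmatrix q m n" by (rule qmatrix_ring)
  have p: "p a \<in> carrier (free_matrix_algebra m n)" using insert.prems by blast
  have A: "(\<Sum>a\<in>A. p a) \<in> carrier (free_matrix_algebra m n)"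
    "proj q m n (\<Sum>a\<in>A. p a) = (\<Oplus>\<^bsub>qmatrix q m n\<^esub>a\<in>A. proj q m n (p a))"
    using insert by blast+
  have "(\<Oplus>\<^bsub>qmatrix q m n\<^esub>a\<in>insert a A. proj q m n (p a)) =
    proj q m n (p a) \<oplus>\<^bsub>qmatrix q m n\<^esub> (\<Oplus>\<^bsub>qmatrix q m n\<^esub>a\<in>A. proj q m n (p a))"
    using insert by (intro R.finsum_insert) (auto intro!: proj_closed)
  then show ?case
    using insert.hyps A proj_hom(1)[OF p A(1), of q] free_algebra_closed(1)[OF p A(1)] by simp
qed

lemma proj_prod_list:
  fixes q :: "'k::field"
  assumes "\<And>p. p \<in> set ps \<Longrightarrow> p \<in> carrier (free_matrix_algebra m n)"
  shows "prod_list ps \<in> carrier (free_matrix_algebra m n) \<and>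
    proj q m n (prod_list ps) = foldr (\<otimes>\<^bsub>qmatrix q m n\<^esub>) (map (proj q m n) ps) \<one>\<^bsub>qmatrix q m n\<^esub>"
  using assms
  by (induction ps) (auto simp: proj_one proj_hom zero_one_free_algebra free_algebra_closed)

section \<open>Maximal minors as polynomials and their commutation\<close>

definition minor_poly :: "'k::field \<Rightarrow> nat \<Rightarrow> nat set \<Rightarrow> (nat \<times> nat, 'k) ncpoly" where
  "minor_poly q m J = (\<Sum>\<sigma> | \<sigma> permutes {..<m}. ncconst ((- q) ^ perm_length m \<sigma>) *
    prod_list (map (\<lambda>a. ncvar (sorted_list_of_set {1..m} ! a, sorted_list_of_set J ! \<sigma> a)) [0..<m]))"

lemma minor_poly_proj:
  fixes q :: "'k::field"
  assumes J: "J \<subseteq> {1..n}" "card J = m"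
  shows "minor_poly q m J \<in> carrier (free_matrix_algebra m n)"
    and "proj q m n (minor_poly q m J) = qminor q m n {1..m} J"
proof -
  let ?F = "free_matrix_algebra m n :: (nat \<times> nat, 'k) ncpoly ring"
  let ?v = "\<lambda>\<sigma> a. ncvar (sorted_list_of_set {1..m} ! a, sorted_list_of_set J ! \<sigma> a)"
  have v: "?v \<sigma> a \<in> carrier ?F" if "\<sigma> permutes {..<m}" "a < m" for \<sigma> a
  proof -
    have fin: "finite J" using J(1) finite_subset by blast
    have "\<sigma> a < card J" using permutes_in_image[OF that(1)] that(2) J(2) by auto
    then have "sorted_list_of_set {1..m} ! a \<in> {1..m}" "sorted_list_of_set J ! \<sigma> a \<in> J"
      using fin that(2) nth_mem[of a "sorted_list_of_set {1..m}"] nth_mem[of "\<sigma> a" "sorted_list_of_set J"]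
      by auto
    with J show ?thesis by (intro ncvar_closed) blast
  qed
  have prod: "prod_list (map (?v \<sigma>) [0..<m]) \<in> carrier ?F"
    "proj q m n (prod_list (map (?v \<sigma>) [0..<m])) =
      foldr (\<otimes>\<^bsub>qmatrix q m n\<^esub>) (map (\<lambda>a. proj q m n (?v \<sigma> a)) [0..<m]) \<one>\<^bsub>qmatrix q m n\<^esub>"
    if "\<sigma> permutes {..<m}" for \<sigma>
  proof -
    have "p \<in> carrier ?F" if "p \<in> set (map (?v \<sigma>) [0..<m])" for p
      using that v[OF \<open>\<sigma> permutes {..<m}\<close>] by auto
    note * = proj_prod_list[of "map (?v \<sigma>) [0..<m]" m n q, OF this]
    show "prod_list (map (?v \<sigma>) [0..<m]) \<in> carrier ?F"
      using * by blast
    show "proj q m n (prod_list (map (?v \<sigma>) [0..<m])) =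
      foldr (\<otimes>\<^bsub>qmatrix q m n\<^esub>) (map (\<lambda>a. proj q m n (?v \<sigma> a)) [0..<m]) \<one>\<^bsub>qmatrix q m n\<^esub>"
      using * by (simp only: map_map comp_def)
  qed
  have tm: "ncconst ((- q) ^ perm_length m \<sigma>) * prod_list (map (?v \<sigma>) [0..<m]) \<in> carrier ?F"
    if "\<sigma> permutes {..<m}" for \<sigma>
    using prod(1)[OF that] by (intro free_algebra_closed ncconst_closed)
  have fin: "finite {\<sigma>. \<sigma> permutes {..<m}}" by (rule finite_permutations) simp
  note S = proj_sum[OF fin, of "\<lambda>\<sigma>. ncconst ((- q) ^ perm_length m \<sigma>) * prod_list (map (?v \<sigma>) [0..<m])" m n q]
  show "minor_poly q m J \<in> carrier ?F"
    unfolding minor_poly_def using S tm by blast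
  have "proj q m n (minor_poly q m J) = (\<Oplus>\<^bsub>qmatrix q m n\<^esub>\<sigma>\<in>{\<sigma>. \<sigma> permutes {..<m}}.
      proj q m n (ncconst ((- q) ^ perm_length m \<sigma>) * prod_list (map (?v \<sigma>) [0..<m])))"
    unfolding minor_poly_def using S tm by blast
  also have "\<dots> = qminor q m n {1..m} J"
  proof -
    interpret R: ring "qmatrix q m n" by (rule qmatrix_ring)
    have card: "card {1..m} = m" by simp
    show ?thesis
      unfolding qminor_def card proj_scalar proj_gen
    proof (rule R.finsum_cong')
      fix \<sigma> assume "\<sigma> \<in> {\<sigma>. \<sigma> permutes {..<m}}"
      then have \<sigma>: "\<sigma> permutes {..<m}" by simp
      show "proj q m n (ncconst ((- q) ^ perm_length m \<sigma>) * prod_list (map (?v \<sigma>) [0..<m])) =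
        proj q m n (ncconst ((- q) ^ perm_length m \<sigma>)) \<otimes>\<^bsub>qmatrix q m n\<^esub>
        foldr (\<otimes>\<^bsub>qmatrix q m n\<^esub>) (map (\<lambda>a. proj q m n (?v \<sigma> a)) [0..<m]) \<one>\<^bsub>qmatrix q m n\<^esub>"
        using proj_hom(2)[OF ncconst_closed prod(1)[OF \<sigma>]] prod(2)[OF \<sigma>] by simp
    next
      show "(\<lambda>\<sigma>. proj q m n (ncconst ((- q) ^ perm_length m \<sigma>)) \<otimes>\<^bsub>qmatrix q m n\<^esub>
          foldr (\<otimes>\<^bsub>qmatrix q m n\<^esub>) (map (\<lambda>a. proj q m n (?v \<sigma> a)) [0..<m]) \<one>\<^bsub>qmatrix q m n\<^esub>)
        \<in> {\<sigma>. \<sigma> permutes {..<m}} \<rightarrow> carrier (qmatrix q m n)"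
      proof
        fix \<sigma> assume "\<sigma> \<in> {\<sigma>. \<sigma> permutes {..<m}}"
        then have \<sigma>: "\<sigma> permutes {..<m}" by simp
        show "proj q m n (ncconst ((- q) ^ perm_length m \<sigma>)) \<otimes>\<^bsub>qmatrix q m n\<^esub>
          foldr (\<otimes>\<^bsub>qmatrix q m n\<^esub>) (map (\<lambda>a. proj q m n (?v \<sigma> a)) [0..<m]) \<one>\<^bsub>qmatrix q m n\<^esub>
          \<in> carrier (qmatrix q m n)"
          unfolding prod(2)[OF \<sigma>, symmetric]
          by (intro R.m_closed proj_closed ncconst_closed prod(1)[OF \<sigma>])
      qed
    qed simp
  qed
  finally show "proj q m n (minor_poly q m J) = qminor q m n {1..m} J" .
qed

text \<open>Here the defining sum over column permutations meets the antisymmetrised rows of the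
  commutation relations, by \<open>rdet_eq_cdet\<close>.\<close>

lemma rep_minor_poly:
  fixes q :: "'k::field"
  assumes "q \<noteq> 0" "finite J" "card J = m"
  shows "rep q m n (minor_poly q m J) =
    quantum_matrix.rdet scal q (Xop q n m) {1..m} (sorted_list_of_set J)"
proof -
  interpret Q: quantum_matrix scal q "Xop q n m" by (rule quantum_matrix_Xop[OF assms(1)])
  have "Q.rdet {1..m} (sorted_list_of_set J) = Q.cdet (sorted_list_of_set {1..m}) J"
    using assms by (intro Q.rdet_eq_cdet) auto
  also have "\<dots> = rep q m n (minor_poly q m J)"
    using Q.cdet_permutes[of J "sorted_list_of_set {1..m}"] assms
    by (simp add: minor_poly_def sc.ev_sum sc.ev_mult sc.ev_const sc.ev_word[where w="map _ _", simplified
        comp_def map_map] genop_def comp_def)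
  finally show ?thesis by simp
qed

text \<open>Minors are indexed by the binary codes of their column sets, as a well-ordered index type is
  needed.\<close>

definition minor_index :: "nat \<Rightarrow> nat \<Rightarrow> nat set" where
  "minor_index m n = set_encode ` {J. J \<subseteq> {1..n} \<and> card J = m}"

definition minor_gen :: "'k::field \<Rightarrow> nat \<Rightarrow> nat \<Rightarrow> (nat \<times> nat, 'k) ncpoly" where
  "minor_gen q m v = minor_poly q m (set_decode v)"

text \<open>The lower terms \<open>[K] [L]\<close> in the commutation relation of \<open>[I]\<close> and \<open>[J]\<close> have column sums that
  are further apart but have the same total, hence a larger sum of squares.\<close>

definition minor_wt :: "nat \<Rightarrow> nat \<Rightarrow> nat" where
  "minor_wt n v = (\<Sum>{1..n})\<^sup>2 - (\<Sum>(set_decode v))\<^sup>2"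

lemma minor_index_decode: "v \<in> minor_index m n \<longleftrightarrow> set_decode v \<subseteq> {1..n} \<and> card (set_decode v) = m"
proof
  assume "v \<in> minor_index m n"
  then obtain J where "v = set_encode J" "J \<subseteq> {1..n}" "card J = m" by (auto simp: minor_index_def)
  then show "set_decode v \<subseteq> {1..n} \<and> card (set_decode v) = m"
    using finite_subset[of J "{1..n}"] by simp
next
  assume "set_decode v \<subseteq> {1..n} \<and> card (set_decode v) = m"
  then show "v \<in> minor_index m n"
    unfolding minor_index_def by (intro image_eqI[of _ _ "set_decode v"]) auto
qed

lemma finite_minor_index: "finite (minor_index m n)"
  unfolding minor_index_def by (rule finite_imageI, rule finite_subset[of _ "Pow {1..n}"]) auto

lemma minor_gen_closed: "v \<in> minor_index m n \<Longrightarrow> minor_gen q m v \<in> carrier (free_matrix_algebra m n)"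
  unfolding minor_gen_def minor_index_decode by (intro minor_poly_proj) auto

text \<open>Lift a linear combination of operators term by term; the error acts as zero and hence
  lies in the ideal by faithfulness. This brings the relations between minors back to
  polynomials.\<close>

lemma rep_span_pullback:
  fixes q :: "'k::field"
  assumes q: "q \<noteq> 0" and x: "x \<in> carrier (free_matrix_algebra m n)"
    and S: "S \<subseteq> carrier (free_matrix_algebra m n)" and rep: "rep q m n x \<in> sc.vs.span (rep q m n ` S)"
  shows "x \<in> nc.vs.span (S \<union> qmatrix_ideal q m n)"
proof -
  let ?F = "free_matrix_algebra m n :: (nat \<times> nat, 'k) ncpoly ring"
  have "\<exists>y. y \<in> nc.vs.span S \<and> y \<in> carrier ?F \<and> rep q m n y = rep q m n x"
    using rep
  proof (induction rule: sc.vs.span_induct_alt)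
    case base
    then show ?case
      by (intro exI[of _ 0]) (auto simp: nc.vs.span_zero zero_one_free_algebra)
  next
    case (step c a b)
    then obtain y z where "y \<in> nc.vs.span S" "y \<in> carrier ?F" "rep q m n y = b" "z \<in> S" "rep q m n z = a"
      by auto
    then have "ncconst c * z + y \<in> nc.vs.span S" "ncconst c * z + y \<in> carrier ?F"
      "rep q m n (ncconst c * z + y) = scal c * a + b"
      using S by (auto simp: sc.ev_add sc.ev_mult sc.ev_const
          intro: nc.vs.span_add nc.vs.span_scale nc.vs.span_base free_algebra_closed ncconst_closed)
    then show ?case by blast
  qed
  then obtain y where y: "y \<in> nc.vs.span S" "y \<in> carrier ?F" "rep q m n y = rep q m n x" by blast
  have "x - y \<in> qmatrix_ideal q m n"
    using rep_eq_zero_iff[OF q free_algebra_closed(3)[OF x y(2)]] y(3) by (simp add: sc.ev_minus)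
  moreover have "y \<in> nc.vs.span (S \<union> qmatrix_ideal q m n)"
    using y(1) nc.vs.span_mono[of S "S \<union> qmatrix_ideal q m n"] by blast
  ultimately have "(x - y) + y \<in> nc.vs.span (S \<union> qmatrix_ideal q m n)"
    by (intro nc.vs.span_add) (auto intro: nc.vs.span_base)
  then show ?thesis by simp
qed

text \<open>The column sets of the lower terms lie in the union of the two given ones, so they again
  index maximal minors and the filtration closes up.\<close>

lemma word_filtration_minors:
  fixes q :: "'k::field"
  assumes q: "q \<noteq> 0"
  shows "word_filtration ncconst (minor_gen q m) (minor_index m n) (minor_wt n) (qmatrix_ideal q m n)"
proof (intro word_filtration.intro central_ncconst word_filtration_axioms.intro qmatrix_ideal_subspace)
  let ?I = "qmatrix_ideal q m n" and ?V = "minor_index m n" and ?u = "minor_gen q m"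
  show "?u v * x \<in> ?I" "x * ?u v \<in> ?I" if "v \<in> ?V" "x \<in> ?I" for v x
    using qmatrix_ideal_facts(3,4)[OF that(2) minor_gen_closed[OF that(1)]] by simp_all
  fix a b assume ab: "a \<in> ?V" "b \<in> ?V"
  interpret Q: quantum_matrix scal q "Xop q n m" by (rule quantum_matrix_Xop[OF q])
  let ?A = "set_decode a" and ?B = "set_decode b"
  let ?M = "\<lambda>J. Q.rdet {1..m} (sorted_list_of_set J)"
  have A: "?A \<subseteq> {1..n}" "card ?A = m" and B: "?B \<subseteq> {1..n}" "card ?B = m"
    using ab by (auto simp: minor_index_decode)
  have rep: "rep q m n (?u v) = ?M (set_decode v)" if "v \<in> ?V" for v
    unfolding minor_gen_def using that by (intro rep_minor_poly q) (auto simp: minor_index_decode)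
  let ?S = "{?u x * ?u y |x y. x \<in> ?V \<and> y \<in> ?V \<and> minor_wt n x + minor_wt n y < minor_wt n a + minor_wt n b}"
  obtain c where c: "c \<noteq> 0" "?M ?A * ?M ?B - scal c * (?M ?B * ?M ?A) \<in>
    sc.vs.span {?M K * ?M L |K L. K \<subseteq> ?A \<union> ?B \<and> L \<subseteq> ?A \<union> ?B \<and> card K = card {1..m} \<and> card L = card {1..m} \<and>
      (\<Sum>K)\<^sup>2 + (\<Sum>L)\<^sup>2 > (\<Sum>?A)\<^sup>2 + (\<Sum>?B)\<^sup>2}" (is "_ \<in> sc.vs.span ?S'")
    using Q.minor_commutation[of "{1..m}" ?A ?B] A B by auto
  have sub: "?S' \<subseteq> rep q m n ` ?S"
  proof
    fix z assume "z \<in> ?S'"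
    then obtain K L where z: "z = ?M K * ?M L" and KL: "K \<subseteq> ?A \<union> ?B" "L \<subseteq> ?A \<union> ?B" "card K = m" "card L = m"
      "(\<Sum>K)\<^sup>2 + (\<Sum>L)\<^sup>2 > (\<Sum>?A)\<^sup>2 + (\<Sum>?B)\<^sup>2" by auto
    have sets: "K \<subseteq> {1..n}" "L \<subseteq> {1..n}" using KL(1,2) A B by blast+
    then have fin: "finite K" "finite L" using finite_subset by blast+
    \<comment> \<open>Ensures that the subtraction of naturals in \<open>minor_wt\<close> is never
      cut off at zero.\<close>
    have le: "(\<Sum>J)\<^sup>2 \<le> (\<Sum>{1..n})\<^sup>2" if "J \<subseteq> {1..n}" for J :: "nat set"
      using that by (intro power_mono sum_mono2) auto
    have mem: "set_encode K \<in> ?V" "set_encode L \<in> ?V"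
      using sets KL fin by (auto simp: minor_index_decode)
    have "minor_wt n (set_encode K) + minor_wt n (set_encode L) < minor_wt n a + minor_wt n b"
    proof -
      have "(c - k) + (c - l) < (c - i) + (c - j)"
        if "k \<le> c" "l \<le> c" "i \<le> c" "j \<le> c" "i + j < k + l" for c i j k l :: nat
        using that by linarith
      from this[OF le[OF sets(1)] le[OF sets(2)] le[OF A(1)] le[OF B(1)] KL(5)]
      show ?thesis unfolding minor_wt_def set_encode_inverse[OF fin(1)] set_encode_inverse[OF fin(2)] .
    qed
    then have "?u (set_encode K) * ?u (set_encode L) \<in> ?S" using mem by blast
    moreover have "rep q m n (?u (set_encode K) * ?u (set_encode L)) = z"
      using rep mem fin z by (simp add: sc.ev_mult)
    ultimately show "z \<in> rep q m n ` ?S" by blast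
  qed
  have "?u a * ?u b - ncconst c * (?u b * ?u a) \<in> nc.vs.span (?S \<union> ?I)"
  proof (rule rep_span_pullback[OF q])
    show "?u a * ?u b - ncconst c * (?u b * ?u a) \<in> carrier (free_matrix_algebra m n)"
      using ab by (intro free_algebra_closed minor_gen_closed ncconst_closed)
    show "?S \<subseteq> carrier (free_matrix_algebra m n)"
      by (auto intro!: free_algebra_closed minor_gen_closed)
    have "rep q m n (?u a * ?u b - ncconst c * (?u b * ?u a)) = ?M ?A * ?M ?B - scal c * (?M ?B * ?M ?A)"
      using rep ab by (simp add: sc.ev_minus sc.ev_mult sc.ev_const)
    then show "rep q m n (?u a * ?u b - ncconst c * (?u b * ?u a)) \<in> sc.vs.span (rep q m n ` ?S)"
      using c(2) sc.vs.span_mono[OF sub] by auto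
  qed
  then show "\<exists>c. c \<noteq> 0 \<and> ?u a * ?u b - ncconst c * (?u b * ?u a) \<in> nc.vs.span (?S \<union> ?I)"
    using c(1) by blast
qed

section \<open>The grassmannian inside the quotient ring\<close>

lemma quantum_grassmannian_sel [simp]:
  "x \<oplus>\<^bsub>quantum_grassmannian q m n\<^esub> y = x \<oplus>\<^bsub>qmatrix q m n\<^esub> y"
  "x \<otimes>\<^bsub>quantum_grassmannian q m n\<^esub> y = x \<otimes>\<^bsub>qmatrix q m n\<^esub> y"
  "\<zero>\<^bsub>quantum_grassmannian q m n\<^esub> = \<zero>\<^bsub>qmatrix q m n\<^esub>"
  "\<one>\<^bsub>quantum_grassmannian q m n\<^esub> = \<one>\<^bsub>qmatrix q m n\<^esub>"
  by (simp_all add: quantum_grassmannian_def)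

lemma quantum_grassmannian_carrier_eq:
  "carrier (quantum_grassmannian q m n) =
    generate_ring (qmatrix q m n) (range (qmatrix_scalar q m n) \<union> maximal_qminors q m n)"
  by (simp add: quantum_grassmannian_def)

lemma quantum_grassmannian_subset: "carrier (quantum_grassmannian q m n) \<subseteq> carrier (qmatrix q m n)"
  unfolding quantum_grassmannian_carrier_eq
  by (rule ring.generate_ring_incl[OF qmatrix_ring])
    (auto simp: maximal_qminors_def intro!: qmatrix_scalar_closed qminor_closed)

locale grassmannian =
  fixes q :: "'k::field" and m n :: nat
  assumes q: "q \<noteq> 0"
begin

sublocale W: word_filtration ncconst "minor_gen q m" "minor_index m n" "minor_wt n" "qmatrix_ideal q m n"
  by (rule word_filtration_minors[OF q])

text \<open>Plays the part of the preimage of the grassmannian in the free algebra, in the form of a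
  span of ordered monomials to which \<open>noetherian_division\<close> applies.\<close>

definition lifts :: "(nat \<times> nat, 'k) ncpoly set" where
  "lifts = nc.vs.span ({W.std \<beta> |\<beta>. set_mset \<beta> \<subseteq> minor_index m n} \<union> qmatrix_ideal q m n)"

lemma mon_closed: "set w \<subseteq> minor_index m n \<Longrightarrow> W.mon w \<in> carrier (free_matrix_algebra m n)"
  by (induction w) (auto simp: zero_one_free_algebra free_algebra_closed minor_gen_closed)

lemma lifts_closed: "lifts \<subseteq> carrier (free_matrix_algebra m n)"
  unfolding lifts_def
proof (rule nc.vs.span_minimal)
  show "{W.std \<beta> |\<beta>. set_mset \<beta> \<subseteq> minor_index m n} \<union> qmatrix_ideal q m n \<subseteq> carrier (free_matrix_algebra m n)"
    using qmatrix_ideal_facts(5) by (auto simp: W.std_def intro!: mon_closed)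
  show "nc.vs.subspace (carrier (free_matrix_algebra m n))"
    unfolding nc.vs.subspace_def
    by (auto intro: zero_one_free_algebra free_algebra_closed ncconst_closed)
qed

lemma mon_lifts: "set w \<subseteq> minor_index m n \<Longrightarrow> W.mon w \<in> lifts"
  unfolding lifts_def by (rule W.mon_span_std)

text \<open>A product of ordered monomials is a word in the minors, which
  \<open>mon_span_std\<close> sorts; any factor from the ideal keeps the product in the
  ideal.\<close>

lemma lifts_mult:
  assumes "x \<in> lifts" "y \<in> lifts"
  shows "x * y \<in> lifts"
  using assms(1) unfolding lifts_def
proof (rule nc.span_mult_right)
  fix a assume a: "a \<in> {W.std \<beta> |\<beta>. set_mset \<beta> \<subseteq> minor_index m n} \<union> qmatrix_ideal q m n"
  show "a * y \<in> nc.vs.span ({W.std \<beta> |\<beta>. set_mset \<beta> \<subseteq> minor_index m n} \<union> qmatrix_ideal q m n)"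
  proof (cases "a \<in> qmatrix_ideal q m n")
    case True
    then have "a * y \<in> qmatrix_ideal q m n"
      using qmatrix_ideal_facts(4) lifts_closed assms(2) by blast
    then show ?thesis by (intro nc.vs.span_base) simp
  next
    case False
    then obtain \<beta> where \<beta>: "a = W.std \<beta>" "set_mset \<beta> \<subseteq> minor_index m n" using a by blast
    show ?thesis
      using assms(2) unfolding lifts_def
    proof (rule nc.span_mult_left)
      fix b assume b: "b \<in> {W.std \<beta> |\<beta>. set_mset \<beta> \<subseteq> minor_index m n} \<union> qmatrix_ideal q m n"
      show "a * b \<in> nc.vs.span ({W.std \<beta> |\<beta>. set_mset \<beta> \<subseteq> minor_index m n} \<union> qmatrix_ideal q m n)"
      proof (cases "b \<in> qmatrix_ideal q m n")
        case True
        then have "a * b \<in> qmatrix_ideal q m n"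
          using W.mon_N(1)[of "sorted_list_of_multiset \<beta>" b] \<beta> by (simp add: W.std_def)
        then show ?thesis by (intro nc.vs.span_base) simp
      next
        case False
        then obtain \<gamma> where \<gamma>: "b = W.std \<gamma>" "set_mset \<gamma> \<subseteq> minor_index m n" using b by blast
        have "a * b = W.mon (sorted_list_of_multiset \<beta> @ sorted_list_of_multiset \<gamma>)"
          by (simp add: \<beta> \<gamma> W.std_def)
        then show ?thesis using mon_lifts[of "sorted_list_of_multiset \<beta> @ sorted_list_of_multiset \<gamma>"] \<beta>(2) \<gamma>(2)
          by (simp add: lifts_def)
      qed
    qed
  qed
qed

lemma one_lifts: "1 \<in> lifts"
  using mon_lifts[of "[]"] by simp

lemma scalar_lifts: "ncconst c \<in> lifts"
  using nc.vs.span_scale[OF one_lifts[unfolded lifts_def], of c] by (simp add: lifts_def)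

lemma scalar_carrier: "proj q m n (ncconst c) \<in> carrier (quantum_grassmannian q m n)"
  unfolding quantum_grassmannian_carrier_eq
  by (rule generate_ring.incl) (auto simp: proj_scalar)

lemma mon_carrier:
  "set w \<subseteq> minor_index m n \<Longrightarrow> proj q m n (W.mon w) \<in> carrier (quantum_grassmannian q m n)"
proof (induction w)
  case Nil
  then show ?case
    unfolding quantum_grassmannian_carrier_eq by (simp add: proj_one generate_ring.one)
next
  case (Cons v w)
  have "proj q m n (minor_gen q m v) \<in> maximal_qminors q m n"
    using Cons.prems minor_poly_proj(2)[of "set_decode v" n m q]
    unfolding maximal_qminors_def minor_gen_def by (auto simp: minor_index_decode)
  then have "proj q m n (minor_gen q m v) \<in> carrier (quantum_grassmannian q m n)"
    unfolding quantum_grassmannian_carrier_eq by (intro generate_ring.incl) simp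
  moreover have "proj q m n (W.mon w) \<in> carrier (quantum_grassmannian q m n)" using Cons by simp
  moreover have "proj q m n (W.mon (v # w)) = proj q m n (minor_gen q m v) \<otimes>\<^bsub>qmatrix q m n\<^esub> proj q m n
      (W.mon w)"
    using Cons.prems proj_hom(2)[OF minor_gen_closed[of v] mon_closed[of w], of q] by simp
  ultimately show ?case
    unfolding quantum_grassmannian_carrier_eq by (simp add: generate_ring.eng_mult)
qed

lemma carrier_lifts:
  assumes "x \<in> carrier (quantum_grassmannian q m n)"
  obtains p where "p \<in> lifts" "x = proj q m n p"
proof -
  have "\<exists>p\<in>lifts. x = proj q m n p"
    using assms unfolding quantum_grassmannian_carrier_eq
  proof (induction rule: generate_ring.induct)
    case one
    show ?case using one_lifts proj_one by metis
  next
    case (incl x)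
    then show ?case
    proof
      assume "x \<in> range (qmatrix_scalar q m n)"
      then show ?thesis using scalar_lifts by (auto simp: proj_scalar)
    next
      assume "x \<in> maximal_qminors q m n"
      then obtain J where J: "J \<subseteq> {1..n}" "card J = m" "x = qminor q m n {1..m} J"
        by (auto simp: maximal_qminors_def)
      then have "finite J" using finite_subset by blast
      then have "x = proj q m n (W.mon [set_encode J])" "set [set_encode J] \<subseteq> minor_index m n"
        using J minor_poly_proj(2)[OF J(1,2), of q] by (auto simp: minor_gen_def minor_index_decode)
      then show ?thesis using mon_lifts by blast
    qed
  next
    case (a_inv x)
    then obtain p where p: "p \<in> lifts" "x = proj q m n p" by blast
    have "- p \<in> lifts" using p(1) unfolding lifts_def by (rule nc.vs.span_neg)
    then show ?case using proj_uminus[of p m n q] p lifts_closed by auto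
  next
    case (eng_add x y)
    then obtain p r where p: "p \<in> lifts" "x = proj q m n p" "r \<in> lifts" "y = proj q m n r" by blast
    have "p + r \<in> lifts" using p unfolding lifts_def by (intro nc.vs.span_add)
    then show ?case using proj_hom(1)[of p m n r q] p lifts_closed by blast
  next
    case (eng_mult x y)
    then obtain p r where p: "p \<in> lifts" "x = proj q m n p" "r \<in> lifts" "y = proj q m n r" by blast
    then show ?case using proj_hom(2)[of p m n r q] lifts_mult[of p r] lifts_closed by blast
  qed
  then show ?thesis using that by blast
qed

text \<open>Treats both sides at once: \<open>ideal_pred\<close> stands for left or right ideals and
  \<open>T \<gamma>\<close> for multiplication by \<open>W.std \<gamma>\<close> on that side. Ideals
  are pulled back to \<open>lifts\<close>, where division yields finitely many generators, and these
  are projected. The intersection in the conclusion is the generated ideal with its definition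
  unfolded.\<close>

lemma side_noetherian:
  fixes ideal_pred :: "(nat \<times> nat, 'k) ncpoly set set \<Rightarrow> bool"
  assumes T_add: "\<And>\<gamma> x y. T \<gamma> (x + y) = T \<gamma> x + T \<gamma> y"
    and T_scale: "\<And>\<gamma> c x. T \<gamma> (ncconst c * x) = ncconst c * T \<gamma> x"
    and T_N: "\<And>\<gamma> x. \<lbrakk>set_mset \<gamma> \<subseteq> minor_index m n; x \<in> qmatrix_ideal q m n\<rbrakk> \<Longrightarrow> T \<gamma> x \<in> qmatrix_ideal q m n"
    and T_std: "\<And>\<beta> \<gamma>. \<lbrakk>set_mset \<beta> \<subseteq> minor_index m n; set_mset \<gamma> \<subseteq> minor_index m n\<rbrakk> \<Longrightarrow>
      \<exists>c. c \<noteq> 0 \<and> T \<gamma> (W.std \<beta>) - ncconst c * W.std (\<gamma> + \<beta>) \<in> W.below (\<gamma> + \<beta>)"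
    and T_lifts: "\<And>\<gamma> x. \<lbrakk>set_mset \<gamma> \<subseteq> minor_index m n; x \<in> lifts\<rbrakk> \<Longrightarrow> T \<gamma> x \<in> lifts"
    and sub: "\<And>I. ideal_pred I \<Longrightarrow> I \<subseteq> carrier (quantum_grassmannian q m n)"
    and zero: "\<And>I. ideal_pred I \<Longrightarrow> \<zero>\<^bsub>qmatrix q m n\<^esub> \<in> I"
    and add: "\<And>I x y. \<lbrakk>ideal_pred I; x \<in> I; y \<in> I\<rbrakk> \<Longrightarrow> x \<oplus>\<^bsub>qmatrix q m n\<^esub> y \<in> I"
    and scale: "\<And>I c x. \<lbrakk>ideal_pred I; x \<in> lifts; proj q m n x \<in> I\<rbrakk> \<Longrightarrow> proj q m n (ncconst c * x) \<in> I"
    and T_ideal: "\<And>I \<gamma> x. \<lbrakk>ideal_pred I; set_mset \<gamma> \<subseteq> minor_index m n; x \<in> lifts; proj q m n x \<in> I\<rbrakk> \<Longrightarrow>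
      proj q m n (T \<gamma> x) \<in> I"
    and I: "ideal_pred I"
  shows "\<exists>A \<subseteq> carrier (quantum_grassmannian q m n). finite A \<and> I = \<Inter>{I. ideal_pred I \<and> A \<subseteq> I}"
proof -
  define lift where "lift I = {x \<in> lifts. proj q m n x \<in> I}" for I
  have subspace: "nc.vs.subspace (lift I)" if "ideal_pred I" for I
    unfolding nc.vs.subspace_def
  proof (intro conjI ballI allI)
    show "0 \<in> lift I" using zero[OF that] proj_zero[of q m n] by (simp add: lift_def lifts_def nc.vs.span_zero)
    show "x + y \<in> lift I" if "x \<in> lift I" "y \<in> lift I" for x y
    proof -
      have "x \<in> carrier (free_matrix_algebra m n)" "y \<in> carrier (free_matrix_algebra m n)" "x + y \<in> lifts"
        using that lifts_closed by (auto simp: lift_def lifts_def nc.vs.span_add)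
      then show ?thesis using that add[OF \<open>ideal_pred I\<close>] by (simp add: lift_def proj_hom)
    qed
    show "ncconst c * x \<in> lift I" if "x \<in> lift I" for c x
      using that scale[OF \<open>ideal_pred I\<close>] lifts_mult[OF scalar_lifts] by (simp add: lift_def)
  qed
  have N: "qmatrix_ideal q m n \<subseteq> lift I" if "ideal_pred I" for I
  proof
    fix x assume x: "x \<in> qmatrix_ideal q m n"
    then have "x \<in> lifts" unfolding lifts_def by (intro nc.vs.span_base) simp
    moreover have "proj q m n x = \<zero>\<^bsub>qmatrix q m n\<^esub>"
      using x proj_eq_zero_iff[of x m n q] qmatrix_ideal_facts(5) by blast
    ultimately show "x \<in> lift I" using zero[OF that] by (simp add: lift_def)
  qed
  have T_lift: "T \<gamma> x \<in> lift I" if "ideal_pred I" "set_mset \<gamma> \<subseteq> minor_index m n" "x \<in> lift I" for I \<gamma> x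
    using that T_lifts T_ideal by (simp add: lift_def)
  have "lift I \<subseteq> nc.vs.span ({W.std \<beta> |\<beta>. set_mset \<beta> \<subseteq> minor_index m n} \<union> qmatrix_ideal q m n)"
    by (auto simp: lift_def lifts_def)
  then have "\<exists>A \<subseteq> lift I. finite A \<and> (\<forall>J'. A \<subseteq> J' \<longrightarrow> qmatrix_ideal q m n \<subseteq> J' \<longrightarrow>
      nc.vs.subspace J' \<longrightarrow> (\<forall>\<gamma> x. set_mset \<gamma> \<subseteq> minor_index m n \<longrightarrow> x \<in> J' \<longrightarrow> T \<gamma> x \<in> J') \<longrightarrow> lift I \<subseteq> J')"
    by (intro W.noetherian_division finite_minor_index T_add T_scale T_N T_std subspace[OF I] T_lift[OF I])
  then obtain A where A: "A \<subseteq> lift I \<and> finite A \<and> (\<forall>J'. A \<subseteq> J' \<longrightarrow> qmatrix_ideal q m n \<subseteq> J' \<longrightarrow>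
      nc.vs.subspace J' \<longrightarrow> (\<forall>\<gamma> x. set_mset \<gamma> \<subseteq> minor_index m n \<longrightarrow> x \<in> J' \<longrightarrow> T \<gamma> x \<in> J') \<longrightarrow> lift I \<subseteq> J')" ..
  note A12 = conjunct1[OF A] conjunct1[OF conjunct2[OF A]] and A3 = conjunct2[OF conjunct2[OF A]]
  have AI: "proj q m n ` A \<subseteq> I" using A12(1) by (auto simp: lift_def)
  have "x \<in> I'" if I': "ideal_pred I'" "proj q m n ` A \<subseteq> I'" and x: "x \<in> I" for I' x
  proof -
    \<comment> \<open>The pullback of any competing ideal satisfies all closure conditions of
      \<open>noetherian_division\<close>, so it contains the pullback of \<open>I\<close>.\<close>
    have "A \<subseteq> lift I'" using A12(1) I'(2) by (auto simp: lift_def)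
    then have le: "lift I \<subseteq> lift I'"
      by (rule A3[rule_format, OF _ N[OF I'(1)] subspace[OF I'(1)] T_lift[OF I'(1)]])
    obtain p where "p \<in> lifts" "x = proj q m n p" using carrier_lifts sub[OF I] x by blast
    then show ?thesis using le x by (auto simp: lift_def)
  qed
  then have "I = \<Inter>{I. ideal_pred I \<and> proj q m n ` A \<subseteq> I}" using I AI by blast
  then show ?thesis using A12(2) AI sub[OF I] by (intro exI[of _ "proj q m n ` A"]) auto
qed

lemma std_carrier:
  "set_mset \<gamma> \<subseteq> minor_index m n \<Longrightarrow> proj q m n (W.std \<gamma>) \<in> carrier (quantum_grassmannian q m n)"
  "set_mset \<gamma> \<subseteq> minor_index m n \<Longrightarrow> W.std \<gamma> \<in> lifts"
  by (simp_all add: W.std_def mon_carrier mon_lifts)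

lemma left_noetherian: "left_noetherian_ring (quantum_grassmannian q m n)"
proof (intro left_noetherian_ring.intro quantum_grassmannian_ring left_noetherian_ring_axioms.intro)
  let ?G = "quantum_grassmannian q m n"
  fix I assume "left_ideal I ?G"
  then show "\<exists>A\<subseteq>carrier ?G. finite A \<and> I = gen_left_ideal ?G A"
    unfolding gen_left_ideal_def
  proof (rule side_noetherian[where T = "\<lambda>\<gamma> x. W.std \<gamma> * x", rotated -1])
    have mult: "proj q m n (y * x) \<in> I"
      if "left_ideal I ?G" "x \<in> lifts" "proj q m n x \<in> I" "y \<in> lifts" "proj q m n y \<in> carrier ?G" for I x y
    proof -
      have "proj q m n (y * x) = proj q m n y \<otimes>\<^bsub>qmatrix q m n\<^esub> proj q m n x"
        using that lifts_closed by (intro proj_hom) auto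
      then show ?thesis using left_ideal.I_l_closed[OF that(1,3,5)] by simp
    qed
    show "proj q m n (ncconst c * x) \<in> I" if "left_ideal I ?G" "x \<in> lifts" "proj q m n x \<in> I" for I c x
      using mult[OF that scalar_lifts scalar_carrier] .
    show "proj q m n (W.std \<gamma> * x) \<in> I"
      if "left_ideal I ?G" "set_mset \<gamma> \<subseteq> minor_index m n" "x \<in> lifts" "proj q m n x \<in> I" for I \<gamma> x
      using mult[OF that(1,3,4)] std_carrier[OF that(2)] by blast
    show "W.std \<gamma> * x \<in> qmatrix_ideal q m n"
      if "set_mset \<gamma> \<subseteq> minor_index m n" "x \<in> qmatrix_ideal q m n" for \<gamma> x
      using W.mon_N(1) that by (simp add: W.std_def)
    show "I \<subseteq> carrier ?G" if "left_ideal I ?G" for I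
      using additive_subgroup.a_subset[OF left_ideal.axioms(1)[OF that]] .
    show "\<zero>\<^bsub>qmatrix q m n\<^esub> \<in> I" if "left_ideal I ?G" for I
      using additive_subgroup.zero_closed[OF left_ideal.axioms(1)[OF that]] by simp
    show "x \<oplus>\<^bsub>qmatrix q m n\<^esub> y \<in> I" if "left_ideal I ?G" "x \<in> I" "y \<in> I" for I x y
      using additive_subgroup.a_closed[OF left_ideal.axioms(1)[OF that(1)] that(2,3)] by simp
  qed (auto simp: distrib_left nc.s_left_comm lifts_mult std_carrier W.std_mult_leading)
qed

lemma right_noetherian: "right_noetherian_ring (quantum_grassmannian q m n)"
proof (intro right_noetherian_ring.intro quantum_grassmannian_ring right_noetherian_ring_axioms.intro)
  let ?G = "quantum_grassmannian q m n"
  fix I assume "right_ideal I ?G"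
  then show "\<exists>A\<subseteq>carrier ?G. finite A \<and> I = gen_right_ideal ?G A"
    unfolding gen_right_ideal_def
  proof (rule side_noetherian[where T = "\<lambda>\<gamma> x. x * W.std \<gamma>", rotated -1])
    have mult: "proj q m n (x * y) \<in> I"
      if "right_ideal I ?G" "x \<in> lifts" "proj q m n x \<in> I" "y \<in> lifts" "proj q m n y \<in> carrier ?G" for I x y
    proof -
      have "proj q m n (x * y) = proj q m n x \<otimes>\<^bsub>qmatrix q m n\<^esub> proj q m n y"
        using that lifts_closed by (intro proj_hom) auto
      then show ?thesis using right_ideal.I_r_closed[OF that(1,3,5)] by simp
    qed
    show "proj q m n (ncconst c * x) \<in> I" if "right_ideal I ?G" "x \<in> lifts" "proj q m n x \<in> I" for I c x
      using mult[OF that scalar_lifts scalar_carrier, of c] nc.s_comm[of x c] by simp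
    show "proj q m n (x * W.std \<gamma>) \<in> I"
      if "right_ideal I ?G" "set_mset \<gamma> \<subseteq> minor_index m n" "x \<in> lifts" "proj q m n x \<in> I" for I \<gamma> x
      using mult[OF that(1,3,4)] std_carrier[OF that(2)] by blast
    show "x * W.std \<gamma> \<in> qmatrix_ideal q m n"
      if "set_mset \<gamma> \<subseteq> minor_index m n" "x \<in> qmatrix_ideal q m n" for \<gamma> x
      using W.mon_N(2) that by (simp add: W.std_def)
    \<comment> \<open>Exponents add commutatively, so multiplication from the right has the same
      leading exponent.\<close>
    show "\<exists>c. c \<noteq> 0 \<and> W.std \<beta> * W.std \<gamma> - ncconst c * W.std (\<gamma> + \<beta>) \<in> W.below (\<gamma> + \<beta>)"
      if "set_mset \<beta> \<subseteq> minor_index m n" "set_mset \<gamma> \<subseteq> minor_index m n" for \<beta> \<gamma>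
      using W.std_mult_leading[OF that(2,1)] by (simp add: add.commute)
    show "I \<subseteq> carrier ?G" if "right_ideal I ?G" for I
      using additive_subgroup.a_subset[OF right_ideal.axioms(1)[OF that]] .
    show "\<zero>\<^bsub>qmatrix q m n\<^esub> \<in> I" if "right_ideal I ?G" for I
      using additive_subgroup.zero_closed[OF right_ideal.axioms(1)[OF that]] by simp
    show "x \<oplus>\<^bsub>qmatrix q m n\<^esub> y \<in> I" if "right_ideal I ?G" "x \<in> I" "y \<in> I" for I x y
      using additive_subgroup.a_closed[OF right_ideal.axioms(1)[OF that(1)] that(2,3)] by simp
  qed (auto simp: distrib_right mult.assoc lifts_mult std_carrier)
qed

text \<open>Integrality is inherited from the whole quantum matrix algebra, since the grassmannian
  is a subring.\<close>

lemma domain: "nc_domain (quantum_grassmannian q m n)"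
proof (intro nc_domain.intro quantum_grassmannian_ring nc_domain_axioms.intro)
  let ?G = "quantum_grassmannian q m n"
  have "rep q m n 1 \<noteq> 0" by (simp add: sc.ev_one)
  then show "\<one>\<^bsub>?G\<^esub> \<noteq> \<zero>\<^bsub>?G\<^esub>"
    using proj_eq_zero_iff[OF zero_one_free_algebra(2), of q m n] qmatrix_ideal_rep[OF q, of 1 m n]
    by (auto simp: proj_one)
  fix a b assume ab: "a \<otimes>\<^bsub>?G\<^esub> b = \<zero>\<^bsub>?G\<^esub>" "a \<in> carrier ?G" "b \<in> carrier ?G"
  obtain p where p: "p \<in> carrier (free_matrix_algebra m n)" "a = proj q m n p"
    using proj_surj ab(2) quantum_grassmannian_subset by blast
  obtain r where r: "r \<in> carrier (free_matrix_algebra m n)" "b = proj q m n r"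
    using proj_surj ab(3) quantum_grassmannian_subset by blast
  have "proj q m n (p * r) = \<zero>\<^bsub>qmatrix q m n\<^esub>" using ab(1) p r by (simp add: proj_hom)
  then have "p * r \<in> qmatrix_ideal q m n"
    using proj_eq_zero_iff free_algebra_closed(2)[OF p(1) r(1)] by blast
  then have "rep q m n p * rep q m n r = 0"
    using qmatrix_ideal_rep[OF q] sc.ev_mult[of "genop q m n" p r] by simp
  then have "p \<in> qmatrix_ideal q m n \<or> r \<in> qmatrix_ideal q m n"
    using rep_domain[OF q p(1) _ r(1)] by blast
  then show "a = \<zero>\<^bsub>?G\<^esub> \<or> b = \<zero>\<^bsub>?G\<^esub>"
    using p r proj_eq_zero_iff[OF p(1), of q] proj_eq_zero_iff[OF r(1), of q] by simp
qed

end

theorem theorem1p4: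
  fixes q :: "'k::field" and m n :: nat
  assumes "q \<noteq> 0" and "1 \<le> m" and "m \<le> n"
  shows "lr_noetherian_ring (quantum_grassmannian q m n) \<and> nc_domain (quantum_grassmannian q m n)"
proof -
  interpret grassmannian q m n by (rule grassmannian.intro) (rule assms(1))
  show ?thesis
    using left_noetherian right_noetherian domain by (simp add: lr_noetherian_ring_def)
qed

end
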